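(* Let $K$ be an infinite field, let $R=K[x,y,z]$ be a polynomial ring in three variables and let $I\subseteq R$ be a monomial ideal. Let $\operatorname{np}(I)\subseteq\mathbb{R}^3$ have a minimal set of hyperplanes $\mathbf{w}_1\cdot\mathbf{u}=b_1,\dots,\mathbf{w}_s\cdot\mathbf{u}=b_s$ and facet-defining halfspaces $\mathbf{h}_1\cdot\mathbf{u}\leq c_1,\dots,\mathbf{h}_t\cdot\mathbf{u}\leq c_t$. Suppose that there exist $\alpha_1,\dots,\alpha_s\in\mathbb{R}$ and $\beta_1,\dots,\beta_t\in\mathbb{R}_{\ge0}$ such that $$\mathbf{W}:=\sum_{i=1}^s\alpha_i\mathbf{w}_i+\sum_{j=1}^t\beta_j\mathbf{h}_j$$ has all negative entries, and let $k$ be the minimal number of non-zero $\beta_j$ needed to achieve this (over all such choices of $\alpha_i\in\mathbb R$, $\beta_j\in\mathbb{R}_{\ge 0}$). Then $$\ell(I)=4-(s+k).$$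
   Context: The Newton polytope of a monomial ideal $I$ in $K[x_1,\dots,x_n]$ is $\operatorname{np}(I)=\operatorname{conv}\{\mathbf b\in\mathbb{Z}_{\ge0}^n : \mathbf x^{\mathbf b}\in G(I)\}$, where $G(I)$ is the minimal set of monomial generators of $I$ and $\mathbf x^{\mathbf b}=x_1^{b_1}\cdots x_n^{b_n}$. The analytic spread of $I$ is $\ell(I)=\dim\left(R[It]\otimes_R R/\mathfrak m\right)$ (Krull dimension), where $R[It]$ is the Rees algebra and $\mathfrak m$ is the ideal generated by the variables. Hyperplane/halfspace description of a polytope $E\subseteq\mathbb{R}^n$: a minimal set of hyperplanes of $E$ is a set of hyperplanes $\mathbf w_i\cdot\mathbf u=b_i$ with the $\mathbf w_i$ linearly independent whose common intersection is the affine hull of $E$; the facet-defining halfspaces $\mathbf h_j\cdot\mathbf u\le c_j$ contain $E$, each supporting hyperplane $\mathbf h_j\cdot\mathbf u=c_j$ meets $E$ in a facet of $E$, and $E$ is the intersection of all the hyperplanes and halfspaces listed. Either list may be empty. *)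

theory Defs
  imports
    "HOL-Analysis.Analysis"
    "HOL-Algebra.Algebra"
    "HOL-Algebra.Algebraic_Closure_Type"
    "HOL-Library.Poly_Mapping"
    "HOL-Library.Numeral_Type"
    "HOL-Library.Extended_Real"
    "HOL-Computational_Algebra.Polynomial"
begin

text \<open>Polynomials over \<open>'k\<close> in variables indexed by \<open>'n\<close>; exponent vectors are
  finitely supported functions \<open>'n \<Rightarrow>\<^sub>0 nat\<close>, and the type-class product
  on \<open>_ \<Rightarrow>\<^sub>0 'k\<close> is the convolution product.\<close>

type_synonym ('n, 'k) mpoly = "('n \<Rightarrow>\<^sub>0 nat) \<Rightarrow>\<^sub>0 'k"

abbreviation poly_ring :: "('n, 'k::comm_ring_1) mpoly ring" where
  "poly_ring \<equiv> ring_of_type_algebra"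

definition monom_of :: "('n \<Rightarrow>\<^sub>0 nat) \<Rightarrow> ('n, 'k::comm_ring_1) mpoly" where
  "monom_of b = Poly_Mapping.single b 1"

definition irrelevant_ideal :: "('n, 'k::comm_ring_1) mpoly set" where
  "irrelevant_ideal = Idl\<^bsub>poly_ring\<^esub> (range (\<lambda>i. monom_of (Poly_Mapping.single i 1)))"

definition monomial_ideal :: "('n, 'k::comm_ring_1) mpoly set \<Rightarrow> bool" where
  "monomial_ideal I \<longleftrightarrow> (\<exists>M \<subseteq> range monom_of. I = Idl\<^bsub>poly_ring\<^esub> M)"

text \<open>For a monomial ideal over a nonzero ring the minimal set of monomial generators
  exists and is unique, so the description below denotes it.  It is empty for the zero ideal.\<close>

definition min_monomial_gens :: "('n, 'k::comm_ring_1) mpoly set \<Rightarrow> ('n, 'k) mpoly set" where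
  "min_monomial_gens I = (THE G. G \<subseteq> range monom_of \<and> Idl\<^bsub>poly_ring\<^esub> G = I \<and>
     (\<forall>H. H \<subset> G \<longrightarrow> Idl\<^bsub>poly_ring\<^esub> H \<noteq> I))"

definition newton_polytope :: "('n::finite, 'k::comm_ring_1) mpoly set \<Rightarrow> (real ^ 'n) set" where
  "newton_polytope I =
     convex hull ((\<lambda>b. \<chi> i. real (Poly_Mapping.lookup b i)) ` {b. monom_of b \<in> min_monomial_gens I})"

text \<open>The supremum is taken in the extended reals, so that the zero ring, which has no prime
  ideals, gets dimension \<open>-\<infinity>\<close>.\<close>

definition krull_dim :: "('a, 'm) ring_scheme \<Rightarrow> ereal" where
  "krull_dim S = Sup {ereal (real n) | n.
     \<exists>P :: nat \<Rightarrow> 'a set. (\<forall>i\<le>n. primeideal (P i) S) \<and> (\<forall>i<n. P i \<subset> P (Suc i))}"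

text \<open>The tensor product \<open>A \<otimes>\<^bsub>R\<^esub> B\<close> of two commutative \<open>R\<close>-algebras with
  structure maps \<open>f\<close> and \<open>g\<close>: the free abelian group on \<open>A \<times> B\<close>, with product
  \<open>(a, b) (a', b') = (a a', b b')\<close> extended bilinearly, modulo the usual bilinearity relations.
  The product of a basis element with a relation is again a relation, so the ideal generated by
  the relations is the subgroup they generate, and the underlying group is the tensor product
  of modules.\<close>

definition free_pair_ring ::
  "('a, 'm) ring_scheme \<Rightarrow> ('b, 'n) ring_scheme \<Rightarrow> (('a \<times> 'b) \<Rightarrow>\<^sub>0 int) ring" where
  "free_pair_ring A B =
     \<lparr> carrier = {F. Poly_Mapping.keys F \<subseteq> carrier A \<times> carrier B},
       monoid.mult = (\<lambda>F G. frag_extend (\<lambda>(a, b). frag_extend (\<lambda>(a', b').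
          frag_of (a \<otimes>\<^bsub>A\<^esub> a', b \<otimes>\<^bsub>B\<^esub> b')) G) F),
       one = frag_of (\<one>\<^bsub>A\<^esub>, \<one>\<^bsub>B\<^esub>),
       ring.zero = 0,
       add = (+) \<rparr>"

definition tensor_relations ::
  "('r, 'l) ring_scheme \<Rightarrow> ('a, 'm) ring_scheme \<Rightarrow> ('b, 'n) ring_scheme \<Rightarrow>
   ('r \<Rightarrow> 'a) \<Rightarrow> ('r \<Rightarrow> 'b) \<Rightarrow> (('a \<times> 'b) \<Rightarrow>\<^sub>0 int) set" where
  "tensor_relations R A B f g =
     {frag_of (a \<oplus>\<^bsub>A\<^esub> a', b) - frag_of (a, b) - frag_of (a', b) | a a' b.
        a \<in> carrier A \<and> a' \<in> carrier A \<and> b \<in> carrier B} \<union>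
     {frag_of (a, b \<oplus>\<^bsub>B\<^esub> b') - frag_of (a, b) - frag_of (a, b') | a b b'.
        a \<in> carrier A \<and> b \<in> carrier B \<and> b' \<in> carrier B} \<union>
     {frag_of (f r \<otimes>\<^bsub>A\<^esub> a, b) - frag_of (a, g r \<otimes>\<^bsub>B\<^esub> b) | r a b.
        r \<in> carrier R \<and> a \<in> carrier A \<and> b \<in> carrier B}"

definition tensor_algebra ::
  "('r, 'l) ring_scheme \<Rightarrow> ('a, 'm) ring_scheme \<Rightarrow> ('b, 'n) ring_scheme \<Rightarrow>
   ('r \<Rightarrow> 'a) \<Rightarrow> ('r \<Rightarrow> 'b) \<Rightarrow> (('a \<times> 'b) \<Rightarrow>\<^sub>0 int) set ring" where
  "tensor_algebra R A B f g =
     free_pair_ring A B Quot (Idl\<^bsub>free_pair_ring A B\<^esub> (tensor_relations R A B f g))"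

text \<open>The Rees algebra \<open>R[It]\<close> is the direct sum of the \<open>I\<^sup>i t\<^sup>i\<close>, a subring of \<open>R[t]\<close>.
  Powers of ideals are taken in the monoid of ideals of \<open>R\<close>, whose unit is \<open>R\<close>.\<close>

definition rees_algebra :: "('n, 'k::comm_ring_1) mpoly set \<Rightarrow> ('n, 'k) mpoly poly ring" where
  "rees_algebra I =
     ring_of_type_algebra \<lparr> carrier :=
       {p. \<forall>i. Polynomial.coeff p i \<in> I [^]\<^bsub>ideals_set poly_ring\<^esub> i} \<rparr>"

definition analytic_spread :: "('n, 'k::comm_ring_1) mpoly set \<Rightarrow> ereal" where
  "analytic_spread I = krull_dim
     (tensor_algebra poly_ring (rees_algebra I) (poly_ring Quot irrelevant_ideal)
        (\<lambda>r. [:r:]) (\<lambda>r. irrelevant_ideal +>\<^bsub>poly_ring\<^esub> r))"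

definition minimal_hyperplanes ::
  "'a::euclidean_space set \<Rightarrow> nat \<Rightarrow> (nat \<Rightarrow> 'a) \<Rightarrow> (nat \<Rightarrow> real) \<Rightarrow> bool" where
  "minimal_hyperplanes E s w b \<longleftrightarrow>
     inj_on w {..<s} \<and> independent (w ` {..<s}) \<and>
     (\<Inter>i<s. {u. w i \<bullet> u = b i}) = affine hull E"

text \<open>Facets are nonempty here, so a single point has no facet-defining halfspaces.\<close>

definition facet_defining_halfspaces ::
  "'a::euclidean_space set \<Rightarrow> nat \<Rightarrow> (nat \<Rightarrow> 'a) \<Rightarrow> (nat \<Rightarrow> real) \<Rightarrow> bool" where
  "facet_defining_halfspaces E t h c \<longleftrightarrow>
     (\<forall>j<t. E \<subseteq> {u. h j \<bullet> u \<le> c j} \<and> (E \<inter> {u. h j \<bullet> u = c j}) facet_of E)"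

definition polytope_description ::
  "'a::euclidean_space set \<Rightarrow> nat \<Rightarrow> (nat \<Rightarrow> 'a) \<Rightarrow> (nat \<Rightarrow> real) \<Rightarrow>
   nat \<Rightarrow> (nat \<Rightarrow> 'a) \<Rightarrow> (nat \<Rightarrow> real) \<Rightarrow> bool" where
  "polytope_description E s w b t h c \<longleftrightarrow>
     minimal_hyperplanes E s w b \<and> facet_defining_halfspaces E t h c \<and>
     E = (\<Inter>i<s. {u. w i \<bullet> u = b i}) \<inter> (\<Inter>j<t. {u. h j \<bullet> u \<le> c j})"

definition negative_combination ::
  "nat \<Rightarrow> (nat \<Rightarrow> real ^ 'n::finite) \<Rightarrow> nat \<Rightarrow> (nat \<Rightarrow> real ^ 'n) \<Rightarrow>
   (nat \<Rightarrow> real) \<Rightarrow> (nat \<Rightarrow> real) \<Rightarrow> bool" where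
  "negative_combination s w t h \<alpha> \<beta> \<longleftrightarrow>
     (\<forall>j<t. 0 \<le> \<beta> j) \<and>
     (\<forall>l. ((\<Sum>i<s. \<alpha> i *\<^sub>R w i) + (\<Sum>j<t. \<beta> j *\<^sub>R h j)) $ l < 0)"

end

theory Submission
  imports Defs
begin

text \<open>Call a face of the Newton polytope compact if it is exposed by a functional all of whose
  entries are negative.  Primes of the fiber ring are primes of the Rees algebra containing the
  variables.  Given such a prime \<open>Q\<close>, the generators \<open>x\<^sup>b t\<close> not in \<open>Q\<close> have exponents on a common
  compact face \<open>F\<close>: otherwise, by linear programming duality, a product of them is divisible by a
  variable.  Modulo \<open>Q\<close> the algebra is spanned by the lattice points of the cone over \<open>F\<close>, of which
  there are \<open>O(N^(dim F + 1))\<close> in degree at most \<open>N\<close>, while a chain of length \<open>n\<close> above \<open>Q\<close>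
  produces \<open>n\<close> algebraically independent elements; hence \<open>n \<le> dim F + 1\<close>.  Conversely the
  monomials off the faces in a flag of \<open>F\<close> span a chain of primes of that length.  So the analytic
  spread is one more than the largest dimension of a compact face.

  By Farkas and Caratheodory the functionals exposing a face of dimension \<open>d\<close> are combinations with
  at most \<open>3 - s - d\<close> facet normals, so \<open>k \<le> 3 - s - d\<close>.  Equality for some compact face is clear
  except when \<open>s = 0\<close> and \<open>k = 2\<close>, where two facets may meet in a vertex only; there it suffices that
  two distinct minimal generators always lie on a common compact face.\<close>

text \<open>The fiber ring is a quotient of a free abelian group on pairs, and the natural map back
  to the Rees algebra is determined only modulo the variables. Hence no isomorphism with a quotient
  of the Rees algebra is set up: only chains of primes are compared, and each prime absorbs the
  ambiguity by itself. The + 1 in dim F + 1 has two matching sources: points of the cone over F have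
  the degree in t as one more coordinate, and the flag of F ends with the empty face, which gives
  the prime spanned by all monomials other than 1. What ties the argument to three variables is the
  existence of a large compact face. The facets whose normals occur in a negative combination with k
  terms need not meet in a face of codimension k. With k = 0 the face is the polytope, with k = 1 a
  facet, and for s + k at least 3 a vertex is large enough; only for s = 0 and k = 2 an edge has to
  be found by other means.\<close>

abbreviation "lookup \<equiv> Poly_Mapping.lookup"
abbreviation "keys \<equiv> Poly_Mapping.keys"

section \<open>Constant coefficients and the ideal generated by the variables\<close>

lemma poly_mapping_single_induct [case_names add single]:
  fixes p :: "'a \<Rightarrow>\<^sub>0 'b::comm_monoid_add"
  assumes add: "\<And>p q. P p \<Longrightarrow> P q \<Longrightarrow> P (p + q)"
    and single: "\<And>a c. P (Poly_Mapping.single a c)"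
  shows "P p"
proof (induction p rule: update_induct)
  case const
  show ?case using single[of undefined 0] by simp
next
  case (update p a b)
  have "Poly_Mapping.update a b p = p + Poly_Mapping.single a b"
    using update(1)
    by (intro poly_mapping_eqI)
       (auto simp: lookup_update lookup_add lookup_single when_def in_keys_iff)
  then show ?case using add[OF update(3) single] by simp
qed

lemma plus_exponent_eq_0_iff [simp]:
  fixes a b :: "'n \<Rightarrow>\<^sub>0 nat"
  shows "a + b = 0 \<longleftrightarrow> a = 0 \<and> b = 0"
  by (metis add_is_0 lookup_add lookup_zero poly_mapping_eqI add_0)

text \<open>Natural exponents add up to 0 only if both are 0, so no cross terms reach the constant
  coefficient.\<close>

lemma lookup_mult_0:
  fixes p q :: "('n \<Rightarrow>\<^sub>0 nat) \<Rightarrow>\<^sub>0 'k::comm_ring_1"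
  shows "lookup (p * q) 0 = lookup p 0 * lookup q 0"
proof (induction p rule: poly_mapping_single_induct)
  case (add p p')
  then show ?case by (simp add: distrib_right lookup_add)
next
  case (single a c)
  show ?case
  proof (induction q rule: poly_mapping_single_induct)
    case (add p p')
    then show ?case by (simp add: distrib_left lookup_add)
  next
    case (single b d)
    show ?case by (simp add: mult_single lookup_single when_def)
  qed
qed

lemma single_Suc_0_nonzero [simp]: "Poly_Mapping.single x (Suc 0) \<noteq> 0"
  by (metis lookup_single_eq lookup_zero nat.distinct(1))

lemma irrelevant_ideal_ideal: "ideal (irrelevant_ideal :: ('n, 'k::comm_ring_1) mpoly set) poly_ring"
proof -
  interpret ring "poly_ring :: ('n, 'k) mpoly ring" by (rule ring_from_type_algebra)
  show ?thesis unfolding irrelevant_ideal_def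
    by (rule genideal_ideal) (simp add: ring_of_type_algebra_def)
qed

text \<open>Polynomials without constant term form an ideal that contains the variables. This makes
  the constant coefficient well defined on cosets of \<open>irrelevant_ideal\<close>.\<close>

lemma irrelevant_ideal_subset:
  "irrelevant_ideal \<subseteq> {p :: ('n, 'k::comm_ring_1) mpoly. lookup p 0 = 0}"
proof -
  interpret ring "poly_ring :: ('n, 'k) mpoly ring" by (rule ring_from_type_algebra)
  have "ideal {p :: ('n, 'k) mpoly. lookup p 0 = 0} poly_ring"
  proof (rule idealI)
    show "ring (poly_ring :: ('n, 'k) mpoly ring)" by (rule ring_from_type_algebra)
    show "subgroup {p :: ('n, 'k) mpoly. lookup p 0 = 0} (add_monoid poly_ring)"
    proof (rule group.subgroupI[OF a_group])
      fix a :: "('n, 'k) mpoly" assume a: "a \<in> {p. lookup p 0 = 0}"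
      have "\<ominus>\<^bsub>poly_ring\<^esub> a = - a"
        by (rule minus_equality) (auto simp: ring_of_type_algebra_def)
      then show "inv\<^bsub>add_monoid poly_ring\<^esub> a \<in> {p. lookup p 0 = 0}"
        using a by (simp add: a_inv_def)
    qed (auto simp: ring_of_type_algebra_def lookup_add intro: exI[of _ 0])
  qed (auto simp: ring_of_type_algebra_def lookup_mult_0)
  then show ?thesis unfolding irrelevant_ideal_def
    by (rule genideal_minimal) (auto simp: monom_of_def lookup_single when_def)
qed

subsection \<open>The tensor product as a quotient of the ring of pairs\<close>

context
  fixes A :: "('a, 'm) ring_scheme" and B :: "('b, 'n) ring_scheme"
  assumes crA: "cring A" and crB: "cring B"
begin

interpretation A: cring A by (rule crA)
interpretation B: cring B by (rule crB)

private abbreviation "S \<equiv> free_pair_ring A B"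

lemma carrier_free_pair_ring: "carrier S = {F. keys F \<subseteq> carrier A \<times> carrier B}"
  by (simp add: free_pair_ring_def)

lemma add_free_pair_ring: "x \<oplus>\<^bsub>S\<^esub> y = x + y"
  by (simp add: free_pair_ring_def)

lemma zero_free_pair_ring: "\<zero>\<^bsub>S\<^esub> = 0"
  by (simp add: free_pair_ring_def)

lemma one_free_pair_ring: "\<one>\<^bsub>S\<^esub> = frag_of (\<one>\<^bsub>A\<^esub>, \<one>\<^bsub>B\<^esub>)"
  by (simp add: free_pair_ring_def)

text \<open>Differences instead of sums, because \<open>frag_induction\<close> builds elements from
  zero, basis pairs and differences; the multiplicative laws are then checked on basis
  pairs.\<close>

lemma mult_free_pair_ring_diff_left: "(x - x') \<otimes>\<^bsub>S\<^esub> y = x \<otimes>\<^bsub>S\<^esub> y - x' \<otimes>\<^bsub>S\<^esub> y"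
  by (simp add: free_pair_ring_def frag_extend_diff)

text \<open>\<open>frag_extend\<close> is additive in its last argument, which in the product is the
  left factor; for the right factor the outer sum has to be unfolded.\<close>

lemma mult_free_pair_ring_diff_right: "x \<otimes>\<^bsub>S\<^esub> (y - y') = x \<otimes>\<^bsub>S\<^esub> y - x \<otimes>\<^bsub>S\<^esub> y'"
proof -
  have d: "frag_cmul c (u - v) = frag_cmul c u - frag_cmul c v" for c and u v :: "('a \<times> 'b) \<Rightarrow>\<^sub>0 int"
    by (intro poly_mapping_eqI) (simp add: lookup_minus algebra_simps)
  show ?thesis
    by (simp add: free_pair_ring_def frag_extend_diff case_prod_beta)
       (simp add: frag_extend_def[of _ x] d sum_subtractf case_prod_beta)
qed

lemma mult_free_pair_ring_zero: "0 \<otimes>\<^bsub>S\<^esub> y = 0" "x \<otimes>\<^bsub>S\<^esub> 0 = 0"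
  by (auto simp: free_pair_ring_def case_prod_beta frag_extend_eq_0)

lemma mult_free_pair_ring_of:
  "frag_of p \<otimes>\<^bsub>S\<^esub> frag_of q = frag_of (fst p \<otimes>\<^bsub>A\<^esub> fst q, snd p \<otimes>\<^bsub>B\<^esub> snd q)"
  by (simp add: free_pair_ring_def case_prod_beta)

lemmas mult_free_pair_ring = mult_free_pair_ring_diff_left mult_free_pair_ring_diff_right
  mult_free_pair_ring_zero mult_free_pair_ring_of

lemma mult_free_pair_ring_closed:
  assumes "x \<in> carrier S" "y \<in> carrier S"
  shows "x \<otimes>\<^bsub>S\<^esub> y \<in> carrier S"
  using assms(1)[unfolded carrier_free_pair_ring mem_Collect_eq]
proof (induction x rule: frag_induction)
  case (one p)
  show ?case using assms(2)[unfolded carrier_free_pair_ring mem_Collect_eq]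
  proof (induction y rule: frag_induction)
    case (one q)
    then show ?case using \<open>p \<in> _\<close> by (auto simp: mult_free_pair_ring carrier_free_pair_ring)
  next
    case (diff a b)
    then show ?case using keys_diff[of "frag_of p \<otimes>\<^bsub>S\<^esub> a" "frag_of p \<otimes>\<^bsub>S\<^esub> b"]
      unfolding mult_free_pair_ring_diff_right carrier_free_pair_ring mem_Collect_eq by blast
  qed (auto simp: mult_free_pair_ring_zero carrier_free_pair_ring)
next
  case (diff a b)
  then show ?case using keys_diff[of "a \<otimes>\<^bsub>S\<^esub> y" "b \<otimes>\<^bsub>S\<^esub> y"]
    unfolding mult_free_pair_ring_diff_left carrier_free_pair_ring mem_Collect_eq by blast
qed (auto simp: mult_free_pair_ring_zero carrier_free_pair_ring)

lemma mult_free_pair_ring_comm: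
  assumes "x \<in> carrier S" "y \<in> carrier S"
  shows "x \<otimes>\<^bsub>S\<^esub> y = y \<otimes>\<^bsub>S\<^esub> x"
  using assms(1)[unfolded carrier_free_pair_ring mem_Collect_eq]
proof (induction x rule: frag_induction)
  case (one p)
  show ?case using assms(2)[unfolded carrier_free_pair_ring mem_Collect_eq]
  proof (induction y rule: frag_induction)
    case (one q)
    then show ?case using \<open>p \<in> _\<close> by (simp add: mult_free_pair_ring mem_Times_iff A.m_comm[of "fst p"] B.m_comm[of "snd p"])
  qed (auto simp: mult_free_pair_ring)
qed (auto simp: mult_free_pair_ring)

lemma mult_free_pair_ring_assoc:
  assumes "x \<in> carrier S" "y \<in> carrier S" "z \<in> carrier S"
  shows "x \<otimes>\<^bsub>S\<^esub> y \<otimes>\<^bsub>S\<^esub> z = x \<otimes>\<^bsub>S\<^esub> (y \<otimes>\<^bsub>S\<^esub> z)"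
  using assms(1)[unfolded carrier_free_pair_ring mem_Collect_eq]
proof (induction x rule: frag_induction)
  case (one p)
  show ?case using assms(2)[unfolded carrier_free_pair_ring mem_Collect_eq]
  proof (induction y rule: frag_induction)
    case (one q)
    show ?case using assms(3)[unfolded carrier_free_pair_ring mem_Collect_eq]
    proof (induction z rule: frag_induction)
      case (one r)
      then show ?case using \<open>p \<in> _\<close> \<open>q \<in> _\<close> by (simp add: mult_free_pair_ring mem_Times_iff A.m_assoc B.m_assoc)
    qed (auto simp: mult_free_pair_ring)
  qed (auto simp: mult_free_pair_ring)
qed (auto simp: mult_free_pair_ring)

lemma mult_free_pair_ring_one:
  assumes "x \<in> carrier S"
  shows "\<one>\<^bsub>S\<^esub> \<otimes>\<^bsub>S\<^esub> x = x"
  using assms(1)[unfolded carrier_free_pair_ring mem_Collect_eq]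
  by (induction x rule: frag_induction) (auto simp: mult_free_pair_ring one_free_pair_ring)

lemma mult_free_pair_ring_add_left: "(x + x') \<otimes>\<^bsub>S\<^esub> y = x \<otimes>\<^bsub>S\<^esub> y + x' \<otimes>\<^bsub>S\<^esub> y"
  using mult_free_pair_ring_diff_left[of "x + x'" x' y] by simp

lemma cring_free_pair_ring: "cring S"
proof (rule cringI)
  show "abelian_group S"
  proof (rule abelian_groupI)
    fix x y assume "x \<in> carrier S" "y \<in> carrier S"
    then show "x \<oplus>\<^bsub>S\<^esub> y \<in> carrier S"
      using keys_add[of x y] by (auto simp: carrier_free_pair_ring add_free_pair_ring)
  next
    fix x assume x: "x \<in> carrier S"
    then show "\<exists>y\<in>carrier S. y \<oplus>\<^bsub>S\<^esub> x = \<zero>\<^bsub>S\<^esub>"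
      by (intro bexI[of _ "- x"])
         (auto simp: carrier_free_pair_ring add_free_pair_ring zero_free_pair_ring)
  qed (auto simp: carrier_free_pair_ring add_free_pair_ring zero_free_pair_ring algebra_simps)
  show "Group.comm_monoid S"
    by (rule comm_monoidI)
       (auto intro: mult_free_pair_ring_closed mult_free_pair_ring_comm
         mult_free_pair_ring_assoc mult_free_pair_ring_one,
        auto simp: one_free_pair_ring carrier_free_pair_ring)
qed (auto simp: add_free_pair_ring mult_free_pair_ring_add_left)

lemma minus_free_pair_ring:
  assumes "x \<in> carrier S" "y \<in> carrier S"
  shows "x \<ominus>\<^bsub>S\<^esub> y = x - y"
proof -
  interpret cring S by (rule cring_free_pair_ring)
  have m: "- y \<in> carrier S" using assms by (auto simp: carrier_free_pair_ring)
  have "\<ominus>\<^bsub>S\<^esub> y = - y"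
    by (rule minus_equality) (use assms m in \<open>auto simp: add_free_pair_ring zero_free_pair_ring\<close>)
  then show ?thesis by (simp add: a_minus_def add_free_pair_ring)
qed

end

text \<open>As \<open>P\<close> contains \<open>J\<close>, membership in \<open>P\<close> depends
  only on the coset modulo \<open>J\<close>, so primeness can be tested on representatives.\<close>

lemma primeideal_quotient_image:
  assumes "cring R" "ideal J R" "primeideal P R" "J \<subseteq> P"
  shows "primeideal ((+>\<^bsub>R\<^esub>) J ` P) (R Quot J)"
    and "\<And>x. x \<in> carrier R \<Longrightarrow> J +>\<^bsub>R\<^esub> x \<in> (+>\<^bsub>R\<^esub>) J ` P \<longleftrightarrow> x \<in> P"
proof -
  interpret R: cring R by fact
  interpret J: ideal J R by fact
  interpret P: primeideal P R by fact
  show mem: "J +>\<^bsub>R\<^esub> x \<in> (+>\<^bsub>R\<^esub>) J ` P \<longleftrightarrow> x \<in> P" if x: "x \<in> carrier R" for x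
  proof
    assume "J +>\<^bsub>R\<^esub> x \<in> (+>\<^bsub>R\<^esub>) J ` P"
    then obtain y where y: "y \<in> P" "J +>\<^bsub>R\<^esub> x = J +>\<^bsub>R\<^esub> y" by auto
    have "x \<ominus>\<^bsub>R\<^esub> y \<in> J"
      using R.quotient_eq_iff_same_a_r_cos[OF assms(2) x] y P.a_Hcarr by blast
    then have "x \<ominus>\<^bsub>R\<^esub> y \<in> P" using assms by auto
    then have "(x \<ominus>\<^bsub>R\<^esub> y) \<oplus>\<^bsub>R\<^esub> y \<in> P" using y P.a_closed by blast
    then show "x \<in> P" using x y P.a_Hcarr by (simp add: a_minus_def R.a_assoc R.l_neg)
  qed auto
  show "primeideal ((+>\<^bsub>R\<^esub>) J ` P) (R Quot J)"
  proof (rule primeidealI)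
    show "ideal ((+>\<^bsub>R\<^esub>) J ` P) (R Quot J)"
      using R.ring_ideal_imp_quot_ideal[OF assms(2) P.is_ideal] .
    show "cring (R Quot J)" by (rule J.quotient_is_cring[OF assms(1)])
    show "carrier (R Quot J) \<noteq> (+>\<^bsub>R\<^esub>) J ` P"
    proof
      assume "carrier (R Quot J) = (+>\<^bsub>R\<^esub>) J ` P"
      then have "J +>\<^bsub>R\<^esub> x \<in> (+>\<^bsub>R\<^esub>) J ` P" if "x \<in> carrier R" for x
        using that by (auto simp: FactRing_def A_RCOSETS_def')
      then have "carrier R \<subseteq> P" using mem by blast
      then show False using P.I_notcarr P.a_subset by blast
    qed
    fix a b assume "a \<in> carrier (R Quot J)" "b \<in> carrier (R Quot J)"
      and ab: "a \<otimes>\<^bsub>R Quot J\<^esub> b \<in> (+>\<^bsub>R\<^esub>) J ` P"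
    then obtain x y where x: "x \<in> carrier R" "a = J +>\<^bsub>R\<^esub> x" and y: "y \<in> carrier R" "b = J +>\<^bsub>R\<^esub> y"
      by (auto simp: FactRing_def A_RCOSETS_def')
    have "J +>\<^bsub>R\<^esub> (x \<otimes>\<^bsub>R\<^esub> y) \<in> (+>\<^bsub>R\<^esub>) J ` P"
      using ab x y J.rcoset_mult_add[of x y] by (simp add: FactRing_def)
    then have "x \<in> P \<or> y \<in> P" using mem x y P.I_prime by auto
    then show "a \<in> (+>\<^bsub>R\<^esub>) J ` P \<or> b \<in> (+>\<^bsub>R\<^esub>) J ` P" using x y by auto
  qed
qed


subsection \<open>Primes of the fiber ring\<close>

definition fiber_ring :: "('n, 'k::comm_ring_1) mpoly poly ring \<Rightarrow>
    (('n, 'k) mpoly poly \<times> ('n, 'k) mpoly set \<Rightarrow>\<^sub>0 int) set ring" where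
  "fiber_ring A = tensor_algebra poly_ring A (poly_ring Quot irrelevant_ideal)
     (\<lambda>r. [:r:]) (\<lambda>r. irrelevant_ideal +>\<^bsub>poly_ring\<^esub> r)"

text \<open>For comparing primes, the Rees algebra enters just as a subring of R[t] that contains
  R.\<close>

locale poly_subalgebra =
  fixes C :: "('n::finite, 'k::field) mpoly poly set"
  assumes const_mem: "[:r:] \<in> C"
    and add_mem: "p \<in> C \<Longrightarrow> q \<in> C \<Longrightarrow> p + q \<in> C"
    and mult_mem: "p \<in> C \<Longrightarrow> q \<in> C \<Longrightarrow> p * q \<in> C"
begin

definition A :: "('n, 'k) mpoly poly ring" where "A = ring_of_type_algebra\<lparr>carrier := C\<rparr>"

lemma A_simps [simp]:
  "carrier A = C" "p \<otimes>\<^bsub>A\<^esub> q = p * q" "p \<oplus>\<^bsub>A\<^esub> q = p + q" "\<zero>\<^bsub>A\<^esub> = 0" "\<one>\<^bsub>A\<^esub> = 1"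
  by (simp_all add: A_def ring_of_type_algebra_def)

lemma zero_mem: "0 \<in> C" and one_mem: "1 \<in> C"
  using const_mem[of 0] const_mem[of 1] by (simp_all add: one_pCons)

lemma uminus_mem: "p \<in> C \<Longrightarrow> - p \<in> C"
  using mult_mem[OF const_mem[of "-1"], of p] by simp

lemma diff_mem: "p \<in> C \<Longrightarrow> q \<in> C \<Longrightarrow> p - q \<in> C"
  using add_mem[of p "- q"] uminus_mem[of q] by simp

lemma cring_A: "cring A"
proof (rule cringI)
  show "abelian_group A"
    by (rule abelian_groupI)
       (auto simp: zero_mem add_mem algebra_simps intro: bexI[of _ "- _"] uminus_mem)
  show "Group.comm_monoid A"
    by (rule comm_monoidI) (auto simp: one_mem mult_mem algebra_simps)
qed (auto simp: algebra_simps)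

sublocale A: cring A by (rule cring_A)

abbreviation "K \<equiv> poly_ring Quot (irrelevant_ideal :: ('n, 'k) mpoly set)"

lemma cring_K: "cring K"
  by (rule ideal.quotient_is_cring[OF irrelevant_ideal_ideal cring_from_type_algebra])

definition S :: "(('n, 'k) mpoly poly \<times> ('n, 'k) mpoly set \<Rightarrow>\<^sub>0 int) ring" where
  "S = free_pair_ring A K"

sublocale K: cring K by (rule cring_K)
sublocale S: cring S unfolding S_def by (rule cring_free_pair_ring[OF cring_A cring_K])

definition rels :: "(('n, 'k) mpoly poly \<times> ('n, 'k) mpoly set \<Rightarrow>\<^sub>0 int) set" where
  "rels = tensor_relations poly_ring A K (\<lambda>r. [:r:]) (\<lambda>r. irrelevant_ideal +>\<^bsub>poly_ring\<^esub> r)"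

definition J :: "(('n, 'k) mpoly poly \<times> ('n, 'k) mpoly set \<Rightarrow>\<^sub>0 int) set" where
  "J = Idl\<^bsub>S\<^esub> rels"

lemma fiber_ring_eq: "fiber_ring A = S Quot J"
  by (simp add: fiber_ring_def tensor_algebra_def S_def J_def rels_def)

lemmas S_carrier = carrier_free_pair_ring[OF cring_A cring_K, folded S_def]
  and S_add = add_free_pair_ring[OF cring_A cring_K, folded S_def]
  and S_zero = zero_free_pair_ring[OF cring_A cring_K, folded S_def]
  and S_one = one_free_pair_ring[OF cring_A cring_K, folded S_def]
  and S_minus = minus_free_pair_ring[OF cring_A cring_K, folded S_def]
  and S_mult = mult_free_pair_ring[OF cring_A cring_K, folded S_def]

lemma coset_closed: "irrelevant_ideal +>\<^bsub>poly_ring\<^esub> r \<in> carrier K" for r :: "('n, 'k) mpoly"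
  by (auto simp: FactRing_def A_RCOSETS_def' ring_of_type_algebra_def)

lemma frag_of_mem: "p \<in> C \<Longrightarrow> Z \<in> carrier K \<Longrightarrow> frag_of (p, Z) \<in> carrier S"
  by (auto simp: S_carrier)

lemma frag_diff_mem: "x \<in> carrier S \<Longrightarrow> y \<in> carrier S \<Longrightarrow> x - y \<in> carrier S"
  using S_minus S.minus_closed by metis

lemma rels_subset: "rels \<subseteq> carrier S"
  unfolding rels_def tensor_relations_def
  by (auto simp: FactRing_def[symmetric] intro!: frag_diff_mem frag_of_mem add_mem mult_mem[OF const_mem, simplified]
      K.add.m_closed K.m_closed coset_closed)

lemma J_ideal: "ideal J S"
  unfolding J_def by (rule S.genideal_ideal[OF rels_subset])

lemma rels_in_J: "rels \<subseteq> J"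
  unfolding J_def by (rule S.genideal_self[OF rels_subset])

interpretation J: ideal J S by (rule J_ideal)

lemma J_diff: "x \<in> J \<Longrightarrow> y \<in> J \<Longrightarrow> x - y \<in> J"
  using S_minus[of x y] J.a_Hcarr J.a_closed J.a_inv_closed by (metis a_minus_def)

lemma J_add: "x \<in> J \<Longrightarrow> y \<in> J \<Longrightarrow> x + y \<in> J"
  using J.a_closed by (simp add: S_add)

lemma J_uminus: "x \<in> J \<Longrightarrow> - x \<in> J"
  using J_diff[of 0 x] J.zero_closed by (simp add: S_zero)

lemma rel_add_left: "p \<in> C \<Longrightarrow> q \<in> C \<Longrightarrow> Z \<in> carrier K \<Longrightarrow>
    frag_of (p + q, Z) - frag_of (p, Z) - frag_of (q, Z) \<in> J"
  by (rule subsetD[OF rels_in_J]) (force simp: rels_def tensor_relations_def)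

lemma rel_add_right: "p \<in> C \<Longrightarrow> Z \<in> carrier K \<Longrightarrow> Y \<in> carrier K \<Longrightarrow>
    frag_of (p, Z \<oplus>\<^bsub>K\<^esub> Y) - frag_of (p, Z) - frag_of (p, Y) \<in> J"
  by (rule subsetD[OF rels_in_J]) (force simp: rels_def tensor_relations_def)

lemma rel_scalar: "p \<in> C \<Longrightarrow> Z \<in> carrier K \<Longrightarrow>
    frag_of ([:r:] * p, Z) - frag_of (p, (irrelevant_ideal +>\<^bsub>poly_ring\<^esub> r) \<otimes>\<^bsub>K\<^esub> Z) \<in> J"
  by (rule subsetD[OF rels_in_J]) (force simp: rels_def tensor_relations_def ring_of_type_algebra_def)

text \<open>The canonical map of the algebra into the tensor product, sending \<open>p\<close> to
  its tensor with 1.\<close>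

definition \<phi> :: "('n, 'k) mpoly poly \<Rightarrow> (('n, 'k) mpoly poly \<times> ('n, 'k) mpoly set \<Rightarrow>\<^sub>0 int) set" where
  "\<phi> p = J +>\<^bsub>S\<^esub> frag_of (p, \<one>\<^bsub>K\<^esub>)"

lemma coset_eq_iff: "x \<in> carrier S \<Longrightarrow> y \<in> carrier S \<Longrightarrow> J +>\<^bsub>S\<^esub> x = J +>\<^bsub>S\<^esub> y \<longleftrightarrow> x - y \<in> J"
  using S.quotient_eq_iff_same_a_r_cos[OF J_ideal] S_minus by auto

lemma \<phi>_hom: "ring_hom_ring A (fiber_ring A) \<phi>"
  unfolding fiber_ring_eq
proof (rule ring_hom_ringI)
  show "ring A" by (rule A.ring_axioms)
  show "ring (S Quot J)" by (rule J.quotient_is_ring)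
  show "\<phi> p \<in> carrier (S Quot J)" if "p \<in> carrier A" for p
    using that frag_of_mem[OF _ K.one_closed] by (auto simp: \<phi>_def FactRing_def A_RCOSETS_def')
  show "\<phi> (p \<otimes>\<^bsub>A\<^esub> q) = \<phi> p \<otimes>\<^bsub>S Quot J\<^esub> \<phi> q" if "p \<in> carrier A" "q \<in> carrier A" for p q
  proof -
    have "\<phi> p \<otimes>\<^bsub>S Quot J\<^esub> \<phi> q = J +>\<^bsub>S\<^esub> (frag_of (p, \<one>\<^bsub>K\<^esub>) \<otimes>\<^bsub>S\<^esub> frag_of (q, \<one>\<^bsub>K\<^esub>))"
      using that J.rcoset_mult_add[of "frag_of (p, \<one>\<^bsub>K\<^esub>)" "frag_of (q, \<one>\<^bsub>K\<^esub>)"]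
        frag_of_mem[OF _ K.one_closed] by (simp add: \<phi>_def FactRing_def[of S])
    then show ?thesis using that by (simp add: S_mult \<phi>_def K.l_one[OF K.one_closed])
  qed
  show "\<phi> (p \<oplus>\<^bsub>A\<^esub> q) = \<phi> p \<oplus>\<^bsub>S Quot J\<^esub> \<phi> q" if "p \<in> carrier A" "q \<in> carrier A" for p q
  proof -
    have m: "frag_of (p, \<one>\<^bsub>K\<^esub>) \<in> carrier S" "frag_of (q, \<one>\<^bsub>K\<^esub>) \<in> carrier S"
      "frag_of (p + q, \<one>\<^bsub>K\<^esub>) \<in> carrier S"
      using that by (auto intro!: frag_of_mem add_mem)
    have "\<phi> p \<oplus>\<^bsub>S Quot J\<^esub> \<phi> q = J +>\<^bsub>S\<^esub> (frag_of (p, \<one>\<^bsub>K\<^esub>) \<oplus>\<^bsub>S\<^esub> frag_of (q, \<one>\<^bsub>K\<^esub>))"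
      using J.a_rcos_sum[OF m(1,2)] by (simp add: \<phi>_def FactRing_def[of S])
    also have "\<dots> = \<phi> (p + q)"
      unfolding \<phi>_def
      using coset_eq_iff[OF S.add.m_closed[OF m(1,2)] m(3)] J_uminus[OF rel_add_left[of p q "\<one>\<^bsub>K\<^esub>"]] that
      by (simp add: S_add algebra_simps)
    finally show ?thesis by simp
  qed
  show "\<phi> \<one>\<^bsub>A\<^esub> = \<one>\<^bsub>S Quot J\<^esub>"
    by (simp add: \<phi>_def FactRing_def[of S] S_one)
qed

text \<open>The second entry of a pair is the coset of some \<open>r\<close>, and the scalar
  relation moves \<open>r\<close> over to the first entry.\<close>

lemma \<phi>_surj: "Z \<in> carrier (fiber_ring A) \<Longrightarrow> \<exists>p\<in>C. Z = \<phi> p"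
proof -
  assume "Z \<in> carrier (fiber_ring A)"
  then obtain F where F: "F \<in> carrier S" "Z = J +>\<^bsub>S\<^esub> F"
    by (auto simp: fiber_ring_eq FactRing_def A_RCOSETS_def')
  have "\<exists>p\<in>C. F - frag_of (p, \<one>\<^bsub>K\<^esub>) \<in> J"
    using F(1)[unfolded S_carrier mem_Collect_eq]
  proof (induction F rule: frag_induction)
    case zero
    \<comment> \<open>Additivity for 0 + 0 leaves the negative of this pair.\<close>
    have "frag_of (0, \<one>\<^bsub>K\<^esub>) \<in> J"
      using J_uminus[OF rel_add_left[OF zero_mem zero_mem K.one_closed]] by simp
    then show ?case using zero_mem J_uminus by force
  next
    case (one x)
    obtain p r where x: "x = (p, irrelevant_ideal +>\<^bsub>poly_ring\<^esub> r)" "p \<in> C"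
      using one by (cases x) (auto simp: FactRing_def A_RCOSETS_def' ring_of_type_algebra_def)
    show ?case using J_uminus[OF rel_scalar[OF x(2) K.one_closed, of r]] x mult_mem[OF const_mem x(2), of r]
      by (intro bexI[of _ "[:r:] * p"]) (simp_all add: K.r_one[OF coset_closed])
  next
    case (diff a b)
    then obtain p q where pq: "p \<in> C" "a - frag_of (p, \<one>\<^bsub>K\<^esub>) \<in> J" "q \<in> C" "b - frag_of (q, \<one>\<^bsub>K\<^esub>) \<in> J"
      by blast
    have "frag_of (p, \<one>\<^bsub>K\<^esub>) - frag_of (p - q, \<one>\<^bsub>K\<^esub>) - frag_of (q, \<one>\<^bsub>K\<^esub>) \<in> J"
      using rel_add_left[OF diff_mem[OF pq(1,3)] pq(3) K.one_closed] by simp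
    from J_add[OF J_diff[OF pq(2,4)] this] show ?case
      using diff_mem[OF pq(1,3)] by (intro bexI[of _ "p - q"]) (simp_all add: algebra_simps)
  qed
  then obtain p where "p \<in> C" "F - frag_of (p, \<one>\<^bsub>K\<^esub>) \<in> J" by blast
  then show ?thesis using F coset_eq_iff[OF F(1) frag_of_mem[OF _ K.one_closed]] by (auto simp: \<phi>_def)
qed

text \<open>Moved across the tensor sign, a variable becomes its coset, which is zero.\<close>

lemma \<phi>_var:
  assumes "p \<in> C"
  shows "\<phi> ([:monom_of (Poly_Mapping.single l 1):] * p) = \<zero>\<^bsub>fiber_ring A\<^esub>"
proof -
  let ?x = "monom_of (Poly_Mapping.single l 1) :: ('n, 'k) mpoly"
  interpret R: ring "poly_ring :: ('n, 'k) mpoly ring" by (rule ring_from_type_algebra)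
  have "?x \<in> irrelevant_ideal"
    unfolding irrelevant_ideal_def
    by (rule subsetD[OF R.genideal_self]) (auto simp: ring_of_type_algebra_def)
  then have "irrelevant_ideal +>\<^bsub>poly_ring\<^esub> ?x = \<zero>\<^bsub>K\<^esub>"
    using R.a_coset_join2[OF _ additive_subgroup.a_subgroup[OF ideal.axioms(1)[OF irrelevant_ideal_ideal]]]
    by (simp add: FactRing_def) (simp add: ring_of_type_algebra_def)
  then have "frag_of ([:?x:] * p, \<one>\<^bsub>K\<^esub>) - frag_of (p, \<zero>\<^bsub>K\<^esub>) \<in> J"
    using rel_scalar[OF assms K.one_closed, of ?x] by (simp add: K.l_null)
  moreover have "frag_of (p, \<zero>\<^bsub>K\<^esub>) \<in> J"
    using J_uminus[OF rel_add_right[OF assms K.zero_closed K.zero_closed]] by (simp add: K.l_zero)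
  ultimately have "frag_of ([:?x:] * p, \<one>\<^bsub>K\<^esub>) \<in> J" using J_add by fastforce
  then show ?thesis unfolding \<phi>_def fiber_ring_eq
    using S.a_coset_join2[of "frag_of ([:?x:] * p, \<one>\<^bsub>K\<^esub>)" J] J.a_subgroup J.a_Hcarr
    by (simp add: FactRing_def)
qed

text \<open>The primes of \<open>A\<close> that correspond to primes of the fiber ring.\<close>

definition fprime :: "('n, 'k) mpoly poly set \<Rightarrow> bool" where
  "fprime Q \<longleftrightarrow> primeideal Q A \<and> (\<forall>l. \<forall>p\<in>C. [:monom_of (Poly_Mapping.single l 1):] * p \<in> Q)"

lemma prime_vimage_\<phi>:
  assumes "primeideal P (fiber_ring A)"
  shows "fprime {p \<in> C. \<phi> p \<in> P}"
proof -
  interpret P: primeideal P "fiber_ring A" by fact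
  have "primeideal {p \<in> carrier A. \<phi> p \<in> P} A"
    by (rule ring_hom_ring.primeideal_vimage[OF \<phi>_hom cring_A assms])
  then show ?thesis
    using \<phi>_var P.zero_closed mult_mem[OF const_mem] by (auto simp: fprime_def)
qed


text \<open>The residue field is the coefficient field; its elements are returned as constant
  polynomials so that they can multiply elements of the algebra. The choice of representative does
  not matter, since members of \<open>irrelevant_ideal\<close> have no constant term.\<close>

definition const_coset :: "('n, 'k) mpoly set \<Rightarrow> ('n, 'k) mpoly" where
  "const_coset Z = Poly_Mapping.single 0 (lookup (SOME r. r \<in> Z) 0)"

lemma const_coset: "const_coset (irrelevant_ideal +>\<^bsub>poly_ring\<^esub> r) = Poly_Mapping.single 0 (lookup r 0)"
proof -
  interpret R: ring "poly_ring :: ('n, 'k) mpoly ring" by (rule ring_from_type_algebra)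
  have "lookup u 0 = lookup r 0" if "u \<in> irrelevant_ideal +>\<^bsub>poly_ring\<^esub> r" for u
    using that irrelevant_ideal_subset
    by (fastforce simp: a_r_coset_def' ring_of_type_algebra_def lookup_add)
  moreover have "r \<in> irrelevant_ideal +>\<^bsub>poly_ring\<^esub> r"
    using ideal.Icarr[OF irrelevant_ideal_ideal] additive_subgroup.zero_closed[OF ideal.axioms(1)[OF irrelevant_ideal_ideal]]
    by (force simp: a_r_coset_def' ring_of_type_algebra_def)
  ultimately show ?thesis unfolding const_coset_def by (metis someI)
qed

lemma K_cases:
  assumes "Z \<in> carrier K"
  obtains r where "Z = irrelevant_ideal +>\<^bsub>poly_ring\<^esub> r"
  using assms by (auto simp: FactRing_def A_RCOSETS_def' ring_of_type_algebra_def)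

lemma K_hom:
  "const_coset (Z \<oplus>\<^bsub>K\<^esub> Y) = const_coset Z + const_coset Y"
  "const_coset (Z \<otimes>\<^bsub>K\<^esub> Y) = const_coset Z * const_coset Y"
  "const_coset \<one>\<^bsub>K\<^esub> = 1"
  if Z: "Z \<in> carrier K" and Y: "Y \<in> carrier K"
proof -
  obtain r s where rs: "Z = irrelevant_ideal +>\<^bsub>poly_ring\<^esub> r" "Y = irrelevant_ideal +>\<^bsub>poly_ring\<^esub> s"
    using K_cases[OF Z] K_cases[OF Y] by metis
  interpret I: ideal "irrelevant_ideal :: ('n, 'k) mpoly set" poly_ring by (rule irrelevant_ideal_ideal)
  show "const_coset (Z \<oplus>\<^bsub>K\<^esub> Y) = const_coset Z + const_coset Y"
    using I.a_rcos_sum[of r s]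
    by (simp add: rs FactRing_def ring_of_type_algebra_def const_coset[unfolded ring_of_type_algebra_def]
        lookup_add single_add)
  show "const_coset (Z \<otimes>\<^bsub>K\<^esub> Y) = const_coset Z * const_coset Y"
    using I.rcoset_mult_add[of r s]
    by (simp add: rs FactRing_def ring_of_type_algebra_def const_coset[unfolded ring_of_type_algebra_def]
        lookup_mult_0 mult_single)
  show "const_coset \<one>\<^bsub>K\<^esub> = 1"
    using const_coset[of 1]
    by (simp add: FactRing_def ring_of_type_algebra_def)
qed

text \<open>A left inverse of \<open>\<phi>\<close>, well defined only modulo the ideal generated by the variables.\<close>

definition ev :: "(('n, 'k) mpoly poly \<times> ('n, 'k) mpoly set \<Rightarrow>\<^sub>0 int) \<Rightarrow> ('n, 'k) mpoly poly" where
  "ev F = (\<Sum>x\<in>keys F. of_int (lookup F x) * ([:const_coset (snd x):] * fst x))"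

lemma ev_superset:
  assumes "finite Z" "keys F \<subseteq> Z"
  shows "ev F = (\<Sum>x\<in>Z. of_int (lookup F x) * ([:const_coset (snd x):] * fst x))"
  unfolding ev_def using assms
  by (intro sum.mono_neutral_left) (auto simp: in_keys_iff)

lemma ev_diff: "ev (F - G) = ev F - ev G"
proof -
  let ?Z = "keys F \<union> keys G"
  have "ev (F - G) = (\<Sum>x\<in>?Z. of_int (lookup (F - G) x) * ([:const_coset (snd x):] * fst x))"
    by (rule ev_superset) (use keys_diff[of F G] in auto)
  also have "\<dots> = ev F - ev G"
    by (subst (1 2) ev_superset[of ?Z])
       (auto simp: lookup_minus left_diff_distrib smult_diff_right simp flip: sum_subtractf)
  finally show ?thesis .
qed

lemma ev_zero: "ev 0 = 0" by (simp add: ev_def)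

lemma ev_of: "ev (frag_of x) = [:const_coset (snd x):] * fst x"
  by (simp add: ev_def)

lemma ev_hom: "ring_hom_ring S A ev"
proof (rule ring_hom_ringI)
  show "ring S" by (rule S.ring_axioms)
  show "ring A" by (rule A.ring_axioms)
  show "ev x \<in> carrier A" if "x \<in> carrier S" for x
    using that[unfolded S_carrier mem_Collect_eq]
    by (induction x rule: frag_induction)
       (auto simp: ev_zero zero_mem ev_diff ev_of diff_mem mult_mem[OF const_mem, simplified])
  show "ev (x \<otimes>\<^bsub>S\<^esub> y) = ev x \<otimes>\<^bsub>A\<^esub> ev y" if "x \<in> carrier S" "y \<in> carrier S" for x y
    using that(1)[unfolded S_carrier mem_Collect_eq]
  proof (induction x rule: frag_induction)
    case (one p)
    show ?case using that(2)[unfolded S_carrier mem_Collect_eq]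
    proof (induction y rule: frag_induction)
      case (one q)
      then show ?case using \<open>p \<in> _\<close>
        by (auto simp: S_mult ev_of K_hom mem_Times_iff algebra_simps)
    qed (auto simp: S_mult ev_zero ev_diff algebra_simps)
  qed (auto simp: S_mult ev_zero ev_diff algebra_simps)
  show "ev (x \<oplus>\<^bsub>S\<^esub> y) = ev x \<oplus>\<^bsub>A\<^esub> ev y" for x y
    using ev_diff[of "x + y" y] by (simp add: S_add algebra_simps)
  show "ev \<one>\<^bsub>S\<^esub> = \<one>\<^bsub>A\<^esub>"
    using K_hom(3)[OF K.one_closed K.one_closed] by (simp add: S_one ev_of)
qed

lemma fprime_D:
  assumes "fprime Q"
  shows "Q \<subseteq> C" "0 \<in> Q" "p \<in> Q \<Longrightarrow> q \<in> Q \<Longrightarrow> p + q \<in> Q" "p \<in> Q \<Longrightarrow> q \<in> Q \<Longrightarrow> p - q \<in> Q"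
    "p \<in> Q \<Longrightarrow> q \<in> C \<Longrightarrow> p * q \<in> Q" "p \<in> C \<Longrightarrow> q \<in> C \<Longrightarrow> p * q \<in> Q \<Longrightarrow> p \<in> Q \<or> q \<in> Q"
    "1 \<notin> Q" "p \<in> C \<Longrightarrow> [:monom_of (Poly_Mapping.single l 1):] * p \<in> Q"
proof -
  interpret Q: primeideal Q A using assms by (simp add: fprime_def)
  show sub: "Q \<subseteq> C" using Q.a_subset by simp
  show "0 \<in> Q" using Q.zero_closed by simp
  show add: "p + q \<in> Q" if "p \<in> Q" "q \<in> Q" for p q using that Q.a_closed by simp
  show mul: "p * q \<in> Q" if "p \<in> Q" "q \<in> C" for p q using that Q.I_r_closed by simp
  show "p - q \<in> Q" if "p \<in> Q" "q \<in> Q" for p q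
    using add[OF that(1) mul[OF that(2) const_mem[of "-1"]]] by simp
  show "p \<in> C \<Longrightarrow> q \<in> C \<Longrightarrow> p * q \<in> Q \<Longrightarrow> p \<in> Q \<or> q \<in> Q" using Q.I_prime by simp
  show "1 \<notin> Q" using Q.I_notcarr sub mul[of 1] by auto
  show "p \<in> C \<Longrightarrow> [:monom_of (Poly_Mapping.single l 1):] * p \<in> Q" using assms by (simp add: fprime_def)
qed

lemma fprimeI:
  assumes "Q \<subseteq> C" "0 \<in> Q" "\<And>p q. p \<in> Q \<Longrightarrow> q \<in> Q \<Longrightarrow> p + q \<in> Q"
    "\<And>p q. p \<in> Q \<Longrightarrow> q \<in> C \<Longrightarrow> p * q \<in> Q" "\<And>p q. p \<in> C \<Longrightarrow> q \<in> C \<Longrightarrow> p * q \<in> Q \<Longrightarrow> p \<in> Q \<or> q \<in> Q"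
    "1 \<notin> Q" "\<And>l p. p \<in> C \<Longrightarrow> [:monom_of (Poly_Mapping.single l 1):] * p \<in> Q"
  shows "fprime Q"
  unfolding fprime_def
proof
  have um: "- p \<in> Q" if "p \<in> Q" for p
    using assms(4)[OF that const_mem[of "-1"]] by simp
  have "subgroup Q (add_monoid A)"
  proof (rule group.subgroupI[OF A.a_group])
    show "inv\<^bsub>add_monoid A\<^esub> a \<in> Q" if "a \<in> Q" for a
      using um[OF that] A.minus_equality[of "- a" a] that assms(1) uminus_mem
      by (auto simp: a_inv_def)
  qed (use assms in auto)
  then have "ideal Q A"
    by (intro idealI A.ring_axioms) (use assms(4) in \<open>auto simp: mult.commute\<close>)
  then show "primeideal Q A"
    by (rule primeidealI[OF _ cring_A]) (use assms one_mem in auto)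
qed (use assms in auto)

text \<open>A monomial other than 1 contains a variable, so every term of \<open>r\<close> moves
  \<open>p\<close> into \<open>Q\<close>.\<close>

lemma fprime_nonconst:
  assumes Q: "fprime Q" and r: "lookup r 0 = 0" and p: "p \<in> C"
  shows "[:r:] * p \<in> Q"
proof -
  have s: "[:Poly_Mapping.single a c:] * p \<in> Q" if "a \<noteq> 0" for a :: "'n \<Rightarrow>\<^sub>0 nat" and c
  proof -
    obtain l where l: "lookup a l \<noteq> 0" using \<open>a \<noteq> 0\<close> by (metis lookup_zero poly_mapping_eqI)
    define a' where "a' = a - Poly_Mapping.single l 1"
    have "a = Poly_Mapping.single l 1 + a'"
      using l by (intro poly_mapping_eqI) (auto simp: a'_def lookup_add lookup_minus lookup_single when_def)
    then have "[:Poly_Mapping.single a c:] * p = [:monom_of (Poly_Mapping.single l 1):] * ([:Poly_Mapping.single a' c:] * p)"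
      by (simp add: monom_of_def mult_single add.commute)
    then show ?thesis using fprime_D(8)[OF Q mult_mem[OF const_mem p]] by simp
  qed
  have "[:(\<Sum>a\<in>Z. Poly_Mapping.single a (lookup r a)):] * p \<in> Q" if "finite Z" "0 \<notin> Z" for Z
    using that
  proof (induction Z rule: finite_induct)
    case (insert x Z)
    have "[:(\<Sum>a\<in>insert x Z. Poly_Mapping.single a (lookup r a)):] * p =
        [:Poly_Mapping.single x (lookup r x):] * p + [:(\<Sum>a\<in>Z. Poly_Mapping.single a (lookup r a)):] * p"
      using insert by (simp add: smult_add_left)
    then show ?case using insert s[of x] fprime_D(3)[OF Q] by auto
  qed (simp add: fprime_D(2)[OF Q])
  moreover have "r = (\<Sum>a\<in>keys r. Poly_Mapping.single a (lookup r a))"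
    by (intro poly_mapping_eqI) (simp add: lookup_sum lookup_single when_def in_keys_iff sum.delta)
  ultimately show ?thesis using r by (metis finite_keys in_keys_iff)
qed

text \<open>On a scalar relation \<open>ev\<close> gives \<open>r\<close> minus its constant term,
  times an element of the algebra. This need not be 0, but a factor without constant term brings it
  into \<open>Q\<close>; the additivity relations are mapped to 0.\<close>

lemma J_ev:
  assumes Q: "fprime Q"
  shows "J \<subseteq> {x \<in> carrier S. ev x \<in> Q}"
proof -
  have "primeideal Q A" using Q by (simp add: fprime_def)
  then have "primeideal {x \<in> carrier S. ev x \<in> Q} S"
    by (rule ring_hom_ring.primeideal_vimage[OF ev_hom S.is_cring])
  then have "ideal {x \<in> carrier S. ev x \<in> Q} S" by (simp add: primeideal_def)
  moreover have "ev x \<in> Q" if "x \<in> rels" for x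
  proof -
    have sc: "ev (frag_of ([:r:] * p, Z) - frag_of (p, (irrelevant_ideal +>\<^bsub>poly_ring\<^esub> r) \<otimes>\<^bsub>K\<^esub> Z)) \<in> Q"
      if "p \<in> C" "Z \<in> carrier K" for p r Z
    proof -
      have "ev (frag_of ([:r:] * p, Z) - frag_of (p, (irrelevant_ideal +>\<^bsub>poly_ring\<^esub> r) \<otimes>\<^bsub>K\<^esub> Z))
        = [:r - Poly_Mapping.single 0 (lookup r 0):] * ([:const_coset Z:] * p)"
        using that by (simp add: ev_diff ev_of K_hom(2)[OF coset_closed] const_coset
            algebra_simps smult_diff_left)
      then show ?thesis
        using fprime_nonconst[OF Q _ mult_mem[OF const_mem that(1)]] by (simp add: lookup_minus)
    qed
    show ?thesis
      using that unfolding rels_def tensor_relations_def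
      using sc by (auto simp: ev_diff ev_of K_hom(1) fprime_D(2)[OF Q] smult_add_left smult_add_right)
  qed
  ultimately show ?thesis unfolding J_def using rels_subset by (intro S.genideal_minimal) auto
qed

text \<open>Chains are pulled back along \<phi>, where surjectivity keeps them strict. In the other
  direction they are pulled back along \<open>ev\<close> to the ring of pairs, where they contain
  \<open>J\<close>, and then reduced modulo \<open>J\<close>; a pair of 1 with some \<open>p\<close>
  that is new in the larger prime shows strictness.\<close>

lemma krull_dim_fiber_ring:
  "krull_dim (fiber_ring A) = Sup {ereal (real n) | n.
     \<exists>Q. (\<forall>i\<le>n. fprime (Q i)) \<and> (\<forall>i<n. Q i \<subset> Q (Suc i))}"
proof -
  have "(\<exists>P. (\<forall>i\<le>n. primeideal (P i) (fiber_ring A)) \<and> (\<forall>i<n. P i \<subset> P (Suc i))) \<longleftrightarrow>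
    (\<exists>Q. (\<forall>i\<le>n. fprime (Q i)) \<and> (\<forall>i<n. Q i \<subset> Q (Suc i)))" for n :: nat
  proof
    assume "\<exists>P. (\<forall>i\<le>n. primeideal (P i) (fiber_ring A)) \<and> (\<forall>i<n. P i \<subset> P (Suc i))"
    then obtain P where P: "\<And>i. i \<le> n \<Longrightarrow> primeideal (P i) (fiber_ring A)" "\<And>i. i < n \<Longrightarrow> P i \<subset> P (Suc i)"
      by blast
    define Q where "Q i = {p \<in> C. \<phi> p \<in> P i}" for i
    have "Q i \<subset> Q (Suc i)" if i: "i < n" for i
    proof -
      obtain Z where Z: "Z \<in> P (Suc i)" "Z \<notin> P i" using P(2)[OF i] by blast
      have "Z \<in> carrier (fiber_ring A)"
        using Z(1) P(1)[of "Suc i"] i additive_subgroup.a_Hcarr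
        by (metis Suc_leI ideal_def primeideal_def)
      then obtain p where "p \<in> C" "Z = \<phi> p" using \<phi>_surj by blast
      then show ?thesis using P(2)[OF i] Z by (auto simp: Q_def)
    qed
    moreover have "fprime (Q i)" if "i \<le> n" for i
      unfolding Q_def by (rule prime_vimage_\<phi>[OF P(1)[OF that]])
    ultimately show "\<exists>Q. (\<forall>i\<le>n. fprime (Q i)) \<and> (\<forall>i<n. Q i \<subset> Q (Suc i))" by blast
  next
    assume "\<exists>Q. (\<forall>i\<le>n. fprime (Q i)) \<and> (\<forall>i<n. Q i \<subset> Q (Suc i))"
    then obtain Q where Q: "\<And>i. i \<le> n \<Longrightarrow> fprime (Q i)" "\<And>i. i < n \<Longrightarrow> Q i \<subset> Q (Suc i)"
      by blast
    define P' where "P' i = {x \<in> carrier S. ev x \<in> Q i}" for i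
    define P where "P i = (+>\<^bsub>S\<^esub>) J ` P' i" for i
    have P': "primeideal (P' i) S" "J \<subseteq> P' i" if "i \<le> n" for i
      using Q(1)[OF that] ring_hom_ring.primeideal_vimage[OF ev_hom S.is_cring] J_ev
      unfolding P'_def by (auto simp: fprime_def)
    have P: "primeideal (P i) (fiber_ring A)"
      "\<And>x. x \<in> carrier S \<Longrightarrow> J +>\<^bsub>S\<^esub> x \<in> P i \<longleftrightarrow> ev x \<in> Q i" if "i \<le> n" for i
      using primeideal_quotient_image[OF S.is_cring J_ideal P'[OF that]]
      by (auto simp: P_def P'_def fiber_ring_eq)
    moreover have "P i \<subset> P (Suc i)" if i: "i < n" for i
    proof -
      have "P i \<subseteq> P (Suc i)" using Q(2)[OF i] by (auto simp: P_def P'_def)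
      moreover obtain p where p: "p \<in> Q (Suc i)" "p \<notin> Q i" using Q(2)[OF i] by blast
      moreover have "p \<in> C" using p fprime_D(1)[OF Q(1)[of "Suc i"]] i by auto
      moreover have "ev (frag_of (p, \<one>\<^bsub>K\<^esub>)) = p"
        using K_hom(3)[OF K.one_closed K.one_closed] by (simp add: ev_of)
      ultimately show ?thesis
        using P(2)[of i "frag_of (p, \<one>\<^bsub>K\<^esub>)"] P(2)[of "Suc i" "frag_of (p, \<one>\<^bsub>K\<^esub>)"]
          frag_of_mem[OF \<open>p \<in> C\<close> K.one_closed] i by (auto simp: psubset_eq)
    qed
    ultimately show "\<exists>P. (\<forall>i\<le>n. primeideal (P i) (fiber_ring A)) \<and> (\<forall>i<n. P i \<subset> P (Suc i))" by blast
  qed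
  then show ?thesis unfolding krull_dim_def by simp
qed

end

subsection \<open>Monomial ideals and their powers\<close>

text \<open>Divisibility of monomials, in terms of their exponents.\<close>

definition dv :: "('n \<Rightarrow>\<^sub>0 nat) \<Rightarrow> ('n \<Rightarrow>\<^sub>0 nat) \<Rightarrow> bool" where
  "dv b a \<longleftrightarrow> (\<exists>d. a = b + d)"

lemma dv_iff: "dv b a \<longleftrightarrow> (\<forall>l. lookup b l \<le> lookup a l)"
proof
  assume *: "\<forall>l. lookup b l \<le> lookup a l"
  have "a = b + (a - b)"
    by (rule poly_mapping_eqI) (use * in \<open>simp add: lookup_add lookup_minus\<close>)
  then show "dv b a" by (auto simp: dv_def)
qed (auto simp: dv_def lookup_add)

lemma dv_refl [simp]: "dv a a"
  and dv_trans: "dv a b \<Longrightarrow> dv b c \<Longrightarrow> dv a c"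
  and dv_antisym: "dv a b \<Longrightarrow> dv b a \<Longrightarrow> a = b"
  and dv_add_right: "dv a b \<Longrightarrow> dv a (b + d)"
  by (auto simp: dv_iff lookup_add intro: poly_mapping_eqI order.trans antisym trans_le_add1)

text \<open>The ideal generated by the monomials with exponents in \<open>M\<close>, described by
  supports.\<close>

definition monomial_span :: "('n \<Rightarrow>\<^sub>0 nat) set \<Rightarrow> ('n, 'k::field) mpoly set" where
  "monomial_span M = {p. \<forall>a\<in>keys p. \<exists>b\<in>M. dv b a}"

lemma poly_mapping_single_induct_on [consumes 1, case_names zero add single]:
  fixes p :: "'a \<Rightarrow>\<^sub>0 'b::comm_monoid_add"
  assumes sub: "keys p \<subseteq> D" and zero: "P 0" and add: "\<And>p q. P p \<Longrightarrow> P q \<Longrightarrow> P (p + q)"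
    and single: "\<And>a c. a \<in> D \<Longrightarrow> P (Poly_Mapping.single a c)"
  shows "P p"
proof -
  have "P (\<Sum>a\<in>F. Poly_Mapping.single a (lookup p a))" if "finite F" "F \<subseteq> D" for F
    using that by (induction F rule: finite_induct) (auto simp: zero intro!: add single)
  moreover have "p = (\<Sum>a\<in>keys p. Poly_Mapping.single a (lookup p a))"
    by (intro poly_mapping_eqI) (simp add: lookup_sum lookup_single when_def in_keys_iff sum.delta)
  ultimately show ?thesis using sub finite_keys by metis
qed

lemma ideal_poly_ringI:
  fixes I :: "('n, 'k::comm_ring_1) mpoly set"
  assumes "0 \<in> I" "\<And>p q. p \<in> I \<Longrightarrow> q \<in> I \<Longrightarrow> p + q \<in> I" "\<And>p q. p \<in> I \<Longrightarrow> q * p \<in> I"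
  shows "ideal I poly_ring"
proof -
  interpret R: ring "poly_ring :: ('n, 'k) mpoly ring" by (rule ring_from_type_algebra)
  show ?thesis
  proof (rule idealI)
    show "ring (poly_ring :: ('n, 'k) mpoly ring)" by (rule ring_from_type_algebra)
    show "subgroup I (add_monoid poly_ring)"
    proof (rule group.subgroupI[OF R.a_group])
      fix a assume a: "a \<in> I"
      have "\<ominus>\<^bsub>poly_ring\<^esub> a = - a"
        by (rule R.minus_equality) (auto simp: ring_of_type_algebra_def)
      then show "inv\<^bsub>add_monoid poly_ring\<^esub> a \<in> I"
        using assms(3)[OF a, of "-1"] by (simp add: a_inv_def)
    qed (use assms in \<open>auto simp: ring_of_type_algebra_def\<close>)
  qed (use assms in \<open>auto simp: ring_of_type_algebra_def mult.commute\<close>)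
qed

lemma ideal_poly_ringD:
  fixes I :: "('n, 'k::comm_ring_1) mpoly set"
  assumes "ideal I poly_ring"
  shows "0 \<in> I" "p \<in> I \<Longrightarrow> q \<in> I \<Longrightarrow> p + q \<in> I" "p \<in> I \<Longrightarrow> p * q \<in> I"
proof -
  interpret I: ideal I poly_ring by fact
  show "0 \<in> I"
  proof -
    have "\<zero>\<^bsub>poly_ring\<^esub> = (0 :: ('n, 'k) mpoly)" by (simp add: ring_of_type_algebra_def)
    then show ?thesis using additive_subgroup.zero_closed[OF ideal.axioms(1)[OF assms]] by simp
  qed
  show "p \<in> I \<Longrightarrow> q \<in> I \<Longrightarrow> p + q \<in> I" using additive_subgroup.a_closed[OF ideal.axioms(1)[OF assms], of p q] by (simp add: ring_of_type_algebra_def)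
  show "p \<in> I \<Longrightarrow> p * q \<in> I" using I.I_r_closed[of p q] by (simp add: ring_of_type_algebra_def)
qed

lemma monomial_span_ideal: "ideal (monomial_span M) poly_ring"
proof (rule ideal_poly_ringI)
  fix p q :: "('a, 'b) mpoly"
  show "p + q \<in> monomial_span M" if "p \<in> monomial_span M" "q \<in> monomial_span M"
    using that keys_add[of p q] by (force simp: monomial_span_def)
  show "q * p \<in> monomial_span M" if "p \<in> monomial_span M"
  proof -
    have "\<exists>b\<in>M. dv b (x + y)" if "y \<in> keys p" for x y
      using that \<open>p \<in> monomial_span M\<close> dv_add_right[of _ y x] by (auto simp: monomial_span_def add.commute)
    then have "\<exists>b\<in>M. dv b z" if "z \<in> keys (q * p)" for z
      using subsetD[OF keys_mult that] by auto
    then show ?thesis by (simp add: monomial_span_def)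
  qed
qed (simp add: monomial_span_def)

lemma monomial_spanI:
  fixes I :: "('n, 'k::field) mpoly set"
  assumes "0 \<in> I" "\<And>p q. p \<in> I \<Longrightarrow> q \<in> I \<Longrightarrow> p + q \<in> I"
    and "\<And>b d c. b \<in> M \<Longrightarrow> Poly_Mapping.single (b + d) c \<in> I"
  shows "monomial_span M \<subseteq> I"
proof
  fix p :: "('n, 'k) mpoly" assume "p \<in> monomial_span M"
  then have "keys p \<subseteq> {a. \<exists>b\<in>M. dv b a}" by (auto simp: monomial_span_def)
  then show "p \<in> I"
    by (induction p rule: poly_mapping_single_induct_on) (use assms in \<open>auto simp: dv_def\<close>)
qed

lemma single_mem_monomial_span_iff:
  "c \<noteq> 0 \<Longrightarrow> Poly_Mapping.single a c \<in> monomial_span M \<longleftrightarrow> (\<exists>b\<in>M. dv b a)"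
  by (simp add: monomial_span_def)

lemma Idl_monomials: "Idl\<^bsub>poly_ring\<^esub> (monom_of ` M) = (monomial_span M :: ('n, 'k::field) mpoly set)"
proof
  interpret R: ring "poly_ring :: ('n, 'k) mpoly ring" by (rule ring_from_type_algebra)
  let ?I = "Idl\<^bsub>poly_ring\<^esub> (monom_of ` M) :: ('n, 'k) mpoly set"
  have sub: "monom_of ` M \<subseteq> carrier (poly_ring :: ('n, 'k) mpoly ring)" by (simp add: ring_of_type_algebra_def)
  note I = ideal_poly_ringD[OF R.genideal_ideal[OF sub]]
  show "monomial_span M \<subseteq> ?I"
  proof (rule monomial_spanI)
    fix b d and c :: 'k assume "b \<in> M"
    then have "monom_of b \<in> ?I" using R.genideal_self[OF sub] by auto
    then have "monom_of b * Poly_Mapping.single d c \<in> ?I" by (rule I(3))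
    then show "Poly_Mapping.single (b + d) c \<in> ?I" by (simp add: monom_of_def mult_single)
  qed (use I in auto)
  show "?I \<subseteq> monomial_span M"
  proof (rule R.genideal_minimal[OF monomial_span_ideal], safe)
    fix b assume "b \<in> M"
    then show "monom_of b \<in> (monomial_span M :: ('n, 'k) mpoly set)"
      using single_mem_monomial_span_iff[OF one_neq_zero, of b M] dv_refl[of b] unfolding monom_of_def by blast
  qed
qed

definition min_exps :: "('n \<Rightarrow>\<^sub>0 nat) set \<Rightarrow> ('n \<Rightarrow>\<^sub>0 nat) set" where
  "min_exps M = {b\<in>M. \<forall>b'\<in>M. dv b' b \<longrightarrow> b' = b}"

lemma ex_min_exp:
  fixes M :: "('n::finite \<Rightarrow>\<^sub>0 nat) set"
  assumes "b \<in> M"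
  shows "\<exists>b'\<in>min_exps M. dv b' b"
  using assms
proof (induction "\<Sum>l\<in>UNIV. lookup b l" arbitrary: b rule: less_induct)
  case less
  show ?case
  proof (cases "b \<in> min_exps M")
    case False
    then obtain b' where b': "b' \<in> M" "dv b' b" "b' \<noteq> b" using less(2) by (auto simp: min_exps_def)
    have "(\<Sum>l\<in>UNIV. lookup b' l) < (\<Sum>l\<in>UNIV. lookup b l)"
    proof (rule sum_strict_mono_ex1)
      show "\<exists>a\<in>UNIV. lookup b' a < lookup b a"
      proof -
        obtain l where "lookup b' l \<noteq> lookup b l" using b'(3) by (metis poly_mapping_eqI)
        moreover have "lookup b' l \<le> lookup b l" using b'(2) by (simp add: dv_iff)
        ultimately show ?thesis by (intro bexI[of _ l]) auto
      qed
    qed (use b' in \<open>auto simp: dv_iff\<close>)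
    from less(1)[OF this b'(1)] show ?thesis using b' dv_trans by blast
  next
    case True
    then show ?thesis using dv_refl by blast
  qed
qed

lemma monomial_span_min_exps:
  fixes M :: "('n::finite \<Rightarrow>\<^sub>0 nat) set"
  shows "monomial_span (min_exps M) = (monomial_span M :: ('n, 'k::field) mpoly set)"
proof -
  have "(\<exists>b\<in>min_exps M. dv b a) \<longleftrightarrow> (\<exists>b\<in>M. dv b a)" for a
  proof
    assume "\<exists>b\<in>M. dv b a"
    then obtain b where b: "b \<in> M" "dv b a" by blast
    then obtain b' where "b' \<in> min_exps M" "dv b' b" using ex_min_exp by blast
    then show "\<exists>b\<in>min_exps M. dv b a" using dv_trans[OF _ b(2)] by blast
  qed (auto simp: min_exps_def)
  then show ?thesis by (simp add: monomial_span_def)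
qed

text \<open>A minimal \<open>g\<close> is divisible by some \<open>h\<close> in \<open>H\<close>,
  and \<open>h\<close> by some \<open>m\<close> in \<open>M\<close>; minimality forces
  \<open>m = g\<close>, hence \<open>h = g\<close>. This makes the minimal monomial generators
  unique.\<close>

lemma min_exps_subset_generators:
  fixes M :: "('n::finite \<Rightarrow>\<^sub>0 nat) set"
  assumes "monomial_span H = (monomial_span M :: ('n, 'k::field) mpoly set)"
  shows "min_exps M \<subseteq> H"
proof
  fix g assume g: "g \<in> min_exps M"
  have ex: "(\<exists>b\<in>H. dv b a) \<longleftrightarrow> (\<exists>b\<in>M. dv b a)" for a
  proof -
    have "Poly_Mapping.single a (1::'k) \<in> monomial_span H \<longleftrightarrow> Poly_Mapping.single a (1::'k) \<in> monomial_span M"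
      by (simp only: assms)
    then show ?thesis by (simp add: single_mem_monomial_span_iff)
  qed
  obtain h where h: "h \<in> H" "dv h g" using ex[of g] g dv_refl[of g] unfolding min_exps_def by blast
  obtain m where m: "m \<in> M" "dv m h" using ex[of h] h dv_refl[of h] by blast
  then have "m = g" using g dv_trans[OF m(2) h(2)] by (auto simp: min_exps_def)
  then show "g \<in> H" using h m dv_antisym by metis
qed

lemma monom_of_inj: "inj (monom_of :: _ \<Rightarrow> ('n, 'k::field) mpoly)"
proof (rule injI)
  fix a b :: "'a \<Rightarrow>\<^sub>0 nat" assume "monom_of a = (monom_of b :: ('a, 'k) mpoly)"
  then have "keys (monom_of a :: ('a, 'k) mpoly) = keys (monom_of b :: ('a, 'k) mpoly)" by simp
  then show "a = b" by (simp add: monom_of_def)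
qed

lemma min_monomial_gens_eq:
  fixes M :: "('n::finite \<Rightarrow>\<^sub>0 nat) set"
  shows "min_monomial_gens (monomial_span M :: ('n, 'k::field) mpoly set) = monom_of ` min_exps M"
  unfolding min_monomial_gens_def
proof (rule the_equality)
  let ?I = "monomial_span M :: ('n, 'k) mpoly set"
  have H: "monom_of ` min_exps M \<subseteq> H" if "Idl\<^bsub>poly_ring\<^esub> H = ?I" "H \<subseteq> range monom_of" for H
  proof -
    have H: "H = monom_of ` (monom_of -` H)" using that by auto
    have "monomial_span (monom_of -` H) = Idl\<^bsub>poly_ring\<^esub> (monom_of ` (monom_of -` H) :: ('n, 'k) mpoly set)"
      by (rule Idl_monomials[symmetric])
    also have "\<dots> = ?I" using that(1) H by simp
    finally show ?thesis using min_exps_subset_generators by blast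
  qed
  show "monom_of ` min_exps M \<subseteq> range monom_of \<and> Idl\<^bsub>poly_ring\<^esub> (monom_of ` min_exps M) = ?I \<and>
      (\<forall>H\<subset>monom_of ` min_exps M. Idl\<^bsub>poly_ring\<^esub> H \<noteq> ?I)"
  proof (intro conjI allI impI notI)
    fix H assume "H \<subset> monom_of ` min_exps M" "Idl\<^bsub>poly_ring\<^esub> H = ?I"
    then show False using H[of H] by blast
  qed (auto simp: Idl_monomials monomial_span_min_exps)
  fix G assume G: "G \<subseteq> range monom_of \<and> Idl\<^bsub>poly_ring\<^esub> G = ?I \<and> (\<forall>H\<subset>G. Idl\<^bsub>poly_ring\<^esub> H \<noteq> ?I)"
  then have "monom_of ` min_exps M \<subseteq> G" using H[of G] by blast
  moreover have "\<not> monom_of ` min_exps M \<subset> G"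
    using G Idl_monomials[of "min_exps M"] monomial_span_min_exps[of M] by metis
  ultimately show "G = monom_of ` min_exps M" by blast
qed

lemma min_exps_antichain: "a \<in> min_exps M \<Longrightarrow> b \<in> min_exps M \<Longrightarrow> dv a b \<Longrightarrow> a = b"
  by (auto simp: min_exps_def)

text \<open>Dickson's lemma: in a sequence of distinct exponents, subsequences are chosen coordinate
  by coordinate until all coordinates increase weakly; then the first two terms are
  comparable.\<close>

lemma finite_antichain:
  fixes G :: "('n::finite \<Rightarrow>\<^sub>0 nat) set"
  assumes "\<And>a b. a \<in> G \<Longrightarrow> b \<in> G \<Longrightarrow> dv a b \<Longrightarrow> a = b"
  shows "finite G"
proof (rule ccontr)
  assume "infinite G"
  then obtain s :: "nat \<Rightarrow> _" where s: "inj s" "range s \<subseteq> G" using infinite_countable_subset by blast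
  have "\<exists>f :: nat \<Rightarrow> nat. strict_mono f \<and> (\<forall>l\<in>L. incseq (\<lambda>n. lookup (s (f n)) l))" if "finite L" for L
    using that
  proof (induction L rule: finite_induct)
    case empty
    show ?case by (auto intro: exI[of _ id] strict_mono_id)
  next
    case (insert l L)
    then obtain f where f: "strict_mono f" "\<And>l. l \<in> L \<Longrightarrow> incseq (\<lambda>n. lookup (s (f n)) l)" by blast
    obtain g where g: "strict_mono g" "monoseq (\<lambda>n. lookup (s (f (g n))) l)"
      using seq_monosub[of "\<lambda>n. lookup (s (f n)) l"] by auto
    let ?v = "\<lambda>n. lookup (s (f (g n))) l"
    \<comment> \<open>A decreasing sequence of natural numbers is constant once it attains its
      minimum, so in either case a tail is increasing.\<close>
    have "\<exists>k. incseq (\<lambda>n. ?v (n + k))"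
    proof (cases "incseq ?v")
      case True
      then show ?thesis by (intro exI[of _ 0]) simp
    next
      case False
      then have dec: "decseq ?v" using g(2) by (simp add: monoseq_iff)
      define m where "m = (LEAST m. m \<in> range ?v)"
      have "m \<in> range ?v" unfolding m_def by (rule LeastI_ex) auto
      then obtain k where k: "?v k = m" by auto
      have "?v (n + k) = m" for n
        using decseqD[OF dec, of k "n + k"] k Least_le[of "\<lambda>m. m \<in> range ?v" "?v (n + k)"]
        unfolding m_def by auto
      then show ?thesis by (intro exI[of _ k]) (simp add: incseq_def)
    qed
    then obtain k where k: "incseq (\<lambda>n. ?v (n + k))" by blast
    have sm: "strict_mono (\<lambda>n. g (n + k))" using g(1) by (simp add: strict_mono_def)
    have "incseq (\<lambda>n. lookup (s (f (g (n + k)))) l')" if "l' \<in> L" for l'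
      using f(2)[OF that] strict_mono_mono[OF sm] by (auto simp: incseq_def mono_def)
    then show ?case using k strict_mono_o[OF f(1) sm] by (intro exI[of _ "\<lambda>n. f (g (n + k))"]) (auto simp: o_def)
  qed
  from this[of UNIV] obtain f where f: "strict_mono f" "\<And>l. incseq (\<lambda>n. lookup (s (f n)) l)" by auto
  have "dv (s (f 0)) (s (f 1))" using f(2) by (auto simp: dv_iff incseq_def)
  then have "s (f 0) = s (f 1)" using assms s(2) by blast
  then have "f 0 = f 1" using s(1) by (auto dest: injD)
  then show False using strict_monoD[OF f(1), of 0 1] by simp
qed

text \<open>Sums of exactly \<open>i\<close> elements of \<open>G\<close>: exponents of monomials
  that generate the \<open>i\<close>-th power of the ideal, not necessarily minimally.\<close>

fun psum :: "('n \<Rightarrow>\<^sub>0 nat) set \<Rightarrow> nat \<Rightarrow> ('n \<Rightarrow>\<^sub>0 nat) set" where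
  "psum G 0 = {0}"
| "psum G (Suc i) = {a + b | a b. a \<in> psum G i \<and> b \<in> G}"

lemma ideal_prod_monomial_span:
  "ideal_prod poly_ring (monomial_span M) (monomial_span N :: ('n, 'k::field) mpoly set) =
    monomial_span {a + b | a b. a \<in> M \<and> b \<in> N}" (is "?L = ?R")
proof
  note R = ideal_poly_ringD[OF monomial_span_ideal[of "{a + b | a b. a \<in> M \<and> b \<in> N}"]]
  show "?L \<subseteq> ?R"
  proof
    fix p assume "p \<in> ?L"
    then show "p \<in> ?R"
    proof induction
      case (prod p q)
      have "\<exists>b\<in>{a + b | a b. a \<in> M \<and> b \<in> N}. dv b (x + y)" if xy: "x \<in> keys p" "y \<in> keys q" for x y
      proof -
        obtain m where "m \<in> M" "dv m x" using prod xy by (auto simp: monomial_span_def)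
        moreover obtain n where "n \<in> N" "dv n y" using prod xy by (auto simp: monomial_span_def)
        ultimately show ?thesis by (intro bexI[of _ "m + n"]) (auto simp: dv_iff lookup_add intro: add_mono)
      qed
      then have "\<exists>b\<in>{a + b | a b. a \<in> M \<and> b \<in> N}. dv b z" if "z \<in> keys (p * q)" for z
        using subsetD[OF keys_mult that] by auto
      then show ?case by (simp add: monomial_span_def ring_of_type_algebra_def)
    qed (use R in \<open>auto simp: ring_of_type_algebra_def\<close>)
  qed
  show "?R \<subseteq> ?L"
  proof (rule monomial_spanI)
    have z: "0 \<in> monomial_span M" "0 \<in> monomial_span N" by (auto simp: monomial_span_def)
    show "0 \<in> ?L" using ideal_prod.prod[OF z, of poly_ring] by (simp add: ring_of_type_algebra_def)
    show "p + q \<in> ?L" if "p \<in> ?L" "q \<in> ?L" for p q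
      using ideal_prod.sum[OF that] by (simp add: ring_of_type_algebra_def)
    fix b d and c :: 'k assume "b \<in> {a + b | a b. a \<in> M \<and> b \<in> N}"
    then obtain m n where b: "b = m + n" "m \<in> M" "n \<in> N" by auto
    have "Poly_Mapping.single m 1 \<in> monomial_span M"
      using b by (auto simp: single_mem_monomial_span_iff intro!: bexI[of _ m])
    moreover have "Poly_Mapping.single (n + d) c \<in> monomial_span N"
      using b by (auto simp: monomial_span_def dv_add_right intro!: bexI[of _ n])
    ultimately show "Poly_Mapping.single (b + d) c \<in> ?L"
      using ideal_prod.prod[of "Poly_Mapping.single m 1" "monomial_span M" "Poly_Mapping.single (n + d) c" "monomial_span N" poly_ring]
      by (simp add: ring_of_type_algebra_def mult_single b add.assoc)
  qed
qed

lemma monomial_span_pow: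
  "(monomial_span G :: ('n, 'k::field) mpoly set) [^]\<^bsub>ideals_set poly_ring\<^esub> (i::nat) = monomial_span (psum G i)"
proof (induction i)
  case 0
  show ?case by (auto simp: nat_pow_def ideals_set_def monomial_span_def dv_def ring_of_type_algebra_def)
next
  case (Suc i)
  then show ?case
    using ideal_prod_monomial_span[of "psum G i" G] by (simp add: nat_pow_def ideals_set_def)
qed

subsection \<open>The Rees algebra as a monoid algebra\<close>

text \<open>An element of R[t] is handled as a finitely supported function on pairs
  \<open>(a, i)\<close>, the exponents of x^a t^i, which hides the nesting of two polynomial
  types.\<close>

definition cof :: "('n, 'k::field) mpoly poly \<Rightarrow> ('n \<Rightarrow>\<^sub>0 nat) \<times> nat \<Rightarrow> 'k" where
  "cof p x = lookup (Polynomial.coeff p (snd x)) (fst x)"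

definition supp :: "('n, 'k::field) mpoly poly \<Rightarrow> (('n \<Rightarrow>\<^sub>0 nat) \<times> nat) set" where
  "supp p = {x. cof p x \<noteq> 0}"

definition mterm :: "('n \<Rightarrow>\<^sub>0 nat) \<times> nat \<Rightarrow> 'k \<Rightarrow> ('n, 'k::field) mpoly poly" where
  "mterm x c = Polynomial.monom (Poly_Mapping.single (fst x) c) (snd x)"

lemma cof_eqI: "(\<And>x. cof p x = cof q x) \<Longrightarrow> p = q"
  by (intro poly_eqI poly_mapping_eqI) (metis cof_def fst_conv snd_conv)

lemma cof_simps [simp]: "cof 0 x = 0" "cof (p + q) x = cof p x + cof q x" "cof (p - q) x = cof p x - cof q x"
  "cof (mterm y c) x = (if x = y then c else 0)"
  by (auto simp: cof_def lookup_add lookup_minus mterm_def lookup_single when_def prod_eq_iff)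

lemma cof_sum [simp]: "cof (sum f F) x = (\<Sum>y\<in>F. cof (f y) x)"
  by (induction F rule: infinite_finite_induct) auto

lemma finite_supp: "finite (supp p)"
proof (rule finite_subset)
  show "supp p \<subseteq> (\<Union>i\<in>{..Polynomial.degree p}. (\<lambda>a. (a, i)) ` keys (Polynomial.coeff p i))"
  proof
    fix x assume "x \<in> supp p"
    then have "fst x \<in> keys (Polynomial.coeff p (snd x))" "Polynomial.coeff p (snd x) \<noteq> 0"
      by (auto simp: supp_def cof_def in_keys_iff)
    then show "x \<in> (\<Union>i\<in>{..Polynomial.degree p}. (\<lambda>a. (a, i)) ` keys (Polynomial.coeff p i))"
      using le_degree[of p "snd x"] by (auto intro!: bexI[of _ "snd x"] image_eqI[of _ _ "fst x"])
  qed
qed auto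

lemma mono_mult: "mterm x c * mterm y d = mterm (x + y) (c * d)"
  by (simp add: mterm_def mult_monom mult_single)

lemma mono_0_1: "mterm 0 1 = 1"
  by (simp add: mterm_def monom_0 one_pCons)

lemma sum_mono_supp: "p = (\<Sum>x\<in>supp p. mterm x (cof p x))"
proof (rule cof_eqI)
  fix x
  have "(\<Sum>y\<in>supp p. cof (mterm y (cof p y)) x) = (\<Sum>y\<in>supp p. if y = x then cof p x else 0)"
    by (rule sum.cong) auto
  then show "cof p x = cof (\<Sum>x\<in>supp p. mterm x (cof p x)) x"
    using finite_supp[of p] by (auto simp: supp_def)
qed

lemma supp_induct [consumes 1, case_names zero add mono]:
  assumes "supp p \<subseteq> M" "P 0" "\<And>p q. P p \<Longrightarrow> P q \<Longrightarrow> P (p + q)" "\<And>x c. x \<in> M \<Longrightarrow> P (mterm x c)"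
  shows "P p"
proof -
  have "P (\<Sum>x\<in>F. mterm x (cof p x))" if "finite F" "F \<subseteq> M" for F
    using that by (induction F rule: finite_induct) (auto intro!: assms)
  then show ?thesis using sum_mono_supp[of p] finite_supp assms(1) by metis
qed

lemma supp_add: "supp (p + q) \<subseteq> supp p \<union> supp q"
  by (auto simp: supp_def)

lemma supp_mono: "supp (mterm x c) \<subseteq> {x}"
  by (auto simp: supp_def split: if_splits)

definition span_of :: "(('n \<Rightarrow>\<^sub>0 nat) \<times> nat) set \<Rightarrow> ('n, 'k::field) mpoly poly set" where
  "span_of M = {p. supp p \<subseteq> M}"

lemma span_of_add: "p \<in> span_of M \<Longrightarrow> q \<in> span_of M \<Longrightarrow> p + q \<in> span_of M"
  using supp_add by (fastforce simp: span_of_def)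

lemma span_of_0: "0 \<in> span_of M" by (auto simp: span_of_def supp_def)

lemma span_of_mono: "x \<in> M \<Longrightarrow> mterm x c \<in> span_of M"
  using supp_mono by (fastforce simp: span_of_def)

lemma span_of_mult:
  assumes "\<And>x y. x \<in> M \<Longrightarrow> y \<in> N \<Longrightarrow> x + y \<in> M'" "p \<in> span_of M" "q \<in> span_of N"
  shows "p * q \<in> span_of M'"
  using assms(2)[unfolded span_of_def mem_Collect_eq]
proof (induction p rule: supp_induct)
  case (mono x c)
  show ?case using assms(3)[unfolded span_of_def mem_Collect_eq]
    by (induction q rule: supp_induct)
       (auto simp: span_of_0 mono_mult distrib_left intro!: span_of_add span_of_mono assms mono)
qed (auto simp: span_of_0 span_of_add distrib_right)

definition restr :: "(('n \<Rightarrow>\<^sub>0 nat) \<times> nat) set \<Rightarrow> ('n, 'k::field) mpoly poly \<Rightarrow> ('n, 'k) mpoly poly" where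
  "restr F p = (\<Sum>x\<in>supp p \<inter> F. mterm x (cof p x))"

lemma cof_restr [simp]: "cof (restr F p) x = (if x \<in> F then cof p x else 0)"
proof -
  have "cof (restr F p) x = (\<Sum>y\<in>supp p \<inter> F. if y = x then cof p x else 0)"
    unfolding restr_def cof_sum by (rule sum.cong) auto
  then show ?thesis using finite_supp[of p] by (auto simp: supp_def)
qed

lemma restr_simps [simp]: "restr F 0 = 0" "restr F (p + q) = restr F p + restr F q"
  "restr F (p - q) = restr F p - restr F q"
  "restr F (mterm x c) = (if x \<in> F then mterm x c else 0)"
  by (auto intro!: cof_eqI)

lemma restr_eq_0_iff: "restr F p = 0 \<longleftrightarrow> supp p \<inter> F = {}"
proof
  assume "restr F p = 0"
  then have "cof (restr F p) x = 0" for x by (metis cof_simps(1))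
  then show "supp p \<inter> F = {}" unfolding supp_def cof_restr by (metis (mono_tags, lifting) disjoint_iff mem_Collect_eq)
qed (auto simp: restr_def)

text \<open>Faces of a monoid: submonoids whose complement is a prime ideal of the monoid.\<close>

definition face_in :: "(('n \<Rightarrow>\<^sub>0 nat) \<times> nat) set \<Rightarrow> (('n \<Rightarrow>\<^sub>0 nat) \<times> nat) set \<Rightarrow> bool" where
  "face_in F M \<longleftrightarrow> F \<subseteq> M \<and> 0 \<in> F \<and> (\<forall>x\<in>M. \<forall>y\<in>M. x + y \<in> F \<longleftrightarrow> x \<in> F \<and> y \<in> F)"

text \<open>A sum of two exponents of \<open>M\<close> lies in \<open>F\<close> exactly if both do,
  so discarding the terms outside \<open>F\<close> commutes with products.\<close>

lemma restr_mult:
  assumes F: "face_in F M" and "p \<in> span_of M" "q \<in> span_of M"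
  shows "restr F (p * q) = restr F p * restr F q"
  using assms(2)[unfolded span_of_def mem_Collect_eq]
proof (induction p rule: supp_induct)
  case (mono x c)
  show ?case using assms(3)[unfolded span_of_def mem_Collect_eq]
    by (induction q rule: supp_induct) (use F mono in \<open>auto simp: face_in_def mono_mult distrib_left\<close>)
qed (auto simp: distrib_right)


text \<open>Exponents of the monomials x^a t^i in the Rees algebra.\<close>

definition Mon :: "('n \<Rightarrow>\<^sub>0 nat) set \<Rightarrow> (('n \<Rightarrow>\<^sub>0 nat) \<times> nat) set" where
  "Mon G = {(a, i). \<exists>b\<in>psum G i. dv b a}"

lemma psum_add: "a \<in> psum G i \<Longrightarrow> b \<in> psum G j \<Longrightarrow> a + b \<in> psum G (i + j)"
proof (induction j arbitrary: b)
  case (Suc j)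
  then obtain c d where "b = c + d" "c \<in> psum G j" "d \<in> G" by auto
  then show ?case using Suc(1)[OF Suc(2)] by (auto simp: add.assoc[symmetric])
qed auto

lemma Mon_add: "x \<in> Mon G \<Longrightarrow> y \<in> Mon G \<Longrightarrow> x + y \<in> Mon G"
proof -
  assume "x \<in> Mon G" "y \<in> Mon G"
  then obtain a b where ab: "a \<in> psum G (snd x)" "dv a (fst x)" "b \<in> psum G (snd y)" "dv b (fst y)"
    by (auto simp: Mon_def)
  have "dv (a + b) (fst x + fst y)" using ab(2,4) by (auto simp: dv_iff lookup_add intro: add_mono)
  then show "x + y \<in> Mon G" using psum_add[OF ab(1,3)] unfolding Mon_def by (cases x; cases y) auto
qed

lemma Mon_const: "(a, 0) \<in> Mon G"
  by (auto simp: Mon_def dv_iff)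

lemma zero_in_Mon: "0 \<in> Mon G"
  using Mon_const[of 0] by (simp add: zero_prod_def)

lemma psum_in_Mon: "a \<in> psum G i \<Longrightarrow> (a, i) \<in> Mon G"
  by (auto simp: Mon_def intro: bexI[of _ a])

lemma gen_in_Mon: "b \<in> G \<Longrightarrow> (b, 1) \<in> Mon G"
  using psum_in_Mon[of b G 1] by auto

lemma rees_algebra_monomial_span:
  "rees_algebra (monomial_span G :: ('n, 'k::field) mpoly set) = ring_of_type_algebra\<lparr>carrier := span_of (Mon G)\<rparr>"
proof -
  have "{p :: ('n, 'k) mpoly poly. \<forall>i. Polynomial.coeff p i \<in> monomial_span G [^]\<^bsub>ideals_set poly_ring\<^esub> i} = span_of (Mon G)"
    unfolding monomial_span_pow unfolding span_of_def Mon_def supp_def cof_def monomial_span_def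
    by (rule Collect_cong) (auto simp: in_keys_iff subset_iff)
  then show ?thesis by (simp add: rees_algebra_def)
qed

lemma const_poly_in_span: "[:r:] \<in> span_of (Mon G)"
proof -
  have "snd x = 0" if "x \<in> supp [:r:]" for x
    using that by (auto simp: supp_def cof_def coeff_pCons split: nat.splits)
  then show ?thesis by (auto simp: span_of_def) (metis Mon_const snd_conv)
qed

text \<open>The second parameter only fixes the coefficient field.\<close>

locale rees =
  fixes G :: "('n::{finite,linorder} \<Rightarrow>\<^sub>0 nat) set" and coefficients :: "'k::field itself"
begin

sublocale poly_subalgebra "span_of (Mon G) :: ('n, 'k) mpoly poly set"
proof
  show "p * q \<in> span_of (Mon G)" if "p \<in> span_of (Mon G)" "q \<in> span_of (Mon G)"
    for p q :: "('n, 'k) mpoly poly"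
    by (rule span_of_mult[OF _ that]) (rule Mon_add)
qed (fact const_poly_in_span span_of_add)+

lemma analytic_spread_eq: "analytic_spread (monomial_span G :: ('n, 'k) mpoly set) = krull_dim (fiber_ring A)"
  by (simp add: analytic_spread_def rees_algebra_monomial_span fiber_ring_def A_def)

lemma var_mult: "[:monom_of (Poly_Mapping.single l 1):] * mterm (a, i) (c::'k) = mterm (Poly_Mapping.single l 1 + a, i) c"
  using mono_mult[of "(Poly_Mapping.single l 1, 0)" 1 "(a, i)" c]
  by (simp add: mterm_def monom_of_def monom_0)

definition face_prime :: "(('n \<Rightarrow>\<^sub>0 nat) \<times> nat) set \<Rightarrow> ('n, 'k) mpoly poly set" where
  "face_prime F = {p \<in> span_of (Mon G). restr F p = 0}"

text \<open>\<open>face_prime F\<close> is the kernel of \<open>restr F\<close>, a ring homomorphism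
  from the Rees algebra into the domain R[t], hence prime; the variables are killed because their
  exponents are not in \<open>F\<close>.\<close>

lemma fprime_face_prime:
  assumes F: "face_in F (Mon G)" and v: "\<And>l. (Poly_Mapping.single l 1, 0) \<notin> F"
  shows "fprime (face_prime F)"
proof (rule fprimeI)
  have m: "restr F (p * q) = restr F p * restr F q"
    if "p \<in> span_of (Mon G)" "q \<in> span_of (Mon G)" for p q :: "('n, 'k) mpoly poly"
    by (rule restr_mult[OF F that])
  have "restr F (mterm 0 1 :: ('n, 'k) mpoly poly) = mterm 0 1" using F by (simp add: face_in_def)
  then show "1 \<notin> face_prime F" by (simp add: face_prime_def mono_0_1)
  show "p * q \<in> face_prime F" if "p \<in> face_prime F" "q \<in> span_of (Mon G)" for p q
    using that m by (simp add: face_prime_def mult_mem)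
  show "p \<in> face_prime F \<or> q \<in> face_prime F"
    if "p \<in> span_of (Mon G)" "q \<in> span_of (Mon G)" "p * q \<in> face_prime F" for p q
    using that m by (auto simp: face_prime_def)
  fix l and p :: "('n, 'k) mpoly poly" assume p: "p \<in> span_of (Mon G)"
  have "restr F [:monom_of (Poly_Mapping.single l 1) :: ('n, 'k) mpoly:] = 0"
    using v[of l] restr_simps(4)[of F "(Poly_Mapping.single l 1, 0)" "1::'k"]
    by (simp add: mterm_def monom_of_def monom_0)
  then show "[:monom_of (Poly_Mapping.single l 1):] * p \<in> face_prime F"
    using p m[OF const_mem p] mult_mem[OF const_mem p] unfolding face_prime_def by (metis (mono_tags, lifting) mem_Collect_eq mult_zero_left)
qed (auto simp: face_prime_def zero_mem add_mem)

lemma face_prime_strict: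
  assumes "F' \<subset> F" "F \<subseteq> Mon G"
  shows "face_prime F \<subset> face_prime F'"
proof -
  obtain x where x: "x \<in> F" "x \<notin> F'" using assms by auto
  have "mterm x 1 \<in> face_prime F' - face_prime F"
    using x assms by (auto simp: face_prime_def span_of_mono) (metis cof_simps(1,4) one_neq_zero)
  moreover have "face_prime F \<subseteq> face_prime F'"
    using assms by (auto simp: face_prime_def restr_eq_0_iff)
  ultimately show ?thesis by auto
qed

lemma krull_dim_ge:
  assumes "\<And>i. i \<le> n \<Longrightarrow> face_in (F i) (Mon G)" "\<And>i. i < n \<Longrightarrow> F (Suc i) \<subset> F i"
    and "\<And>l i. i \<le> n \<Longrightarrow> (Poly_Mapping.single l 1, 0) \<notin> F i"
  shows "krull_dim (fiber_ring A) \<ge> ereal (real n)"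
proof -
  have "\<forall>i\<le>n. fprime (face_prime (F i))" using fprime_face_prime assms(1,3) by simp
  moreover have "\<forall>i<n. face_prime (F i) \<subset> face_prime (F (Suc i))"
  proof (intro allI impI)
    fix i assume "i < n"
    then show "face_prime (F i) \<subset> face_prime (F (Suc i))"
      using face_prime_strict[OF assms(2)] assms(1)[of i] by (simp add: face_in_def)
  qed
  ultimately show ?thesis unfolding krull_dim_fiber_ring
    by (intro Sup_upper CollectI exI[of _ n] exI[of _ "\<lambda>i. face_prime (F i)"] conjI refl)
qed

end

subsection \<open>Bounding chains of primes by counting lattice points\<close>

text \<open>Exponents of products of the x^b t with \<open>b\<close> in \<open>B\<close>, without a
  further factor from R, in contrast to \<open>Mon\<close>.\<close>

definition Bmon :: "('n \<Rightarrow>\<^sub>0 nat) set \<Rightarrow> (('n \<Rightarrow>\<^sub>0 nat) \<times> nat) set" where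
  "Bmon B = {(a, i). a \<in> psum B i}"

lemma finite_psum: "finite B \<Longrightarrow> finite (psum B i)"
proof (induction i)
  case (Suc i)
  have "psum B (Suc i) = (\<lambda>(a, b). a + b) ` (psum B i \<times> B)" by auto
  then show ?case using Suc by (metis finite_cartesian_product finite_imageI)
qed simp

lemma finite_Bmon: "finite B \<Longrightarrow> finite {x \<in> Bmon B. snd x \<le> M}"
  by (rule finite_subset[of _ "\<Union>i\<le>M. (\<lambda>a. (a, i)) ` psum B i"]) (auto simp: Bmon_def finite_psum)

context rees
begin

lemma fprime_power_notin: "fprime Q \<Longrightarrow> f \<in> span_of (Mon G) \<Longrightarrow> f \<notin> Q \<Longrightarrow> f ^ m \<notin> Q \<and> f ^ m \<in> span_of (Mon G)"
  by (induction m) (auto simp: fprime_D(7) one_mem mult_mem dest: fprime_D(6))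

lemma fprime_sum: "fprime Q \<Longrightarrow> (\<And>x. x \<in> F \<Longrightarrow> f x \<in> Q) \<Longrightarrow> sum f F \<in> Q"
  by (induction F rule: infinite_finite_induct) (auto simp: fprime_D)

lemma scal_mem: "mterm 0 (c::'k) \<in> span_of (Mon G)"
  by (rule span_of_mono[OF zero_in_Mon])

lemma prod_mem: "(\<And>x. x \<in> F \<Longrightarrow> f x \<in> span_of (Mon G)) \<Longrightarrow> prod f F \<in> (span_of (Mon G) :: ('n, 'k) mpoly poly set)"
  by (induction F rule: infinite_finite_induct) (auto simp: mult_mem one_mem)

lemma power_mem: "f \<in> span_of (Mon G) \<Longrightarrow> f ^ m \<in> (span_of (Mon G) :: ('n, 'k) mpoly poly set)"
  by (induction m) (auto simp: mult_mem one_mem)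

lemma fprime_scal:
  assumes "fprime Q" "mterm 0 c * p \<in> Q" "c \<noteq> 0"
  shows "p \<in> Q"
proof -
  have "(mterm 0 c * p) * mterm 0 (inverse c) \<in> Q" by (rule fprime_D(5)[OF assms(1,2) scal_mem])
  moreover have "(mterm 0 c * p) * mterm 0 (inverse c) = p * (mterm 0 c * mterm 0 (inverse c))" by (simp only: mult_ac)
  ultimately show ?thesis using assms(3) by (simp add: mono_mult mono_0_1)
qed

text \<open>Dividing by the lowest power of \<open>f j\<close> and passing to the next prime peels off one
  variable at a time.\<close>

lemma chain_independent:
  assumes Q: "\<And>i. i \<le> n \<Longrightarrow> fprime (Q i)" and f: "\<And>i. i < n \<Longrightarrow> f i \<in> Q (Suc i) \<and> f i \<notin> Q i"
    and sub: "\<And>i. i < n \<Longrightarrow> Q i \<subseteq> Q (Suc i)"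
    and "j \<le> n" "finite E" "\<And>e i. e \<in> E \<Longrightarrow> i < j \<or> n \<le> i \<Longrightarrow> e i = 0"
    and "(\<Sum>e\<in>E. mterm 0 (c e) * (\<Prod>i=j..<n. f i ^ e i)) \<in> Q j" "e \<in> E"
  shows "c e = 0"
  using assms(4-8)
proof (induction j arbitrary: E c e rule: inc_induct)
  case base
  \<comment> \<open>With \<open>j = n\<close> all exponents vanish, so \<open>E\<close> has one
    element and the sum is a single scalar, which a proper ideal contains only if it is 0.\<close>
  have "x = y" if "x \<in> E" "y \<in> E" for x y
  proof
    fix i show "x i = y i" using base(2)[OF that(1), of i] base(2)[OF that(2), of i] by (cases "i < n") auto
  qed
  then have "E = {e}" using base by auto
  then have "mterm 0 (c e) * 1 \<in> Q n" using base by simp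
  then show ?case using fprime_scal[OF Q] fprime_D(7)[OF Q] by blast
next
  case (step j)
  have fm: "f i \<in> span_of (Mon G)" if "i < n" for i
    using f[OF that] fprime_D(1)[OF Q[of "Suc i"]] that by auto
  have P: "(\<Prod>i=k..<n. f i ^ e i) \<in> span_of (Mon G)" for e k
    by (intro prod_mem power_mem fm) auto
  show ?case
  proof (rule ccontr)
    assume "c e \<noteq> 0"
    define E' where "E' = {e \<in> E. c e \<noteq> 0}"
    have E': "finite E'" "e \<in> E'" using step \<open>c e \<noteq> 0\<close> by (auto simp: E'_def)
    \<comment> \<open>The lowest power of \<open>f j\<close> among the terms with nonzero
      coefficient; it can be cancelled because \<open>f j\<close> is not in the prime
      \<open>Q j\<close>.\<close>
    define m where "m = Min ((\<lambda>e. e j) ` E')"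
    have m: "m \<le> e j" if "e \<in> E'" for e using E' that by (auto simp: m_def)
    have "m \<in> (\<lambda>e. e j) ` E'" unfolding m_def by (rule Min_in) (use E' in auto)
    then obtain e0 where e0: "e0 \<in> E'" "e0 j = m" by auto
    define R where "R e = mterm 0 (c e) * (f j ^ (e j - m) * (\<Prod>i=Suc j..<n. f i ^ e i))" for e
    have R: "mterm 0 (c e) * (\<Prod>i=j..<n. f i ^ e i) = f j ^ m * R e" if "e \<in> E'" for e
    proof -
      have "f j ^ e j = f j ^ m * f j ^ (e j - m)" using m[OF that] by (simp flip: power_add)
      then show ?thesis using \<open>j < n\<close> by (simp add: prod.atLeast_Suc_lessThan R_def mult_ac)
    qed
    have "(\<Sum>e\<in>E. mterm 0 (c e) * (\<Prod>i=j..<n. f i ^ e i)) = (\<Sum>e\<in>E'. mterm 0 (c e) * (\<Prod>i=j..<n. f i ^ e i))"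
      unfolding E'_def by (rule sum.mono_neutral_right) (use step in \<open>auto simp: mterm_def\<close>)
    also have "\<dots> = f j ^ m * (\<Sum>e\<in>E'. R e)" by (simp add: R sum_distrib_left)
    finally have "f j ^ m * (\<Sum>e\<in>E'. R e) \<in> Q j" using step by simp
    moreover have Rm: "R e \<in> span_of (Mon G)" for e
      unfolding R_def by (intro mult_mem scal_mem power_mem fm P \<open>j < n\<close>)
    then have "(\<Sum>e\<in>E'. R e) \<in> span_of (Mon G)"
      by (induction E' rule: infinite_finite_induct) (auto simp: zero_mem add_mem)
    ultimately have "(\<Sum>e\<in>E'. R e) \<in> Q j"
      using fprime_D(6)[OF Q] fprime_power_notin[OF Q fm, of j j m] f \<open>j < n\<close> by (metis less_imp_le)
    then have RS: "(\<Sum>e\<in>E'. R e) \<in> Q (Suc j)" using sub[OF \<open>j < n\<close>] by auto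
    have QS: "fprime (Q (Suc j))" using Q \<open>j < n\<close> by auto
    \<comment> \<open>Modulo \<open>Q (Suc j)\<close>, which contains \<open>f j\<close>, only the
      terms with \<open>f j\<close> exactly to the power \<open>m\<close> survive.\<close>
    define E0 where "E0 = {e \<in> E'. e j = m}"
    have "(\<Sum>e\<in>E'. R e) = (\<Sum>e\<in>E0. R e) + (\<Sum>e\<in>E' - E0. R e)"
      using sum.subset_diff[of E0 E' R] E'(1) by (simp add: E0_def add.commute)
    moreover have "(\<Sum>e\<in>E' - E0. R e) \<in> Q (Suc j)"
    proof (rule fprime_sum[OF QS])
      fix e assume e: "e \<in> E' - E0"
      then obtain k where k: "e j - m = Suc k" using m[of e] by (auto simp: E0_def) (metis Suc_diff_Suc diff_is_0_eq le_neq_implies_less)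
      have "R e = f j * (mterm 0 (c e) * (f j ^ k * (\<Prod>i=Suc j..<n. f i ^ e i)))"
        by (simp add: R_def k mult_ac)
      then show "R e \<in> Q (Suc j)"
        using fprime_D(5)[OF QS, of "f j"] f[OF \<open>j < n\<close>] by (simp add: mult_mem scal_mem power_mem fm P \<open>j < n\<close>)
    qed
    ultimately have "(\<Sum>e\<in>E0. R e) \<in> Q (Suc j)" using RS fprime_D(4)[OF QS] by (metis add_diff_cancel_right')
    \<comment> \<open>Resetting entry \<open>j\<close> to 0 gives exponents of the form that the
      induction hypothesis requires; putting \<open>m\<close> back recovers the coefficient.\<close>
    moreover have "(\<Sum>e\<in>E0. R e) = (\<Sum>e\<in>(\<lambda>e. e(j := 0)) ` E0. mterm 0 (c (e(j := m))) * (\<Prod>i=Suc j..<n. f i ^ e i))"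
    proof (subst sum.reindex)
      show "inj_on (\<lambda>e. e(j := 0)) E0"
      proof (rule inj_onI)
        fix x y assume xy: "x \<in> E0" "y \<in> E0" "x(j := 0) = y(j := 0)"
        show "x = y"
        proof
          fix i show "x i = y i"
          proof (cases "i = j")
            case True
            then show ?thesis using xy(1,2) by (simp add: E0_def)
          next
            case False
            then show ?thesis using fun_cong[OF xy(3), of i] by simp
          qed
        qed
      qed
      have "e(j := m) = e" if "e \<in> E0" for e using that by (auto simp: E0_def)
      moreover have "(\<Prod>i=Suc j..<n. f i ^ (e(j := 0)) i) = (\<Prod>i=Suc j..<n. f i ^ e i)" for e :: "nat \<Rightarrow> nat"
        by (rule prod.cong) auto
      ultimately show "(\<Sum>e\<in>E0. R e) = sum ((\<lambda>e. mterm 0 (c (e(j := m))) * (\<Prod>i=Suc j..<n. f i ^ e i)) \<circ> (\<lambda>e. e(j := 0))) E0"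
        by (intro sum.cong) (auto simp: R_def E0_def simp del: fun_upd_apply)
    qed
    ultimately have S0: "(\<Sum>e\<in>(\<lambda>e. e(j := 0)) ` E0. mterm 0 (c (e(j := m))) * (\<Prod>i=Suc j..<n. f i ^ e i)) \<in> Q (Suc j)"
      by simp
    have "c ((e0(j := 0))(j := m)) = 0"
    proof (rule step.IH[of "(\<lambda>e. e(j := 0)) ` E0" "\<lambda>e. c (e(j := m))", OF _ _ S0])
      show "finite ((\<lambda>e. e(j := 0)) ` E0)" using E'(1) by (simp add: E0_def)
      show "e i = 0" if "e \<in> (\<lambda>e. e(j := 0)) ` E0" "i < Suc j \<or> n \<le> i" for e i
        using that step(5) by (auto simp: E0_def E'_def less_Suc_eq)
      show "e0(j := 0) \<in> (\<lambda>e. e(j := 0)) ` E0" using e0 by (simp add: E0_def)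
    qed
    then have "c e0 = 0" using e0(2) by (metis fun_upd_triv fun_upd_upd)
    then show False using e0 by (simp add: E'_def)
  qed
qed

definition live :: "('n, 'k) mpoly poly set \<Rightarrow> ('n \<Rightarrow>\<^sub>0 nat) set" where
  "live Q = {b \<in> G. mterm (b, 1) 1 \<notin> Q}"

lemma mono_notin_psum:
  assumes "fprime Q" "b \<in> psum G i" "mterm (b, i) c \<notin> Q"
  shows "b \<in> psum (live Q) i"
  using assms(2,3)
proof (induction i arbitrary: b)
  case (Suc i)
  then obtain a g where b: "b = a + g" "a \<in> psum G i" "g \<in> G" by auto
  have e: "mterm (b, Suc i) c = mterm (a, i) c * mterm (g, 1) 1" using b by (simp add: mono_mult)
  have m: "mterm (a, i) c \<in> span_of (Mon G)" "mterm (g, 1) 1 \<in> span_of (Mon G)"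
    using b by (auto intro!: span_of_mono psum_in_Mon gen_in_Mon[unfolded One_nat_def])
  have "mterm (a, i) c \<notin> Q" using fprime_D(5)[OF assms(1) _ m(2)] e Suc by metis
  moreover have "mterm (g, 1) 1 \<notin> Q" using fprime_D(5)[OF assms(1) _ m(1)] e Suc by (metis mult.commute)
  ultimately show ?case using Suc b by (auto simp: live_def)
qed auto

text \<open>A variable times a monomial of the algebra lies in \<open>Q\<close>. So a monomial
  outside \<open>Q\<close> is an exact product of generators, and each of these is outside
  \<open>Q\<close> as well.\<close>

lemma mono_notin:
  assumes "fprime Q" "x \<in> Mon G" "mterm x c \<notin> Q"
  shows "x \<in> Bmon (live Q)"
proof -
  obtain b d i where x: "x = (b + d, i)" "b \<in> psum G i" using assms by (auto simp: Mon_def dv_def)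
  have "d = 0"
  proof (rule ccontr)
    assume "d \<noteq> 0"
    then obtain l where l: "lookup d l \<noteq> 0" by (metis lookup_zero poly_mapping_eqI)
    have "b + d = Poly_Mapping.single l 1 + (b + (d - Poly_Mapping.single l 1))"
      using l by (intro poly_mapping_eqI) (auto simp: lookup_add lookup_minus lookup_single when_def)
    moreover have "(b + (d - Poly_Mapping.single l 1), i) \<in> Mon G"
      using x by (auto simp: Mon_def dv_def)
    ultimately show False
      using assms(3) fprime_D(8)[OF assms(1) span_of_mono] var_mult x by metis
  qed
  then show ?thesis using x mono_notin_psum[OF assms(1)] assms(3) by (auto simp: Bmon_def)
qed

text \<open>So modulo \<open>Q\<close> the algebra is spanned by products of live
  generators.\<close>

lemma restr_live:
  assumes Q: "fprime Q" and p: "p \<in> span_of (Mon G)"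
  shows "p - restr (Bmon (live Q)) p \<in> Q"
  using p[unfolded span_of_def mem_Collect_eq]
proof (induction p rule: supp_induct)
  case (add p q)
  then show ?case using fprime_D(3)[OF Q add] by (simp add: algebra_simps)
next
  case (mono x c)
  then show ?case using mono_notin[OF Q mono] fprime_D(2)[OF Q] by auto
qed (simp add: fprime_D(2)[OF Q])

end

lemma vector_space_scal: "vector_space (\<lambda>c (p :: ('n, 'k::field) mpoly poly). mterm 0 c * p)"
proof
  have "mterm 0 (a + b) = (mterm 0 a + mterm 0 b :: ('n, 'k) mpoly poly)" for a b :: 'k
    by (rule cof_eqI) (simp del: zero_prod_def)
  then show "mterm 0 (a + b) * x = mterm 0 a * x + mterm 0 b * x" for a b and x :: "('n, 'k) mpoly poly"
    by (simp add: distrib_right)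
qed (auto simp: distrib_left mono_0_1 mult.assoc[symmetric] mono_mult)

context rees
begin

text \<open>Take \<open>f i\<close> in \<open>Q (Suc i)\<close> but not in \<open>Q i\<close>. The
  (N+1)^n products of their powers with exponents at most \<open>N\<close> are linearly independent
  modulo \<open>Q 0\<close>, and cutting them down to \<open>Bmon (live (Q 0))\<close> changes them
  only by elements of \<open>Q 0\<close>. So at least that many monomials are available in the
  corresponding degrees.\<close>

lemma chain_count:
  assumes fin: "finite G" and Q: "\<And>i. i \<le> n \<Longrightarrow> fprime (Q i)" and strict: "\<And>i. i < n \<Longrightarrow> Q i \<subset> Q (Suc i)"
  shows "\<exists>D. \<forall>N. (N + 1) ^ n \<le> card {x \<in> Bmon (live (Q 0)). snd x \<le> D * N}"
proof -
  interpret V: vector_space "\<lambda>c (p :: ('n, 'k) mpoly poly). mterm 0 c * p" by (rule vector_space_scal)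
  have "\<exists>g. g \<in> Q (Suc i) \<and> g \<notin> Q i" if "i < n" for i using strict[OF that] by blast
  then obtain f where f: "\<And>i. i < n \<Longrightarrow> f i \<in> Q (Suc i) \<and> f i \<notin> Q i" by metis
  have fm: "f i \<in> span_of (Mon G)" if "i < n" for i
    using f[OF that] fprime_D(1)[OF Q[of "Suc i"]] that by auto
  \<comment> \<open>A bound on the degrees in t of all \<open>f i\<close>. A product of
    \<open>n\<close> powers with exponents at most \<open>N\<close> has degree at most
    \<open>D * n * N\<close>, so \<open>D * n\<close> is the final witness.\<close>
  define D where "D = Max (insert 0 (snd ` (\<Union>i<n. supp (f i))))"
  have D: "snd x \<le> D" if "x \<in> supp (f i)" "i < n" for x i
    unfolding D_def by (rule Max_ge) (use that finite_supp in auto)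
  let ?L = "\<lambda>k. span_of {x \<in> Mon G. snd x \<le> k} :: ('n, 'k) mpoly poly set"
  have L_mult: "p * q \<in> ?L (k + k')" if "p \<in> ?L k" "q \<in> ?L k'" for p q k k'
    by (rule span_of_mult[OF _ that]) (auto intro: Mon_add)
  have L1: "1 \<in> ?L 0" using span_of_mono[of 0 "{x \<in> Mon G. snd x \<le> 0}" "1::'k"] zero_in_Mon[of G] by (simp add: mono_0_1)
  have L_pow: "f i ^ m \<in> ?L (D * m)" if "i < n" for i m
  proof (induction m)
    case (Suc m)
    have "f i \<in> ?L D" using fm[OF that] D[OF _ that] by (auto simp: span_of_def)
    then show ?case using L_mult[OF _ Suc] by simp
  qed (use L1 in simp)
  have L_prod: "(\<Prod>i=0..<k. f i ^ e i) \<in> ?L (D * (\<Sum>i=0..<k. e i))" if "k \<le> n" for k e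
    using that
  proof (induction k)
    case (Suc k)
    then show ?case using L_mult[OF Suc.IH L_pow[of k "e k"]] by (simp add: distrib_left)
  qed (use L1 in simp)
  have "(N + 1) ^ n \<le> card {x \<in> Bmon (live (Q 0)). snd x \<le> (D * n) * N}" for N
  proof -
    \<comment> \<open>\<open>chain_independent\<close> wants exponents that vanish from
      \<open>n\<close> on, while extensional functions are \<open>undefined\<close> there.\<close>
    define E where "E = (\<lambda>e i. if i < n then e i else 0) ` ({..<n} \<rightarrow>\<^sub>E {..N})"
    have "inj_on (\<lambda>e i. if i < n then e i else 0 :: nat) ({..<n} \<rightarrow>\<^sub>E {..N})"
    proof (rule inj_onI)
      fix x y assume xy: "x \<in> {..<n} \<rightarrow>\<^sub>E {..N}" "y \<in> {..<n} \<rightarrow>\<^sub>E {..N}"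
        "(\<lambda>i. if i < n then x i else 0) = (\<lambda>i. if i < n then y i else 0)"
      show "x = y"
        by (rule PiE_ext[OF xy(1,2)]) (use fun_cong[OF xy(3)] in \<open>metis lessThan_iff\<close>)
    qed
    then have cE: "card E = (N + 1) ^ n"
      unfolding E_def by (simp add: card_image card_PiE)
    have fE: "finite E" unfolding E_def by (intro finite_imageI finite_PiE) auto
    have E: "e i \<le> N" "n \<le> i \<Longrightarrow> e i = 0" if "e \<in> E" for e i
      using that by (auto simp: E_def PiE_def Pi_def)
    define v where "v e = restr (Bmon (live (Q 0))) (\<Prod>i=0..<n. f i ^ e i)" for e :: "nat \<Rightarrow> nat"
    have Pm: "(\<Prod>i=0..<n. f i ^ e i) \<in> span_of (Mon G)" for e
      by (intro prod_mem power_mem fm) auto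
    have indep: "c e = 0" if "(\<Sum>e\<in>E'. mterm 0 (c e) * v e) = 0" "e \<in> E'" "E' \<subseteq> E" for c e E'
    proof (rule chain_independent[where n = n and Q = Q and f = f and j = 0 and E = E' and c = c])
      have "(\<Sum>e\<in>E'. mterm 0 (c e) * (\<Prod>i=0..<n. f i ^ e i)) =
          (\<Sum>e\<in>E'. ((\<Prod>i=0..<n. f i ^ e i) - v e) * mterm 0 (c e))"
        using that(1) by (simp add: algebra_simps sum_subtractf)
      also have "\<dots> \<in> Q 0"
        unfolding v_def by (intro fprime_sum fprime_D(5) Q scal_mem restr_live Pm) auto
      finally show "(\<Sum>e\<in>E'. mterm 0 (c e) * (\<Prod>i=0..<n. f i ^ e i)) \<in> Q 0" .
      show "finite E'" using that fE finite_subset by auto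
      show "Q i \<subseteq> Q (Suc i)" if "i < n" for i using strict[OF that] by blast
    qed (use that E Q f in auto)
    have inj: "inj_on v E"
    proof (rule inj_onI, rule ccontr)
      fix x y assume xy: "x \<in> E" "y \<in> E" "v x = v y" "x \<noteq> y"
      have "mterm 0 1 * v x + mterm 0 (-1) * v x = mterm 0 (1 + -1) * v x" by (simp only: V.scale_left_distrib)
      also have "\<dots> = 0" using V.scale_zero_left[of "v x"] by simp
      finally have "(\<Sum>e\<in>{x, y}. mterm 0 (if e = x then 1 else -1) * v e) = 0" using xy by simp
      from indep[OF this, of x] xy show False by simp
    qed
    have "V.independent (v ` E)"
      unfolding V.dependent_explicit
    proof safe
      fix t u w assume t: "finite t" "t \<subseteq> v ` E" "(\<Sum>w\<in>t. mterm 0 (u w) * w) = 0" "w \<in> t" "u w \<noteq> 0"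
      obtain E' where E': "E' \<subseteq> E" "t = v ` E'" using t(2) by (metis subset_image_iff)
      have "(\<Sum>e\<in>E'. mterm 0 (u (v e)) * v e) = 0"
        using t(3) unfolding E'(2) by (subst (asm) sum.reindex) (auto intro: inj_on_subset[OF inj E'(1)])
      then have "u (v e) = 0" if "e \<in> E'" for e using indep[OF _ that E'(1)] by fast
      then show False using t(4,5) E' by auto
    qed
    moreover have "v ` E \<subseteq> V.span ((\<lambda>x. mterm x 1) ` {x \<in> Bmon (live (Q 0)). snd x \<le> (D * n) * N})" (is "_ \<subseteq> V.span ?T")
    proof safe
      fix e assume e: "e \<in> E"
      have "(\<Sum>i=0..<n. e i) \<le> (\<Sum>i=0..<n. N)" by (intro sum_mono E e)
      then have le: "D * (\<Sum>i=0..<n. e i) \<le> (D * n) * N" by (simp add: mult.assoc)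
      have "supp (\<Prod>i=0..<n. f i ^ e i) \<subseteq> {x. snd x \<le> (D * n) * N}"
        using L_prod[of n e] order.trans[OF _ le] by (auto simp: span_of_def subset_iff)
      then have s: "supp (v e) \<subseteq> {x \<in> Bmon (live (Q 0)). snd x \<le> (D * n) * N}"
        unfolding v_def by (auto simp: supp_def split: if_splits)
      have "v e = (\<Sum>x\<in>supp (v e). mterm 0 (cof (v e) x) * mterm x 1)"
        using sum_mono_supp[of "v e"] by (simp add: mono_mult)
      also have "\<dots> \<in> V.span ?T"
        using s by (intro V.span_sum V.span_scale V.span_base) auto
      finally show "v e \<in> V.span ?T" .
    qed
    moreover have fT: "finite {x \<in> Bmon (live (Q 0)). snd x \<le> (D * n) * N}"
      by (rule finite_Bmon) (use fin in \<open>auto simp: live_def\<close>)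
    ultimately have "card (v ` E) \<le> card ?T"
      using V.independent_span_bound[of ?T "v ` E"] by blast
    also have "\<dots> \<le> card {x \<in> Bmon (live (Q 0)). snd x \<le> (D * n) * N}"
      by (rule card_image_le[OF fT])
    finally show ?thesis using cE card_image[OF inj] by simp
  qed
  then show ?thesis by blast
qed

end


section \<open>Lattice points in the cone over a face\<close>

definition expvec :: "('n::finite \<Rightarrow>\<^sub>0 nat) \<Rightarrow> real ^ 'n" where
  "expvec b = (\<chi> l. real (lookup b l))"

text \<open>Homogenization: exponents of degree \<open>i\<close> in t are placed at height
  \<open>i\<close>, the generators at height 1.\<close>

definition lift :: "('n::finite \<Rightarrow>\<^sub>0 nat) \<times> nat \<Rightarrow> (real ^ 'n) \<times> real" where
  "lift x = (expvec (fst x), real (snd x))"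

lemma lift_add: "lift (x + y) = lift x + lift y"
  by (simp add: lift_def expvec_def lookup_add vec_eq_iff)

lemma lift_0 [simp]: "lift 0 = 0"
  by (auto simp: lift_def expvec_def vec_eq_iff zero_prod_def)

lemma expvec_eq_iff [simp]: "expvec a = expvec b \<longleftrightarrow> a = b"
  by (auto simp: expvec_def vec_eq_iff intro: poly_mapping_eqI)

lemma lift_inj: "inj lift"
  by (rule injI) (auto simp: lift_def prod_eq_iff)

text \<open>A basis of \<open>V\<close> is completed by standard vectors to a basis of the space.
  The standard vectors that were not added give coordinates that are injective on \<open>V\<close>:
  a point of \<open>V\<close> where they vanish is also a combination of the added vectors, hence
  0.\<close>

lemma injective_coordinates:
  fixes V :: "'a::euclidean_space set"
  assumes "subspace V"
  obtains J where "J \<subseteq> Basis" "card J = dim V" "\<And>x. x \<in> V \<Longrightarrow> (\<And>e. e \<in> J \<Longrightarrow> x \<bullet> e = 0) \<Longrightarrow> x = 0"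
proof -
  obtain B where B: "B \<subseteq> V" "independent B" "V \<subseteq> span B" "card B = dim V" using basis_exists by metis
  obtain C where C: "B \<subseteq> C" "C \<subseteq> B \<union> Basis" "independent C" "B \<union> Basis \<subseteq> span C"
    using maximal_independent_subset_extend[of B "B \<union> Basis"] B(2) by auto
  have "span C = UNIV" using C(4) span_mono[of Basis "span C"] by (auto simp: span_span)
  then have cC: "card C = DIM('a)" using C(3) by (metis dim_UNIV dim_eq_card_independent dim_span)
  have fin: "finite C" using C(3) independent_imp_finite by blast
  define J where "J = Basis - (C - B)"
  have "card (C - B) = DIM('a) - dim V" using B(4) C(1) cC fin by (simp add: card_Diff_subset finite_subset)
  moreover have "card J = DIM('a) - card (C - B)"
    unfolding J_def using C(2) fin by (intro card_Diff_subset) auto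
  ultimately have "card J = dim V" using dim_subset_UNIV[of V] by simp
  moreover have "x = 0" if x: "x \<in> V" "\<And>e. e \<in> J \<Longrightarrow> x \<bullet> e = 0" for x
  proof -
    have "x = (\<Sum>e\<in>Basis. (x \<bullet> e) *\<^sub>R e)" by (simp add: euclidean_representation)
    also have "\<dots> = (\<Sum>e\<in>C - B. (x \<bullet> e) *\<^sub>R e)"
      by (rule sum.mono_neutral_right) (use C(2) x(2) in \<open>auto simp: J_def\<close>)
    finally have x1: "x = (\<Sum>e\<in>C - B. (x \<bullet> e) *\<^sub>R e)" .
    have "finite B" using C(1) fin finite_subset by blast
    then obtain u where u: "x = (\<Sum>b\<in>B. u b *\<^sub>R b)" using x(1) B(3) by (auto simp: span_finite)
    have "(\<Sum>e\<in>C. (if e \<in> B then - u e else x \<bullet> e) *\<^sub>R e)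
        = (\<Sum>e\<in>C - B. (x \<bullet> e) *\<^sub>R e) + (\<Sum>e\<in>B. - u e *\<^sub>R e)"
      by (subst sum.subset_diff[OF C(1) fin]) (auto intro!: arg_cong2[of _ _ _ _ "(+)"] sum.cong)
    also have "\<dots> = 0" using x1 u by (simp add: sum_negf)
    finally have sum0: "(\<Sum>e\<in>C. (if e \<in> B then - u e else x \<bullet> e) *\<^sub>R e) = 0" .
    have indC: "\<forall>c. (\<Sum>e\<in>C. c e *\<^sub>R e) = 0 \<longrightarrow> (\<forall>e\<in>C. c e = 0)"
      using C(3) unfolding independent_explicit by blast
    have "\<forall>e\<in>C. (if e \<in> B then - u e else x \<bullet> e) = 0"
      by (rule mp[OF spec[OF indC, of "\<lambda>e. if e \<in> B then - u e else x \<bullet> e"] sum0])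
    then have "x \<bullet> e = 0" if "e \<in> C - B" for e using that by fastforce
    then show "x = 0" using x1 by simp
  qed
  ultimately show ?thesis using that[of J] by (auto simp: J_def)
qed

text \<open>Suitable \<open>dim V\<close> coordinates determine a point of \<open>V\<close>, and
  each of them takes at most \<open>K + 1\<close> values.\<close>

lemma lattice_points_card:
  fixes V :: "'a::euclidean_space set"
  assumes V: "subspace V" "dim V \<le> r" "P \<subseteq> V" and P: "\<And>x e. x \<in> P \<Longrightarrow> e \<in> Basis \<Longrightarrow> \<exists>k::nat. k \<le> K \<and> x \<bullet> e = real k"
  shows "card P \<le> (K + 1) ^ r"
proof -
  obtain J where J: "J \<subseteq> Basis" "card J = dim V" "\<And>x. x \<in> V \<Longrightarrow> (\<And>e. e \<in> J \<Longrightarrow> x \<bullet> e = 0) \<Longrightarrow> x = 0"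
    using injective_coordinates[OF V(1)] by metis
  define g where "g x = (\<lambda>e\<in>J. nat \<lfloor>x \<bullet> e\<rfloor>)" for x :: 'a
  have finJ: "finite J" using J(1) finite_subset finite_Basis by blast
  have g: "x \<bullet> e = real (g x e)" "g x e \<le> K" if "x \<in> P" "e \<in> J" for x e
  proof -
    have "e \<in> Basis" using that(2) J(1) by blast
    note P[OF that(1) this]
    then show "x \<bullet> e = real (g x e)" "g x e \<le> K" using that(2) by (auto simp: g_def)
  qed
  have "inj_on g P"
  proof (rule inj_onI)
    fix x y assume xy: "x \<in> P" "y \<in> P" "g x = g y"
    have "x - y = 0"
    proof (rule J(3))
      show "x - y \<in> V" using xy V by (auto intro: subspace_diff)
      show "(x - y) \<bullet> e = 0" if "e \<in> J" for e
        using g(1)[OF xy(1) that] g(1)[OF xy(2) that] xy(3) by (simp add: inner_diff_left)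
    qed
    then show "x = y" by simp
  qed
  moreover have "g ` P \<subseteq> J \<rightarrow>\<^sub>E {..K}" using g(2) by (auto simp: g_def PiE_def)
  ultimately have "card P \<le> card (J \<rightarrow>\<^sub>E {..K})"
    using finJ by (intro card_inj_on_le) (auto intro: finite_PiE)
  also have "\<dots> = (K + 1) ^ card J" using finJ by (simp add: card_PiE)
  also have "\<dots> \<le> (K + 1) ^ r" using J(2) V(2) by (intro power_increasing) auto
  finally show ?thesis .
qed

lemma psum_lift_span: "a \<in> psum B i \<Longrightarrow> lift (a, i) \<in> span (lift ` (\<lambda>b. (b, 1)) ` B)"
proof (induction i arbitrary: a)
  case 0
  have "lift (0, 0) = 0" using lift_0 by (simp only: zero_prod_def)
  then have "lift (a, 0) = 0" using 0 by simp
  then show ?case by (simp only: span_0)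
next
  case (Suc i)
  then obtain c d where a: "a = c + d" "c \<in> psum B i" "d \<in> B" by auto
  have "lift (a, Suc i) = lift (c, i) + lift (d, 1)" using lift_add[of "(c, i)" "(d, 1)"] a by simp
  moreover have "lift (d, 1) \<in> span (lift ` (\<lambda>b. (b, 1)) ` B)" using a(3) by (intro span_base) auto
  ultimately show ?case using span_add[OF Suc.IH[OF a(2)]] by metis
qed

lemma psum_le:
  assumes "\<And>b l. b \<in> B \<Longrightarrow> lookup b l \<le> m"
  shows "a \<in> psum B i \<Longrightarrow> lookup a l \<le> i * m"
proof (induction i arbitrary: a)
  case (Suc i)
  then obtain c d where "a = c + d" "c \<in> psum B i" "d \<in> B" by auto
  then show ?case using Suc.IH[of c] assms[of d l] by (simp add: lookup_add add_mono)
qed simp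

lemma card_Bmon_le:
  fixes B :: "('n::finite \<Rightarrow>\<^sub>0 nat) set"
  assumes fin: "finite B"
  shows "\<exists>m. \<forall>M. card {x \<in> Bmon B. snd x \<le> M} \<le> (m * M + 1) ^ dim (lift ` (\<lambda>b. (b, 1)) ` B)"
proof -
  \<comment> \<open>The inserted 1 guards the height coordinate: \<open>i \<le> M\<close> has to
    imply \<open>i \<le> m * M\<close> even if all exponents are 0.\<close>
  define m where "m = Max (insert 1 (\<Union>b\<in>B. range (lookup b)))"
  have m: "lookup b l \<le> m" if "b \<in> B" for b l
    unfolding m_def by (rule Max_ge) (use that fin in auto)
  have m1: "1 \<le> m" unfolding m_def by (rule Max_ge) (use fin in auto)
  have "card {x \<in> Bmon B. snd x \<le> M} \<le> (m * M + 1) ^ dim (lift ` (\<lambda>b. (b, 1)) ` B)" for M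
  proof -
    have "card {x \<in> Bmon B. snd x \<le> M} = card (lift ` {x \<in> Bmon B. snd x \<le> M})"
      by (intro card_image[symmetric] inj_on_subset[OF lift_inj]) auto
    also have "\<dots> \<le> (m * M + 1) ^ dim (lift ` (\<lambda>b. (b, 1)) ` B)"
    proof (rule lattice_points_card)
      show "subspace (span (lift ` (\<lambda>b. (b, 1)) ` B))" by (rule subspace_span)
      show "lift ` {x \<in> Bmon B. snd x \<le> M} \<subseteq> span (lift ` (\<lambda>b. (b, 1)) ` B)"
        using psum_lift_span by (auto simp: Bmon_def)
      fix x e assume "x \<in> lift ` {x \<in> Bmon B. snd x \<le> M}" and e: "e \<in> (Basis :: ((real ^ 'n) \<times> real) set)"
      then obtain a i where x: "x = (expvec a, real i)" "a \<in> psum B i" "i \<le> M"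
        by (auto simp: Bmon_def lift_def)
      have "lookup a l \<le> m * M" for l
        using order.trans[OF psum_le[OF m x(2), of l] mult_le_mono1[OF x(3)]] by (simp only: mult.commute)
      moreover have "i \<le> m * M" using x(3) m1 mult_le_mono[of 1 m i M] by simp
      ultimately show "\<exists>k\<le>m * M. x \<bullet> e = real k"
        using e by (auto simp: Basis_prod_def x(1) Basis_vec_def inner_axis expvec_def)
    qed simp
    finally show ?thesis .
  qed
  then show ?thesis by blast
qed

context rees
begin

text \<open>Growth in \<open>N\<close> is compared: at least (N+1)^n monomials by
  \<open>chain_count\<close>, but by \<open>card_Bmon_le\<close> only a polynomial number whose
  degree is the dimension.\<close>

lemma chain_length_le:
  assumes fin: "finite G" and Q: "\<And>i. i \<le> n \<Longrightarrow> fprime (Q i)" and strict: "\<And>i. i < n \<Longrightarrow> Q i \<subset> Q (Suc i)"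
  shows "n \<le> dim (lift ` (\<lambda>b. (b, 1)) ` live (Q 0))"
proof (rule ccontr)
  let ?r = "dim (lift ` (\<lambda>b. (b, 1)) ` live (Q 0))"
  assume "\<not> n \<le> ?r"
  then have n: "Suc ?r \<le> n" by simp
  obtain D where D: "\<And>N. (N + 1) ^ n \<le> card {x \<in> Bmon (live (Q 0)). snd x \<le> D * N}"
    using chain_count[OF fin, of n Q] Q strict by blast
  obtain m where m: "\<And>M. card {x \<in> Bmon (live (Q 0)). snd x \<le> M} \<le> (m * M + 1) ^ ?r"
    using card_Bmon_le[of "live (Q 0)"] fin by (auto simp: live_def)
  \<comment> \<open>With \<open>r\<close> for the dimension, this choice turns the estimate into
    \<open>(N + 1) ^ Suc r \<le> N * (N + 1) ^ r\<close>, which is impossible.\<close>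
  define N where "N = (m * D + 1) ^ ?r"
  have "(N + 1) ^ Suc ?r \<le> (N + 1) ^ n" by (intro power_increasing n) auto
  also have "\<dots> \<le> (m * (D * N) + 1) ^ ?r" using D[of N] m[of "D * N"] by linarith
  also have "\<dots> \<le> ((m * D + 1) * (N + 1)) ^ ?r" by (intro power_mono) (auto simp: algebra_simps)
  also have "\<dots> = N * (N + 1) ^ ?r" by (simp only: N_def power_mult_distrib)
  finally show False by simp
qed

end

lemma expvec_add: "expvec (a + b) = expvec a + expvec b"
  by (simp add: expvec_def lookup_add vec_eq_iff)

lemma expvec_0 [simp]: "expvec 0 = 0"
  by (simp add: expvec_def vec_eq_iff)

lemma expvec_sum: "expvec (sum f F) = (\<Sum>x\<in>F. expvec (f x))"
  by (induction F rule: infinite_finite_induct) (auto simp: expvec_add)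

subsection \<open>Faces of the Newton polytope and chains of primes\<close>

text \<open>Facets are nonempty by definition, so for a single point the empty face, of dimension
  -1, takes their place.\<close>

lemma facet_or_empty_face:
  assumes "polytope P" "P \<noteq> {}"
  shows "\<exists>F. F face_of P \<and> aff_dim F = aff_dim P - 1"
proof (cases "aff_dim P > 0")
  case True
  then obtain F where "F facet_of P" using polytope_facet_exists assms by metis
  then show ?thesis by (auto simp: facet_of_def)
next
  case False
  then have "aff_dim P = 0" using assms(2) aff_dim_geq[of P] aff_dim_empty[of P] by linarith
  then show ?thesis by (intro exI[of _ "{}"]) auto
qed

text \<open>The dimension drops by one at each step until the empty face is reached, which is why
  there is one inclusion more than the dimension of \<open>P\<close>.\<close>

lemma flag_of_faces:
  fixes P :: "'a::euclidean_space set"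
  assumes "polytope P" "aff_dim P + 1 = int n"
  shows "\<exists>F. F 0 = P \<and> (\<forall>i\<le>n. F i face_of P) \<and> (\<forall>i<n. F (Suc i) \<subset> F i)"
  using assms
proof (induction n arbitrary: P)
  case 0
  then show ?case by (intro exI[of _ "\<lambda>_. P"]) (auto intro: face_of_refl polytope_imp_convex)
next
  case (Suc n)
  then have "P \<noteq> {}" by auto
  then obtain P' where P': "P' face_of P" "aff_dim P' = aff_dim P - 1"
    using facet_or_empty_face Suc by blast
  obtain F where F: "F 0 = P'" "\<forall>i\<le>n. F i face_of P'" "\<forall>i<n. F (Suc i) \<subset> F i"
    using Suc.IH[of P'] P' Suc.prems face_of_polytope_polytope by fastforce
  have "P' \<subset> P" using P' face_of_imp_subset by fastforce
  then show ?case
    using F P' Suc.prems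
    by (intro exI[of _ "\<lambda>i. case i of 0 \<Rightarrow> P | Suc j \<Rightarrow> F j"])
       (auto split: nat.splits intro: face_of_refl polytope_imp_convex face_of_trans simp: less_Suc_eq_0_disj)
qed

lemma psum_mono: "B \<subseteq> B' \<Longrightarrow> psum B i \<subseteq> psum B' i"
  by (induction i) auto

text \<open>Write \<open>a = c + d\<close> with \<open>c\<close> a sum of \<open>i\<close>
  generators. Then \<alpha> is at most \<open>i * \<beta>\<close> on \<open>c\<close> and at most 0
  on \<open>d\<close>; as its entries are negative, equality forces \<open>d = 0\<close> and all
  generators in the sum to be tight.\<close>

lemma Mon_functional:
  fixes \<alpha> :: "real ^ 'n::finite"
  assumes neg: "\<And>l. \<alpha> $ l < 0" and le: "\<And>b. b \<in> G \<Longrightarrow> \<alpha> \<bullet> expvec b \<le> \<beta>"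
    and x: "(a, i) \<in> Mon G"
  shows "\<alpha> \<bullet> expvec a \<le> real i * \<beta>"
    and "\<alpha> \<bullet> expvec a = real i * \<beta> \<longleftrightarrow> (a, i) \<in> Bmon {b \<in> G. \<alpha> \<bullet> expvec b = \<beta>}"
proof -
  have psum_le: "\<alpha> \<bullet> expvec c \<le> real i * \<beta> \<and>
      (\<alpha> \<bullet> expvec c = real i * \<beta> \<longleftrightarrow> c \<in> psum {b \<in> G. \<alpha> \<bullet> expvec b = \<beta>} i)" if "c \<in> psum G i" for c i
    using that
  proof (induction i arbitrary: c)
    case (Suc i)
    then obtain a b where c: "c = a + b" "a \<in> psum G i" "b \<in> G" by auto
    have e: "\<alpha> \<bullet> expvec c = \<alpha> \<bullet> expvec a + \<alpha> \<bullet> expvec b" by (simp add: c expvec_add inner_add_right)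
    show ?case
    proof (intro conjI iffI)
      show "\<alpha> \<bullet> expvec c \<le> real (Suc i) * \<beta>" using e Suc.IH[OF c(2)] le[OF c(3)] by (simp add: algebra_simps)
      show "c \<in> psum {b \<in> G. \<alpha> \<bullet> expvec b = \<beta>} (Suc i)" if "\<alpha> \<bullet> expvec c = real (Suc i) * \<beta>"
      proof -
        have "\<alpha> \<bullet> expvec a = real i * \<beta>" "\<alpha> \<bullet> expvec b = \<beta>"
        proof -
          have "real (Suc i) * \<beta> = real i * \<beta> + \<beta>" by (simp add: algebra_simps)
          then show "\<alpha> \<bullet> expvec a = real i * \<beta>" "\<alpha> \<bullet> expvec b = \<beta>"
            using that e Suc.IH[OF c(2)] le[OF c(3)] by linarith+
        qed
        then show ?thesis using Suc.IH[OF c(2)] c by auto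
      qed
      show "\<alpha> \<bullet> expvec c = real (Suc i) * \<beta>" if c_mem: "c \<in> psum {b \<in> G. \<alpha> \<bullet> expvec b = \<beta>} (Suc i)"
      proof -
        obtain a' b' where c': "c = a' + b'" "a' \<in> psum {b \<in> G. \<alpha> \<bullet> expvec b = \<beta>} i" "b' \<in> G" "\<alpha> \<bullet> expvec b' = \<beta>"
          using c_mem by auto
        have "a' \<in> psum G i" using psum_mono[of "{b \<in> G. \<alpha> \<bullet> expvec b = \<beta>}" G i] c'(2) by auto
        then have "\<alpha> \<bullet> expvec a' = real i * \<beta>" using Suc.IH c'(2) by blast
        then show ?thesis using c' by (simp add: expvec_add inner_add_right algebra_simps)
      qed
    qed
  qed simp
  obtain c d where a: "a = c + d" "c \<in> psum G i" using x by (auto simp: Mon_def dv_def)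
  have e: "\<alpha> \<bullet> expvec a = \<alpha> \<bullet> expvec c + \<alpha> \<bullet> expvec d" by (simp add: a expvec_add inner_add_right)
  have d: "\<alpha> \<bullet> expvec d = (\<Sum>l\<in>UNIV. \<alpha> $ l * real (lookup d l))" by (simp add: inner_vec_def expvec_def)
  have d1: "\<alpha> \<bullet> expvec d \<le> 0" unfolding d
    by (intro sum_nonpos) (use neg in \<open>auto simp: mult_le_0_iff less_imp_le\<close>)
  show "\<alpha> \<bullet> expvec a \<le> real i * \<beta>" using e d1 psum_le[OF a(2)] by linarith
  show "\<alpha> \<bullet> expvec a = real i * \<beta> \<longleftrightarrow> (a, i) \<in> Bmon {b \<in> G. \<alpha> \<bullet> expvec b = \<beta>}"
  proof
    assume eq: "\<alpha> \<bullet> expvec a = real i * \<beta>"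
    have "\<alpha> \<bullet> expvec d = 0" using e d1 psum_le[OF a(2)] eq by linarith
    then have "(\<Sum>l\<in>UNIV. - (\<alpha> $ l * real (lookup d l))) = 0" using d by (simp add: sum_negf)
    then have "\<forall>l\<in>UNIV. - (\<alpha> $ l * real (lookup d l)) = 0"
      by (subst (asm) sum_nonneg_eq_0_iff) (use neg in \<open>auto simp: mult_le_0_iff less_imp_le\<close>)
    then have "\<alpha> $ l * real (lookup d l) = 0" for l by simp
    then have "lookup d l = 0" for l using neg[of l] by (metis less_irrefl mult_eq_0_iff of_nat_eq_0_iff)
    then have "d = 0" by (intro poly_mapping_eqI) simp
    then show "(a, i) \<in> Bmon {b \<in> G. \<alpha> \<bullet> expvec b = \<beta>}"
      using psum_le[OF a(2)] eq a by (auto simp: Bmon_def)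
  next
    assume b: "(a, i) \<in> Bmon {b \<in> G. \<alpha> \<bullet> expvec b = \<beta>}"
    then have "a \<in> psum G i" using psum_mono[of "{b \<in> G. \<alpha> \<bullet> expvec b = \<beta>}" G i] by (auto simp: Bmon_def)
    then show "\<alpha> \<bullet> expvec a = real i * \<beta>" using psum_le b by (auto simp: Bmon_def)
  qed
qed

text \<open>The face is the zero set of the additive function
  \<open>i * \<beta> - \<alpha> \<bullet> expvec a\<close>, which is nonnegative on
  \<open>Mon G\<close>; a sum of two nonnegative numbers vanishes only if both do.\<close>

lemma face_in_Bmon:
  fixes \<alpha> :: "real ^ 'n::finite"
  assumes neg: "\<And>l. \<alpha> $ l < 0" and le: "\<And>b. b \<in> G \<Longrightarrow> \<alpha> \<bullet> expvec b \<le> \<beta>"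
  shows "face_in (Bmon {b \<in> G. \<alpha> \<bullet> expvec b = \<beta>}) (Mon G)" (is "face_in ?F _")
  unfolding face_in_def
proof (intro conjI ballI)
  show "?F \<subseteq> Mon G"
    using psum_mono[of "{b \<in> G. \<alpha> \<bullet> expvec b = \<beta>}" G] psum_in_Mon by (fastforce simp: Bmon_def)
  show "0 \<in> ?F" by (simp add: Bmon_def zero_prod_def)
  fix x y assume xy: "x \<in> Mon G" "y \<in> Mon G"
  obtain a i b j where x: "x = (a, i)" and y: "y = (b, j)" by fastforce
  have "(a + b, i + j) \<in> Mon G" using Mon_add[OF xy] x y by simp
  have M: "\<alpha> \<bullet> expvec a \<le> real i * \<beta>"
    "\<alpha> \<bullet> expvec a = real i * \<beta> \<longleftrightarrow> (a, i) \<in> Bmon {b \<in> G. \<alpha> \<bullet> expvec b = \<beta>}" if "(a, i) \<in> Mon G" for a i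
    using Mon_functional[of \<alpha> G \<beta>] neg le that by auto
  have "x + y \<in> ?F \<longleftrightarrow> \<alpha> \<bullet> expvec (a + b) = real (i + j) * \<beta>"
    using M(2)[OF \<open>(a + b, i + j) \<in> Mon G\<close>] x y by simp
  also have "\<dots> \<longleftrightarrow> \<alpha> \<bullet> expvec a = real i * \<beta> \<and> \<alpha> \<bullet> expvec b = real j * \<beta>"
    using M(1)[OF xy(1)[unfolded x]] M(1)[OF xy(2)[unfolded y]]
    by (auto simp: expvec_add inner_add_right algebra_simps)
  also have "\<dots> \<longleftrightarrow> x \<in> ?F \<and> y \<in> ?F" using M(2)[OF xy(1)[unfolded x]] M(2)[OF xy(2)[unfolded y]] x y by simp
  finally show "x + y \<in> ?F \<longleftrightarrow> x \<in> ?F \<and> y \<in> ?F" .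
qed

definition newton :: "('n::finite \<Rightarrow>\<^sub>0 nat) set \<Rightarrow> (real ^ 'n) set" where
  "newton G = convex hull (expvec ` G)"

lemma newton_le_iff: "(\<forall>u\<in>newton G. \<alpha> \<bullet> u \<le> \<beta>) \<longleftrightarrow> (\<forall>b\<in>G. \<alpha> \<bullet> expvec b \<le> \<beta>)"
proof
  assume "\<forall>b\<in>G. \<alpha> \<bullet> expvec b \<le> \<beta>"
  then have "newton G \<subseteq> {u. \<alpha> \<bullet> u \<le> \<beta>}"
    unfolding newton_def by (intro hull_minimal convex_halfspace_le) auto
  then show "\<forall>u\<in>newton G. \<alpha> \<bullet> u \<le> \<beta>" by auto
qed (auto simp: newton_def intro: hull_inc)

text \<open>Faces of compact faces are compact: a large multiple of \<open>W\<close> is added to any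
  functional exposing \<open>F\<close>. This makes all entries negative and still exposes
  \<open>F\<close>, because \<open>W\<close> is maximal there.\<close>

lemma negative_exposing_functional:
  fixes E :: "(real ^ 'n::finite) set" and W :: "real ^ 'n"
  assumes E: "polytope E" and neg: "\<And>l. W $ l < 0" and le: "\<And>u. u \<in> E \<Longrightarrow> W \<bullet> u \<le> M"
    and F: "F face_of (E \<inter> {u. W \<bullet> u = M})"
  shows "\<exists>(\<alpha> :: real ^ 'n) \<beta>. (\<forall>l. \<alpha> $ l < 0) \<and> (\<forall>u\<in>E. \<alpha> \<bullet> u \<le> \<beta>) \<and> F = E \<inter> {u. \<alpha> \<bullet> u = \<beta>}"
proof -
  have "(E \<inter> {u. W \<bullet> u = M}) face_of E"
    using E le by (intro face_of_Int_supporting_hyperplane_le polytope_imp_convex) auto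
  then have "F face_of E" using F face_of_trans by blast
  then have "F exposed_face_of E" using E exposed_face_of_polyhedron polytope_imp_polyhedron by blast
  then obtain a b where ab: "E \<subseteq> {x. a \<bullet> x \<le> b}" "F = E \<inter> {x. a \<bullet> x = b}"
    by (auto simp: exposed_face_of_def)
  \<comment> \<open>\<open>N\<close> exceeds each
    \<open>\<bar>a $ l\<bar> / \<bar>W $ l\<bar>\<close>, so the negative entries of
    \<open>N *\<^sub>R W\<close> outweigh those of \<open>a\<close>; the 1 makes this strict and
    \<open>N\<close> positive.\<close>
  define N where "N = 1 + (\<Sum>l\<in>UNIV. \<bar>a $ l\<bar> / \<bar>W $ l\<bar>)"
  have N: "\<bar>a $ l\<bar> / \<bar>W $ l\<bar> < N" for l
    using member_le_sum[of l UNIV "\<lambda>l. \<bar>a $ l\<bar> / \<bar>W $ l\<bar>"] by (simp add: N_def)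
  have "0 \<le> (\<Sum>l\<in>UNIV. \<bar>a $ l\<bar> / \<bar>W $ l\<bar>)" by (intro sum_nonneg) auto
  then have N0: "N > 0" by (simp add: N_def)
  have "(a + N *\<^sub>R W) $ l < 0" for l
    using N[of l] neg[of l] by (simp add: divide_simps)
  moreover have le': "(a + N *\<^sub>R W) \<bullet> u \<le> b + N * M"
    and eq': "(a + N *\<^sub>R W) \<bullet> u = b + N * M \<longleftrightarrow> a \<bullet> u = b \<and> W \<bullet> u = M" if u: "u \<in> E" for u
  proof -
    have e: "(a + N *\<^sub>R W) \<bullet> u = a \<bullet> u + N * (W \<bullet> u)" by (simp add: inner_add_left)
    have 1: "N * (W \<bullet> u) \<le> N * M" using le[OF u] N0 by simp
    have 2: "a \<bullet> u \<le> b" using ab(1) u by auto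
    show "(a + N *\<^sub>R W) \<bullet> u \<le> b + N * M" using e 1 2 by linarith
    have "N * (W \<bullet> u) = N * M \<longleftrightarrow> W \<bullet> u = M" using N0 by simp
    then show "(a + N *\<^sub>R W) \<bullet> u = b + N * M \<longleftrightarrow> a \<bullet> u = b \<and> W \<bullet> u = M" using e 1 2 by linarith
  qed
  moreover have "F \<subseteq> E \<inter> {u. W \<bullet> u = M}" using F face_of_imp_subset by blast
  then have "F = E \<inter> {u. (a + N *\<^sub>R W) \<bullet> u = b + N * M}" using ab(2) eq' by blast
  ultimately show ?thesis by blast
qed

context rees
begin

lemma krull_dim_ge_face:
  fixes W :: "(real, 'n) vec"
  assumes fin: "finite G" and neg: "\<And>l. W $ l < 0" and le: "\<And>u. u \<in> newton G \<Longrightarrow> W \<bullet> u \<le> M"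
    and n: "int n = aff_dim (newton G \<inter> {u. W \<bullet> u = M}) + 1"
  shows "krull_dim (fiber_ring A) \<ge> ereal (real n)"
proof -
  let ?F0 = "newton G \<inter> {u. W \<bullet> u = M}"
  have E: "polytope (newton G)" unfolding newton_def using fin by (intro polytope_convex_hull) auto
  have face: "?F0 face_of newton G"
    using E le by (intro face_of_Int_supporting_hyperplane_le polytope_imp_convex) auto
  obtain F where F: "F 0 = ?F0" "\<And>i. i \<le> n \<Longrightarrow> F i face_of ?F0" "\<And>i. i < n \<Longrightarrow> F (Suc i) \<subset> F i"
    using flag_of_faces[of ?F0 n] face_of_polytope_polytope[OF E face] n by auto
  define B where "B i = {b \<in> G. expvec b \<in> F i}" for i
  have ex: "\<exists>(\<alpha> :: (real, 'n) vec) \<beta>. (\<forall>l. \<alpha> $ l < 0) \<and> (\<forall>b\<in>G. \<alpha> \<bullet> expvec b \<le> \<beta>) \<and> B i = {b\<in>G. \<alpha> \<bullet> expvec b = \<beta>}" if i: "i \<le> n" for i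
  proof -
    obtain \<alpha> :: "(real, 'n) vec" and \<beta> where ab: "\<forall>l. \<alpha> $ l < 0" "\<forall>u\<in>newton G. \<alpha> \<bullet> u \<le> \<beta>" "F i = newton G \<inter> {u. \<alpha> \<bullet> u = \<beta>}"
      using negative_exposing_functional[OF E neg le F(2)[OF i]] by auto
    have "expvec b \<in> newton G" if "b \<in> G" for b using that by (auto simp: newton_def intro: hull_inc)
    then have "B i = {b\<in>G. \<alpha> \<bullet> expvec b = \<beta>}" using ab(3) by (auto simp: B_def)
    then show ?thesis using ab newton_le_iff by blast
  qed
  have BM: "face_in (Bmon (B i)) (Mon G)" if i: "i \<le> n" for i
  proof -
    obtain \<alpha> :: "(real, 'n) vec" and \<beta> where ab: "\<forall>l. \<alpha> $ l < 0" "\<forall>b\<in>G. \<alpha> \<bullet> expvec b \<le> \<beta>" "B i = {b\<in>G. \<alpha> \<bullet> expvec b = \<beta>}"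
      using ex[OF i] by blast
    show ?thesis unfolding ab(3) by (rule face_in_Bmon) (use ab in auto)
  qed
  show ?thesis
  proof (rule krull_dim_ge[OF BM])
    fix i assume i: "i < n"
    have "B (Suc i) \<subseteq> B i" using F(3)[OF i] by (auto simp: B_def)
    \<comment> \<open>A face is the convex hull of the generators on it, so different faces carry
      different sets of generators.\<close>
    moreover have "\<not> B i \<subseteq> B (Suc i)"
    proof
      assume sub: "B i \<subseteq> B (Suc i)"
      have "F i face_of convex hull (expvec ` G)"
        using F(2)[of i] i face face_of_trans unfolding newton_def by fastforce
      then obtain S where S: "S \<subseteq> expvec ` G" "F i = convex hull S"
        using face_of_convex_hull_subset[of "expvec ` G"] fin by (metis finite_imageI finite_imp_compact)
      have "S \<subseteq> F (Suc i)" using S hull_subset[of S convex] sub by (fastforce simp: B_def)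
      moreover have "convex (F (Suc i))" using F(2)[of "Suc i"] i face_of_imp_convex face_of_polytope_polytope[OF E face] by (simp add: face_of_imp_convex)
      ultimately have "F i \<subseteq> F (Suc i)" using S(2) hull_minimal by metis
      then show False using F(3)[OF i] by auto
    qed
    ultimately obtain b where b: "b \<in> B i" "b \<notin> B (Suc i)" "B (Suc i) \<subseteq> B i" by auto
    have "(b, 1) \<in> Bmon (B i)" "(b, 1) \<notin> Bmon (B (Suc i))" using b by (auto simp: Bmon_def)
    moreover have "Bmon (B (Suc i)) \<subseteq> Bmon (B i)" using psum_mono[OF b(3)] by (auto simp: Bmon_def)
    ultimately show "Bmon (B (Suc i)) \<subset> Bmon (B i)" by blast
  next
    fix l :: 'n and i assume "i \<le> n"
    \<comment> \<open>In degree 0 the monoid \<open>Bmon (B i)\<close> contains only the exponent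
      0.\<close>
    show "(Poly_Mapping.single l 1, 0) \<notin> Bmon (B i)" by (simp add: Bmon_def)
  qed
qed

end

section \<open>Integral duality and the compact face that carries the live generators\<close>

lemma convex_cone_hull_image_finite:
  fixes v :: "'i \<Rightarrow> 'a::real_vector"
  assumes "finite I" "x \<in> convex_cone hull (v ` I)"
  shows "\<exists>c. (\<forall>g. 0 \<le> c g) \<and> x = (\<Sum>g\<in>I. c g *\<^sub>R v g)"
proof -
  let ?S = "{x. \<exists>c. (\<forall>g. 0 \<le> c g) \<and> x = (\<Sum>g\<in>I. c g *\<^sub>R v g)}"
  have "convex_cone hull (v ` I) \<subseteq> ?S"
  proof (rule hull_minimal)
    show "v ` I \<subseteq> ?S"
    proof safe
      fix g assume "g \<in> I"
      then have "v g = (\<Sum>h\<in>I. (if h = g then 1 else 0) *\<^sub>R v h)"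
        using assms(1) by (simp add: if_distrib[of "\<lambda>r. r *\<^sub>R _"] cong: if_cong)
      then show "\<exists>c. (\<forall>g. 0 \<le> c g) \<and> v g = (\<Sum>g\<in>I. c g *\<^sub>R v g)"
        by (intro exI[of _ "\<lambda>h. if h = g then 1 else 0"]) simp
    qed
    show "convex_cone ?S"
      unfolding convex_cone_iff
    proof (intro conjI ballI allI impI)
      show "0 \<in> ?S" by (auto intro: exI[of _ "\<lambda>_. 0"])
      fix x y assume "x \<in> ?S" "y \<in> ?S"
      then obtain c d where "\<forall>g. 0 \<le> c g" "x = (\<Sum>g\<in>I. c g *\<^sub>R v g)" "\<forall>g. 0 \<le> d g" "y = (\<Sum>g\<in>I. d g *\<^sub>R v g)"
        by blast
      then show "x + y \<in> ?S"
        by (auto intro!: exI[of _ "\<lambda>g. c g + d g"] simp: scaleR_left_distrib sum.distrib)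
    next
      fix x and t :: real assume "x \<in> ?S" "0 \<le> t"
      then obtain c where "\<forall>g. 0 \<le> c g" "x = (\<Sum>g\<in>I. c g *\<^sub>R v g)" by blast
      then show "t *\<^sub>R x \<in> ?S" using \<open>0 \<le> t\<close>
        by (auto intro!: exI[of _ "\<lambda>g. t * c g"] simp: scaleR_sum_right)
    qed
  qed
  then show ?thesis using assms(2) by blast
qed

text \<open>Simultaneous Dirichlet approximation turns the real solution provided by separation into an
  integral one: coordinates of an integral vector that are smaller than \<open>1\<close> in absolute value vanish.\<close>

lemma integral_alternative:
  fixes v :: "'i \<Rightarrow> real ^ 'n::finite"
  assumes fin: "finite I" and int: "\<And>g l. g \<in> I \<Longrightarrow> v g $ l \<in> \<int>"
    and noW: "\<not> (\<exists>W :: real ^ 'n. (\<forall>l. W $ l < 0) \<and> (\<forall>g\<in>I. W \<bullet> v g \<le> 0))"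
  shows "\<exists>n :: 'i \<Rightarrow> nat. (\<forall>l. (\<Sum>g\<in>I. real (n g) *\<^sub>R v g) $ l \<le> 0) \<and> (\<Sum>g\<in>I. real (n g) *\<^sub>R v g) \<noteq> 0"
proof -
  define K where "K = convex_cone hull (v ` I)"
  \<comment> \<open>The simplex of nonpositive vectors with coordinate sum -1. A point it shares
    with the cone \<open>K\<close> is a nonzero nonpositive combination of the \<open>v g\<close>;
    if there is none, separation yields the excluded functional.\<close>
  define T where "T = convex hull (range (\<lambda>l :: 'n. - axis l (1::real)))"
  have K: "closed K" "convex K" "0 \<in> K"
    unfolding K_def using fin by (auto intro!: closed_convex_cone_hull convex_convex_cone_hull convex_cone_hull_contains_0)
  have T: "compact T" "convex T" "T \<noteq> {}"
    unfolding T_def by (rule compact_convex_hull, rule finite_imp_compact) auto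
  have "K \<inter> T \<noteq> {}"
  proof
    assume "K \<inter> T = {}"
    then obtain a b where ab: "\<forall>x\<in>K. a \<bullet> x < b" "\<forall>x\<in>T. a \<bullet> x > b"
      using separating_hyperplane_closed_compact[OF K(2,1) T(2,1,3)] by blast
    have b: "b > 0" using ab(1) K(3) by force
    have "a $ l < 0" for l
    proof -
      have "- axis l 1 \<in> T" unfolding T_def by (rule hull_inc) simp
      then have "a \<bullet> - axis l 1 > b" using ab(2) by blast
      then show ?thesis using b by (simp add: inner_axis)
    qed
    moreover have "a \<bullet> v g \<le> 0" if "g \<in> I" for g
    proof (rule ccontr)
      assume "\<not> a \<bullet> v g \<le> 0"
      then have pos: "a \<bullet> v g > 0" by simp
      have "v g \<in> K" unfolding K_def using that by (auto intro: hull_inc)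
      \<comment> \<open>A positive value could be scaled up to \<open>b\<close>, which \<open_bound>
        is not attained on the cone.\<close>
      then have "(b / (a \<bullet> v g)) *\<^sub>R v g \<in> K" unfolding K_def using b pos by (auto intro: convex_cone_hull_mul)
      then have "a \<bullet> ((b / (a \<bullet> v g)) *\<^sub>R v g) < b" using ab(1) by blast
      then show False using pos by simp
    qed
    ultimately show False using noW by blast
  qed
  then obtain x where x: "x \<in> K" "x \<in> T" by blast
  have "T \<subseteq> {x. (\<forall>l. x $ l \<le> 0) \<and> (\<Sum>l\<in>UNIV. x $ l) = -1}"
    unfolding T_def
  proof (rule hull_minimal)
    show "convex {x :: real ^ 'n. (\<forall>l. x $ l \<le> 0) \<and> (\<Sum>l\<in>UNIV. x $ l) = -1}"
    proof (rule convexI, safe)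
      fix x y :: "real ^ 'n" and u w :: real
      assume *: "0 \<le> u" "0 \<le> w" "u + w = 1" "\<forall>l. x $ l \<le> 0" "(\<Sum>l\<in>UNIV. x $ l) = -1"
        "\<forall>l. y $ l \<le> 0" "(\<Sum>l\<in>UNIV. y $ l) = -1"
      show "(u *\<^sub>R x + w *\<^sub>R y) $ l \<le> 0" for l
        using * mult_nonneg_nonpos[of u "x $ l"] mult_nonneg_nonpos[of w "y $ l"] by simp
      show "(\<Sum>l\<in>UNIV. (u *\<^sub>R x + w *\<^sub>R y) $ l) = -1"
        using * by (simp add: sum.distrib flip: sum_distrib_left)
    qed
    show "range (\<lambda>l. - axis l 1) \<subseteq> {x :: real ^ 'n. (\<forall>l. x $ l \<le> 0) \<and> (\<Sum>l\<in>UNIV. x $ l) = -1}"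
      by (auto simp: axis_def sum_negf)
  qed
  then have xneg: "x $ l \<le> 0" and xsum: "(\<Sum>l\<in>UNIV. x $ l) = -1" for l using x by auto
  obtain l0 where l0: "x $ l0 < 0"
  proof -
    have "\<exists>l. x $ l < 0"
    proof (rule ccontr)
      assume "\<not> (\<exists>l. x $ l < 0)"
      then have "0 \<le> (\<Sum>l\<in>UNIV. x $ l)" by (intro sum_nonneg) (auto simp: not_less)
      then show False using xsum by simp
    qed
    then show ?thesis using that by blast
  qed
  obtain c where c: "\<And>g. 0 \<le> c g" "x = (\<Sum>g\<in>I. c g *\<^sub>R v g)"
    using convex_cone_hull_image_finite[OF fin x(1)[unfolded K_def]] by blast
  define S where "S = (\<Sum>g\<in>I. \<Sum>l\<in>UNIV. \<bar>v g $ l\<bar>)"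
  have S0: "S \<ge> 0" unfolding S_def by (intro sum_nonneg) auto
  \<comment> \<open>The rounding error will be at most \<open>S / N\<close> in each coordinate.
    These bounds keep every coordinate below 1 and coordinate \<open>l0\<close> below 0.\<close>
  obtain N :: nat where N: "N > 0" "S < real N" "S < real N * - (x $ l0)"
  proof -
    obtain N1 :: nat where N1: "max S (S / - (x $ l0)) < real N1" using reals_Archimedean2 by blast
    have "S / - (x $ l0) < real N1" by (rule order.strict_trans1[OF max.cobounded2 N1])
    from iffD1[OF pos_divide_less_eq this] have "S < real N1 * - (x $ l0)" using l0 by simp
    moreover have "N1 > 0" using N1 S0 by (cases N1) auto
    ultimately show ?thesis using N1 that by auto
  qed
  obtain e where e: "bij_betw e I {..<card I}" using fin by (metis ex_bij_betw_finite_nat atLeast0LessThan)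
  let ?inv = "the_inv_into I e"
  obtain q p where q: "0 < q" "\<And>i. i < card I \<Longrightarrow> \<bar>of_int q * c (?inv i) - of_int (p i)\<bar> < 1 / N"
    using Dirichlet_approx_simult[OF N(1), of "card I" "\<lambda>i. c (?inv i)"] by blast
  define r where "r g = p (e g)" for g
  have r: "\<bar>of_int q * c g - of_int (r g)\<bar> < 1 / N" if "g \<in> I" for g
  proof -
    have "e g < card I" using e that by (auto simp: bij_betw_def)
    moreover have "?inv (e g) = g" using e that by (intro the_inv_into_f_f) (auto simp: bij_betw_def)
    ultimately show ?thesis using q(2)[of "e g"] by (simp add: r_def)
  qed
  \<comment> \<open>An integer within less than 1 of a nonnegative number is greater than
    -1.\<close>
  have r0: "r g \<ge> 0" if "g \<in> I" for g
  proof -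
    have "0 \<le> of_int q * c g" using q(1) c(1) by simp
    moreover have "1 / real N \<le> 1" using N(1) by simp
    ultimately have "real_of_int (r g) > -1" using r[OF that] by linarith
    then show ?thesis by linarith
  qed
  define n where "n g = nat (r g)" for g
  define y where "y = (\<Sum>g\<in>I. real (n g) *\<^sub>R v g)"
  have yl: "y $ l \<in> \<int>" for l
    unfolding y_def by (auto intro!: Ints_sum Ints_mult int)
  have err: "\<bar>y $ l - of_int q * x $ l\<bar> \<le> S / N" for l
  proof -
    have "y $ l - of_int q * x $ l = (\<Sum>g\<in>I. (of_int (r g) - of_int q * c g) * v g $ l)"
      unfolding y_def c(2) using r0
      by (simp add: n_def sum_distrib_left algebra_simps flip: sum_subtractf)
    also have "\<bar>\<dots>\<bar> \<le> (\<Sum>g\<in>I. \<bar>(of_int (r g) - of_int q * c g) * v g $ l\<bar>)" by (rule sum_abs)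
    also have "\<dots> \<le> (\<Sum>g\<in>I. (1 / N) * (\<Sum>l\<in>UNIV. \<bar>v g $ l\<bar>))"
    proof (rule sum_mono)
      fix g assume g: "g \<in> I"
      have "\<bar>of_int (r g) - of_int q * c g\<bar> \<le> 1 / N" using r[OF g] by (simp add: abs_minus_commute)
      moreover have "\<bar>v g $ l\<bar> \<le> (\<Sum>l\<in>UNIV. \<bar>v g $ l\<bar>)" by (rule member_le_sum) auto
      ultimately show "\<bar>(of_int (r g) - of_int q * c g) * v g $ l\<bar> \<le> (1 / N) * (\<Sum>l\<in>UNIV. \<bar>v g $ l\<bar>)"
        unfolding abs_mult by (intro mult_mono) auto
    qed
    also have "\<dots> = S / N" unfolding S_def sum_distrib_left[symmetric] by simp
    finally show ?thesis .
  qed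
  have SN: "S / N < 1" "S / N < - (x $ l0)" using N by (auto simp: divide_simps mult.commute)
  have "y $ l \<le> 0" for l
  proof -
    have "of_int q * x $ l \<le> 0" using q(1) xneg[of l] by (simp add: mult_nonneg_nonpos)
    then have "y $ l < 1" using err[of l] SN(1) by linarith
    moreover obtain k where "y $ l = of_int k" using yl[of l] by (auto simp: Ints_def)
    ultimately show ?thesis by simp
  qed
  moreover have "y $ l0 < 0"
  proof -
    have "of_int q * x $ l0 \<le> 1 * x $ l0" using q(1) l0 by (intro mult_right_mono_neg) auto
    then show ?thesis using err[of l0] SN(2) by linarith
  qed
  then have "y \<noteq> 0" by auto
  ultimately show ?thesis unfolding y_def by blast
qed

definition nmul :: "nat \<Rightarrow> ('n \<Rightarrow>\<^sub>0 nat) \<Rightarrow> ('n \<Rightarrow>\<^sub>0 nat)" where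
  "nmul k a = (\<Sum>_\<in>{..<k}. a)"

lemma expvec_nmul: "expvec (nmul k a) = real k *\<^sub>R expvec a"
  by (simp add: nmul_def expvec_sum) (simp add: scaleR_conv_of_real vec_eq_iff)

lemma psum_sum:
  assumes "finite H" "\<And>g. g \<in> H \<Longrightarrow> f g \<in> psum G (k g)"
  shows "sum f H \<in> psum G (sum k H)"
  using assms
proof (induction H rule: finite_induct)
  case (insert g H)
  then have "f g + sum f H \<in> psum G (k g + sum k H)" by (intro psum_add) simp_all
  then show ?case using insert(1,2) by simp
qed simp

lemma psum_nmul: "a \<in> psum G i \<Longrightarrow> nmul k a \<in> psum G (k * i)"
proof (induction k)
  case (Suc k)
  then show ?case using psum_add[OF Suc.prems Suc.IH[OF Suc.prems]] by (simp add: nmul_def add.commute)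
qed (simp add: nmul_def)

text \<open>All lifts differ from the lift of one fixed \<open>b0\<close> by vectors at height 0,
  which span the direction space of the affine hull.\<close>

lemma aff_dim_lift:
  fixes B :: "('n::finite \<Rightarrow>\<^sub>0 nat) set"
  assumes "B \<noteq> {}"
  shows "int (dim (lift ` (\<lambda>b. (b, 1)) ` B)) \<le> aff_dim (expvec ` B) + 1"
proof -
  obtain b0 where b0: "b0 \<in> B" using assms by blast
  let ?D = "(\<lambda>x. x - expvec b0) ` expvec ` B" and ?j = "\<lambda>v :: real ^ 'n. (v, 0 :: real)"
  have "lift (b, 1) \<in> span (insert (lift (b0, 1)) (?j ` ?D))" if "b \<in> B" for b
  proof -
    have "lift (b, 1) = ?j (expvec b - expvec b0) + lift (b0, 1)" by (simp add: lift_def)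
    then show ?thesis using that by (auto intro!: span_add intro: span_base)
  qed
  then have "lift ` (\<lambda>b. (b, 1)) ` B \<subseteq> span (insert (lift (b0, 1)) (?j ` ?D))" by auto
  then have "dim (lift ` (\<lambda>b. (b, 1)) ` B) \<le> dim (insert (lift (b0, 1)) (?j ` ?D))" by (rule dim_mono)
  also have "\<dots> \<le> dim (?j ` ?D) + 1" by (simp add: dim_insert)
  also have "dim (?j ` ?D) \<le> dim ?D"
    by (rule dim_image_le) (auto intro!: linearI)
  finally have "int (dim (lift ` (\<lambda>b. (b, 1)) ` B)) \<le> int (dim ?D) + 1" by simp
  moreover have "aff_dim (expvec ` B) = int (dim ?D)"
    by (rule aff_dim_eq_dim_subtract) (use b0 in \<open>auto intro: hull_inc\<close>)
  ultimately show ?thesis by simp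
qed

context rees
begin

lemma mono_prod_power:
  "(\<Prod>b\<in>H. mterm (b, 1) (1::'k)) = mterm (\<Sum>b\<in>H. b, card H) 1"
  by (induction H rule: infinite_finite_induct) (auto simp: mono_mult mono_0_1[unfolded zero_prod_def])

lemma mono_power: "mterm (a, i) (1::'k) ^ k = mterm (nmul k a, k * i) 1"
  by (induction k) (auto simp: mono_mult mono_0_1[unfolded zero_prod_def] nmul_def add.commute)

lemma mono_shifted_in:
  assumes "fprime Q" "c \<in> psum G i" "d \<noteq> 0"
  shows "mterm (c + d, i) (e::'k) \<in> Q"
proof -
  obtain l where l: "lookup d l \<noteq> 0" using assms(3) by (metis lookup_zero poly_mapping_eqI)
  have "c + d = Poly_Mapping.single l 1 + (c + (d - Poly_Mapping.single l 1))"
    using l by (intro poly_mapping_eqI) (auto simp: lookup_add lookup_minus lookup_single when_def)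
  moreover have "(c + (d - Poly_Mapping.single l 1), i) \<in> Mon G"
    using assms(2) by (auto simp: Mon_def dv_def)
  ultimately show ?thesis using fprime_D(8)[OF assms(1) span_of_mono] var_mult by metis
qed

text \<open>Suppose no functional with negative entries is maximal over \<open>G\<close> at the
  barycentre of the live exponents. Duality then shows that some power of x^P t^m, the product of
  all live generators, is a product of generators times a nontrivial monomial in the variables,
  hence lies in \<open>Q\<close>; but its factors are outside \<open>Q\<close>. A functional that is
  maximal at the barycentre attains this maximum at every live exponent.\<close>

lemma live_on_face:
  assumes fin: "finite G" and Q: "fprime Q" and ne: "live Q \<noteq> {}"
  shows "\<exists>(W :: (real, 'n) vec) M. (\<forall>l. W $ l < 0) \<and> (\<forall>b\<in>G. W \<bullet> expvec b \<le> M) \<and> (\<forall>b\<in>live Q. W \<bullet> expvec b = M)"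
proof -
  let ?B = "live Q"
  have finB: "finite ?B" and BG: "?B \<subseteq> G" using fin by (auto simp: live_def)
  define m where "m = card ?B"
  have m: "m > 0" using finB ne by (simp add: m_def card_gt_0_iff)
  define P where "P = (\<Sum>b\<in>?B. b)"
  \<comment> \<open>The difference of \<open>g\<close> and the barycentre, multiplied by
    \<open>m\<close> to become integral.\<close>
  define v where "v g = real m *\<^sub>R expvec g - expvec P" for g
  have vint: "v g $ l \<in> \<int>" for g l by (simp add: v_def expvec_def)
  have PQ: "mterm (P, m) 1 \<notin> Q"
  proof -
    have "(\<Prod>b\<in>H. mterm (b, 1) (1::'k)) \<notin> Q" if "finite H" "H \<subseteq> ?B" for H
      using that
    proof (induction H rule: finite_induct)
      case (insert b H)
      have "mterm (b, 1) (1::'k) \<notin> Q" "mterm (b, 1) (1::'k) \<in> span_of (Mon G)"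
        using insert by (auto simp: live_def intro!: span_of_mono gen_in_Mon[unfolded One_nat_def])
      moreover have "(\<Prod>b\<in>H. mterm (b, 1) (1::'k)) \<in> span_of (Mon G)"
        using insert by (intro prod_mem span_of_mono gen_in_Mon) (auto simp: live_def)
      ultimately show ?case using insert fprime_D(6)[OF Q] by auto
    qed (simp add: fprime_D(7)[OF Q])
    from this[OF finB] show ?thesis unfolding mono_prod_power P_def m_def by simp
  qed
  have "\<exists>W :: (real, 'n) vec. (\<forall>l. W $ l < 0) \<and> (\<forall>g\<in>G. W \<bullet> v g \<le> 0)"
  proof (rule ccontr)
    assume "\<not> ?thesis"
    then obtain n :: "_ \<Rightarrow> nat" where n: "\<And>l. (\<Sum>g\<in>G. real (n g) *\<^sub>R v g) $ l \<le> 0" "(\<Sum>g\<in>G. real (n g) *\<^sub>R v g) \<noteq> 0"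
      using integral_alternative[OF fin, of v] vint by blast
    define N where "N = (\<Sum>g\<in>G. n g)"
    define c where "c = (\<Sum>g\<in>G. nmul (m * n g) g)"
    have "c \<in> psum G (\<Sum>g\<in>G. m * n g)"
      unfolding c_def using psum_nmul[of _ G 1] by (intro psum_sum fin) fastforce
    then have c: "c \<in> psum G (N * m)" unfolding N_def sum_distrib_right by (simp only: mult.commute)
    have y: "(\<Sum>g\<in>G. real (n g) *\<^sub>R v g) = expvec c - expvec (nmul N P)"
      by (simp add: v_def c_def expvec_sum expvec_nmul N_def scaleR_diff_right sum_subtractf
          scaleR_sum_left mult.commute)
    have "dv c (nmul N P)"
      unfolding dv_iff using n(1) by (simp add: y expvec_def)
    then obtain d where d: "nmul N P = c + d" by (auto simp: dv_def)
    have "d \<noteq> 0" using n(2) y d by auto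
    then have "mterm (nmul N P, N * m) 1 \<in> Q" using mono_shifted_in[OF Q c] d by metis
    moreover have "mterm (P, m) (1::'k) \<in> span_of (Mon G)"
    proof -
      have "P \<in> psum ?B m" unfolding P_def m_def using psum_sum[OF finB, of "\<lambda>b. b" ?B "\<lambda>_. 1"] by simp
      then show ?thesis using psum_mono[OF BG] by (intro span_of_mono psum_in_Mon) auto
    qed
    ultimately show False using fprime_power_notin[OF Q _ PQ, of N] by (simp add: mono_power)
  qed
  then obtain W :: "(real, 'n) vec" where W: "\<And>l. W $ l < 0" "\<And>g. g \<in> G \<Longrightarrow> W \<bullet> v g \<le> 0" by blast
  define M where "M = W \<bullet> expvec P / m"
  have le: "W \<bullet> expvec b \<le> M" if "b \<in> G" for b
    using W(2)[OF that] m by (simp add: M_def v_def inner_diff_right field_simps)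
  moreover have "W \<bullet> expvec b = M" if b: "b \<in> ?B" for b
  proof -
    have "(\<Sum>b\<in>?B. M - W \<bullet> expvec b) = real m * M - W \<bullet> expvec P"
      by (simp add: sum_subtractf m_def P_def expvec_sum inner_sum_right)
    also have "\<dots> = 0" using m by (simp add: M_def)
    finally have "\<forall>b\<in>?B. M - W \<bullet> expvec b = 0"
      using finB le BG by (subst (asm) sum_nonneg_eq_0_iff) auto
    then show ?thesis using b by auto
  qed
  ultimately show ?thesis using W(1) by blast
qed

lemma krull_dim_le:
  assumes fin: "finite G" and d: "0 \<le> d + 1"
    and face: "\<And>(W :: (real, 'n) vec) M. \<forall>l. W $ l < 0 \<Longrightarrow> \<forall>u\<in>newton G. W \<bullet> u \<le> M \<Longrightarrow>
      aff_dim (newton G \<inter> {u. W \<bullet> u = M}) \<le> d"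
  shows "krull_dim (fiber_ring A) \<le> ereal (real_of_int (d + 1))"
  unfolding krull_dim_fiber_ring
proof (rule Sup_least, safe)
  fix n :: nat and Q assume Q: "\<forall>i\<le>n. fprime (Q i)" "\<forall>i<n. Q i \<subset> Q (Suc i)"
  let ?B = "live (Q 0)"
  have n: "n \<le> dim (lift ` (\<lambda>b. (b, 1)) ` ?B)"
    using chain_length_le[OF fin, of n Q] Q by blast
  have "int n \<le> d + 1"
  proof (cases "?B = {}")
    \<comment> \<open>Without live generators the dimension is 0, hence
      \<open>n = 0\<close>.\<close>
    case True
    then show ?thesis using n d by simp
  next
    case False
    then obtain W :: "(real, 'n) vec" and M where W: "\<forall>l. W $ l < 0" "\<forall>b\<in>G. W \<bullet> expvec b \<le> M" "\<forall>b\<in>?B. W \<bullet> expvec b = M"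
      using live_on_face[OF fin _ False] Q by blast
    have "expvec ` ?B \<subseteq> newton G \<inter> {u. W \<bullet> u = M}"
      using W(3) by (auto simp: newton_def live_def intro: hull_inc)
    then have "aff_dim (expvec ` ?B) \<le> d"
      using order.trans[OF aff_dim_subset face[OF W(1)]] newton_le_iff[of G W M] W(2) by blast
    then show ?thesis using n aff_dim_lift[OF False] by linarith
  qed
  then show "ereal (real n) \<le> ereal (real_of_int (d + 1))" by simp
qed

end

subsection \<open>Faces in terms of hyperplanes and halfspaces\<close>

lemma independent_familyI:
  fixes v :: "'i \<Rightarrow> 'a::euclidean_space"
  assumes fin: "finite I" and ind: "\<And>c i. (\<Sum>i\<in>I. c i *\<^sub>R v i) = 0 \<Longrightarrow> i \<in> I \<Longrightarrow> c i = 0"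
  shows "inj_on v I" "independent (v ` I)"
proof -
  show inj: "inj_on v I"
  proof (rule inj_onI, rule ccontr)
    fix i j assume ij: "i \<in> I" "j \<in> I" "v i = v j" "i \<noteq> j"
    have "(\<Sum>l\<in>I. ((if l = i then 1 else 0) - (if l = j then 1 else 0)) *\<^sub>R v l) = v i - v j"
      using fin ij(1,2)
      by (simp add: scaleR_diff_left sum_subtractf if_distrib[of "\<lambda>r. r *\<^sub>R _"] cong: if_cong)
    then show False using ind[of "\<lambda>l. (if l = i then 1 else 0) - (if l = j then 1 else 0)" i] ij by auto
  qed
  show "independent (v ` I)"
    unfolding independent_explicit
  proof (intro conjI allI impI ballI)
    fix c u assume "(\<Sum>u\<in>v ` I. c u *\<^sub>R u) = 0" "u \<in> v ` I"
    then show "c u = 0" using ind[of "\<lambda>i. c (v i)"] by (auto simp: sum.reindex[OF inj] o_def)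
  qed (use fin in simp)
qed

lemma independent_family_sum_zero:
  fixes w :: "nat \<Rightarrow> 'a::euclidean_space"
  assumes "inj_on w {..<s}" "independent (w ` {..<s})" "(\<Sum>i<s. a i *\<^sub>R w i) = 0" "i < s"
  shows "a i = 0"
proof -
  let ?g = "\<lambda>x. a (the_inv_into {..<s} w x)"
  have "(\<Sum>x\<in>w ` {..<s}. ?g x *\<^sub>R x) = (\<Sum>i<s. a i *\<^sub>R w i)"
    by (subst sum.reindex[OF assms(1)]) (auto intro!: sum.cong simp: the_inv_into_f_f[OF assms(1)])
  then have sum0: "(\<Sum>x\<in>w ` {..<s}. ?g x *\<^sub>R x) = 0" using assms(3) by simp
  have "\<forall>c. (\<Sum>x\<in>w ` {..<s}. c x *\<^sub>R x) = 0 \<longrightarrow> (\<forall>x\<in>w ` {..<s}. c x = 0)"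
    using assms(2) unfolding independent_explicit by blast
  from mp[OF spec[OF this, of ?g] sum0] have "?g (w i) = 0" using assms(4) by blast
  then show ?thesis using the_inv_into_f_f[OF assms(1)] assms(4) by simp
qed

text \<open>Values on independent vectors can be prescribed, so the hyperplanes have a common point;
  their intersection is a translate of the orthogonal complement of the span.\<close>

lemma independent_hyperplanes_Inter:
  fixes w :: "nat \<Rightarrow> 'a::euclidean_space"
  assumes "inj_on w {..<s}" "independent (w ` {..<s})"
  shows "aff_dim (\<Inter>i<s. {u. w i \<bullet> u = b i}) = int DIM('a) - int s"
proof -
  let ?H = "\<Inter>i<s. {u. w i \<bullet> u = b i}"
  obtain g :: "'a \<Rightarrow> real" where g: "linear g" "\<forall>x\<in>w ` {..<s}. g x = b (the_inv_into {..<s} w x)"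
    using linear_independent_extend[OF assms(2), of "\<lambda>x. b (the_inv_into {..<s} w x)"] by blast
  \<comment> \<open>The vector that represents the functional \<open>g\<close> by inner
    products.\<close>
  define u0 where "u0 = adjoint g 1"
  have u0: "w i \<bullet> u0 = b i" if "i < s" for i
    using adjoint_works[OF g(1), of "w i" 1] g(2) that the_inv_into_f_f[OF assms(1), of i] by (simp add: u0_def)
  let ?V = "{y \<in> UNIV. \<forall>x\<in>span (w ` {..<s}). orthogonal x y}"
  have V: "v \<in> ?V \<longleftrightarrow> (\<forall>i<s. w i \<bullet> v = 0)" for v
  proof
    assume "\<forall>i<s. w i \<bullet> v = 0"
    then have "span (w ` {..<s}) \<subseteq> {x. orthogonal x v}"
      by (intro span_minimal) (auto simp: orthogonal_def subspace_def inner_add_left)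
    then show "v \<in> ?V" by auto
  next
    assume v: "v \<in> ?V"
    show "\<forall>i<s. w i \<bullet> v = 0"
    proof (intro allI impI)
      fix i assume "i < s"
      then have "w i \<in> span (w ` {..<s})" by (intro span_base) auto
      then show "w i \<bullet> v = 0" using v by (auto simp: orthogonal_def)
    qed
  qed
  have "?H = (+) u0 ` ?V"
  proof (intro equalityI subsetI)
    fix u assume "u \<in> ?H"
    then have "u - u0 \<in> ?V" unfolding V by (auto simp: u0 inner_diff_right)
    then show "u \<in> (+) u0 ` ?V" by (rule rev_image_eqI) simp
  next
    fix u assume "u \<in> (+) u0 ` ?V"
    then obtain v where "v \<in> ?V" "u = u0 + v" by blast
    then show "u \<in> ?H" unfolding V by (auto simp: u0 inner_add_right)
  qed
  then have "aff_dim ?H = aff_dim ?V" by (simp only: aff_dim_translation_eq)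
  also have "\<dots> = int (dim ?V)"
    by (rule aff_dim_subspace) (auto simp: subspace_def orthogonal_def inner_add_right)
  also have "dim ?V + dim (span (w ` {..<s})) = DIM('a)"
    using dim_subspace_orthogonal_to_vectors[of "span (w ` {..<s})" UNIV] by simp
  then have "int (dim ?V) = int DIM('a) - int s"
    using assms by (simp add: dim_eq_card_independent card_image)
  finally show ?thesis .
qed

lemma cone_separation_functional:
  fixes v :: "'i \<Rightarrow> 'a::euclidean_space"
  assumes fin: "finite I" and notin: "x \<notin> convex_cone hull (v ` I)"
  shows "\<exists>a. a \<bullet> x > 0 \<and> (\<forall>g\<in>I. a \<bullet> v g \<le> 0)"
proof -
  have "closed (convex_cone hull (v ` I))" using fin by (intro closed_convex_cone_hull) auto
  then obtain a b where ab: "a \<bullet> x < b" "\<forall>y\<in>convex_cone hull (v ` I). b < a \<bullet> y"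
    using separating_hyperplane_closed_point[OF convex_convex_cone_hull _ notin] by blast
  have b: "b < 0" using ab(2) convex_cone_hull_contains_0 by force
  have "a \<bullet> v g \<ge> 0" if "g \<in> I" for g
  proof (rule ccontr)
    assume "\<not> a \<bullet> v g \<ge> 0"
    then have neg: "a \<bullet> v g < 0" by simp
    have "(b / (a \<bullet> v g)) *\<^sub>R v g \<in> convex_cone hull (v ` I)"
      using that b neg by (intro convex_cone_hull_mul hull_inc) (auto simp: divide_nonpos_neg)
    then have "b < a \<bullet> ((b / (a \<bullet> v g)) *\<^sub>R v g)" using ab(2) by blast
    then show False using neg by simp
  qed
  then show ?thesis using ab(1) b by (intro exI[of _ "- a"]) auto
qed

text \<open>Farkas: if \<open>W\<close> is not in the cone spanned by the \<open>w i\<close>, their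
  negatives and the \<open>h j\<close> tight at \<open>f\<close>, separation gives a direction in
  which \<open>f\<close> can be moved inside \<open>E\<close> while \<open>W\<close>
  increases.\<close>

lemma normal_cone_representation:
  fixes w h :: "nat \<Rightarrow> 'a::euclidean_space"
  assumes E: "E = (\<Inter>i<s. {u. w i \<bullet> u = b i}) \<inter> (\<Inter>j<t. {u. h j \<bullet> u \<le> c j})"
    and f: "f \<in> E" and max: "\<And>u. u \<in> E \<Longrightarrow> W \<bullet> u \<le> W \<bullet> f"
  shows "\<exists>\<alpha> \<beta>. (\<forall>j. 0 \<le> \<beta> j) \<and> (\<forall>j<t. h j \<bullet> f \<noteq> c j \<longrightarrow> \<beta> j = 0) \<and>
     W = (\<Sum>i<s. \<alpha> i *\<^sub>R w i) + (\<Sum>j<t. \<beta> j *\<^sub>R h j)"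
proof -
  define J where "J = {j. j < t \<and> h j \<bullet> f = c j}"
  \<comment> \<open>Tags 0 and 1 stand for \<open>w i\<close> and its negative, so that
    \<open>w i\<close> gets a coefficient of either sign; tag 2 stands for the tight
    \<open>h j\<close>.\<close>
  define I where "I = {0::nat, 1} \<times> {..<s} \<union> {2} \<times> J"
  define v where "v p = (if fst p = 0 then w (snd p) else if fst p = 1 then - w (snd p) else h (snd p))" for p :: "nat \<times> nat"
  have finJ: "finite J" by (simp add: J_def)
  then have fin: "finite I" by (simp add: I_def)
  have "W \<in> convex_cone hull (v ` I)"
  proof (rule ccontr)
    assume "W \<notin> convex_cone hull (v ` I)"
    then obtain a where a: "a \<bullet> W > 0" "\<And>g. g \<in> I \<Longrightarrow> a \<bullet> v g \<le> 0"
      using cone_separation_functional[OF fin] by blast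
    have aw: "w i \<bullet> a = 0" if "i < s" for i
      using a(2)[of "(0, i)"] a(2)[of "(1, i)"] that by (simp add: I_def v_def inner_commute)
    have ah: "h j \<bullet> a \<le> 0" if "j \<in> J" for j
      using a(2)[of "(2, j)"] that by (simp add: I_def v_def inner_commute)
    \<comment> \<open>A step short enough for every slack halfspace; the 1 in the denominator avoids
      division by zero, the inserted 1 an empty minimum.\<close>
    define \<epsilon> where "\<epsilon> = Min (insert 1 ((\<lambda>j. (c j - h j \<bullet> f) / (\<bar>h j \<bullet> a\<bar> + 1)) ` ({..<t} - J)))"
    have hf: "h j \<bullet> f < c j" if "j < t" "j \<notin> J" for j
      using f that unfolding E by (force simp: J_def)
    have e0: "\<epsilon> > 0" unfolding \<epsilon>_def using hf by (subst Min_gr_iff) (auto intro!: divide_pos_pos)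
    have "f + \<epsilon> *\<^sub>R a \<in> E"
      unfolding E
    proof (intro IntI INT_I CollectI)
      fix i assume "i \<in> {..<s}"
      then show "w i \<bullet> (f + \<epsilon> *\<^sub>R a) = b i" using f aw[of i] by (auto simp: E inner_add_right)
    next
      fix j assume j: "j \<in> {..<t}"
      show "h j \<bullet> (f + \<epsilon> *\<^sub>R a) \<le> c j"
      proof (cases "j \<in> J")
        case True
        then show ?thesis using ah[OF True] e0 mult_nonneg_nonpos[of \<epsilon> "h j \<bullet> a"] by (simp add: inner_add_right J_def)
      next
        case False
        have "\<epsilon> \<le> (c j - h j \<bullet> f) / (\<bar>h j \<bullet> a\<bar> + 1)"
          unfolding \<epsilon>_def using j False by (intro Min_le) auto
        then have "\<epsilon> * (\<bar>h j \<bullet> a\<bar> + 1) \<le> c j - h j \<bullet> f" by (simp add: pos_le_divide_eq add_pos_nonneg)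
        moreover have "\<epsilon> * (h j \<bullet> a) \<le> \<epsilon> * (\<bar>h j \<bullet> a\<bar> + 1)" using e0 by (intro mult_left_mono) auto
        ultimately show ?thesis by (simp add: inner_add_right)
      qed
    qed
    then have "W \<bullet> (f + \<epsilon> *\<^sub>R a) \<le> W \<bullet> f" by (rule max)
    then show False using a(1) e0 by (simp add: inner_add_right inner_commute mult_le_0_iff)
  qed
  then obtain d where d: "\<And>p. 0 \<le> d p" "W = (\<Sum>p\<in>I. d p *\<^sub>R v p)"
    using convex_cone_hull_image_finite[OF fin] by blast
  have "W = (\<Sum>p\<in>{0} \<times> {..<s}. d p *\<^sub>R v p) + (\<Sum>p\<in>{1} \<times> {..<s}. d p *\<^sub>R v p) + (\<Sum>p\<in>{2} \<times> J. d p *\<^sub>R v p)"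
  proof -
    have "I = ({0} \<times> {..<s} \<union> {1} \<times> {..<s}) \<union> {2} \<times> J" by (auto simp: I_def)
    then show ?thesis unfolding d(2) using finJ by (simp add: sum.union_disjoint disjoint_iff)
  qed
  also have "\<dots> = (\<Sum>i<s. d (0, i) *\<^sub>R w i) + (\<Sum>i<s. d (1, i) *\<^sub>R (- w i)) + (\<Sum>j\<in>J. d (2, j) *\<^sub>R h j)"
  proof -
    have "(\<Sum>p\<in>{k} \<times> F. q p) = (\<Sum>i\<in>F. q (k, i))" for k :: nat and F :: "nat set" and q :: "_ \<Rightarrow> 'a"
      by (rule sum.reindex_bij_witness[of _ "\<lambda>i. (k, i)" snd]) auto
    then show ?thesis by (simp add: v_def del: singleton_iff)
  qed
  also have "(\<Sum>j\<in>J. d (2, j) *\<^sub>R h j) = (\<Sum>j<t. (if j \<in> J then d (2, j) else 0) *\<^sub>R h j)"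
    by (rule sum.mono_neutral_cong_left) (auto simp: J_def)
  finally have "W = (\<Sum>i<s. (d (0, i) - d (1, i)) *\<^sub>R w i) + (\<Sum>j<t. (if j \<in> J then d (2, j) else 0) *\<^sub>R h j)"
    by (simp add: scaleR_diff_left sum_subtractf sum_negf)
  then show ?thesis using d(1)
    by (intro exI[of _ "\<lambda>i. d (0, i) - d (1, i)"] exI[of _ "\<lambda>j. if j \<in> J then d (2, j) else 0"]) (auto simp: J_def)
qed

text \<open>Caratheodory's reduction: in a representation with the fewest nonzero \<open>\<beta> j\<close>, the
  \<open>h j\<close> involved are linearly independent modulo the span of the \<open>w i\<close>.\<close>

lemma minimal_representation_independent:
  fixes w h :: "nat \<Rightarrow> 'a::euclidean_space"
  assumes \<beta>: "\<And>j. 0 \<le> \<beta> j" and min: "\<And>\<alpha>' \<beta>'. (\<And>j. 0 \<le> \<beta>' j) \<Longrightarrow>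
      (\<And>j. j < t \<Longrightarrow> \<beta> j = 0 \<Longrightarrow> \<beta>' j = 0) \<Longrightarrow>
      (\<Sum>i<s. \<alpha>' i *\<^sub>R w i) + (\<Sum>j<t. \<beta>' j *\<^sub>R h j) = (\<Sum>i<s. \<alpha> i *\<^sub>R w i) + (\<Sum>j<t. \<beta> j *\<^sub>R h j) \<Longrightarrow>
      card {j. j < t \<and> \<beta> j \<noteq> 0} \<le> card {j. j < t \<and> \<beta>' j \<noteq> 0}"
    and zero: "(\<Sum>i<s. a i *\<^sub>R w i) + (\<Sum>j\<in>{j. j < t \<and> \<beta> j \<noteq> 0}. g j *\<^sub>R h j) = 0"
    and j: "j < t" "\<beta> j \<noteq> 0"
  shows "g j = 0"
proof -
  let ?S = "{j. j < t \<and> \<beta> j \<noteq> 0}"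
  have pos: False if zero: "(\<Sum>i<s. a i *\<^sub>R w i) + (\<Sum>j\<in>?S. g j *\<^sub>R h j) = 0" and j: "j \<in> ?S" "g j > 0" for a g j
  proof -
    define R where "R = (\<lambda>j. \<beta> j / g j) ` {j \<in> ?S. g j > 0}"
    \<comment> \<open>The longest step along the relation that keeps all coefficients nonnegative;
      it annihilates the coefficient at \<open>j0\<close>.\<close>
    define \<tau> where "\<tau> = Min R"
    have R: "finite R" "R \<noteq> {}" using j by (auto simp: R_def)
    have "\<tau> \<in> R" unfolding \<tau>_def by (rule Min_in[OF R])
    then obtain j0 where j0: "j0 \<in> ?S" "g j0 > 0" "\<tau> = \<beta> j0 / g j0" by (auto simp: R_def)
    have t0: "\<tau> \<ge> 0" using j0 \<beta> by simp
    define \<beta>' where "\<beta>' j = (if j \<in> ?S then \<beta> j - \<tau> * g j else 0)" for j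
    have "0 \<le> \<beta>' j" for j
    proof (cases "j \<in> ?S \<and> g j > 0")
      case True
      then have "\<tau> \<le> \<beta> j / g j" unfolding \<tau>_def by (intro Min_le R) (auto simp: R_def)
      then show ?thesis using True by (simp add: \<beta>'_def pos_le_divide_eq)
    next
      case False
      then show ?thesis using \<beta>[of j] mult_nonneg_nonpos[OF t0, of "g j"] by (auto simp: \<beta>'_def not_less)
    qed
    moreover have "(\<Sum>i<s. (\<alpha> i - \<tau> * a i) *\<^sub>R w i) + (\<Sum>j<t. \<beta>' j *\<^sub>R h j)
        = (\<Sum>i<s. \<alpha> i *\<^sub>R w i) + (\<Sum>j<t. \<beta> j *\<^sub>R h j)"
    proof -
      have "(\<Sum>j<t. \<beta>' j *\<^sub>R h j) = (\<Sum>j\<in>?S. (\<beta> j - \<tau> * g j) *\<^sub>R h j)"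
        by (rule sum.mono_neutral_cong_right) (auto simp: \<beta>'_def)
      moreover have "(\<Sum>j<t. \<beta> j *\<^sub>R h j) = (\<Sum>j\<in>?S. \<beta> j *\<^sub>R h j)"
        by (rule sum.mono_neutral_cong_right) auto
      ultimately have "(\<Sum>i<s. (\<alpha> i - \<tau> * a i) *\<^sub>R w i) + (\<Sum>j<t. \<beta>' j *\<^sub>R h j)
        = (\<Sum>i<s. \<alpha> i *\<^sub>R w i) + (\<Sum>j<t. \<beta> j *\<^sub>R h j)
          - \<tau> *\<^sub>R ((\<Sum>i<s. a i *\<^sub>R w i) + (\<Sum>j\<in>?S. g j *\<^sub>R h j))"
        by (simp add: scaleR_diff_left sum_subtractf scaleR_add_right scaleR_sum_right algebra_simps)
      then show ?thesis using zero by simp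
    qed
    ultimately have "card ?S \<le> card {j. j < t \<and> \<beta>' j \<noteq> 0}"
      by (intro min) (auto simp: \<beta>'_def)
    moreover have "\<beta>' j0 = 0" using j0 by (simp add: \<beta>'_def)
    then have "{j. j < t \<and> \<beta>' j \<noteq> 0} \<subseteq> ?S - {j0}"
      by (auto simp: \<beta>'_def split: if_splits)
    then have "{j. j < t \<and> \<beta>' j \<noteq> 0} \<subset> ?S" using j0(1) by blast
    then have "card {j. j < t \<and> \<beta>' j \<noteq> 0} < card ?S" by (intro psubset_card_mono) auto
    ultimately show False by simp
  qed
  have zero': "(\<Sum>i<s. (- a i) *\<^sub>R w i) + (\<Sum>j\<in>?S. (- g j) *\<^sub>R h j) = 0"
  proof -
    have "(\<Sum>i<s. (- a i) *\<^sub>R w i) + (\<Sum>j\<in>?S. (- g j) *\<^sub>R h j) = - ((\<Sum>i<s. a i *\<^sub>R w i) + (\<Sum>j\<in>?S. g j *\<^sub>R h j))"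
      by (simp add: sum_negf)
    then show ?thesis unfolding zero by simp
  qed
  show ?thesis
    using pos[OF zero, of j] pos[OF zero', of j] j by (cases "g j" "0::real" rule: linorder_cases) auto
qed


text \<open>For \<open>f\<close> in the relative interior of the exposed face, a halfspace tight at
  \<open>f\<close> is tight on the whole face. In a representation of \<open>W\<close> with the
  fewest such \<open>h j\<close>, these and the \<open>w i\<close> are linearly independent and
  constant on the face, so each takes one from the bound on its dimension.\<close>

lemma normal_representation_card:
  fixes w h :: "nat \<Rightarrow> 'a::euclidean_space"
  assumes w: "inj_on w {..<s}" "independent (w ` {..<s})"
    and E: "E = (\<Inter>i<s. {u. w i \<bullet> u = b i}) \<inter> (\<Inter>j<t. {u. h j \<bullet> u \<le> c j})"
    and max: "\<And>u. u \<in> E \<Longrightarrow> W \<bullet> u \<le> M" and ne: "E \<inter> {u. W \<bullet> u = M} \<noteq> {}"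
  shows "\<exists>\<alpha> \<beta>. (\<forall>j. 0 \<le> \<beta> j) \<and> W = (\<Sum>i<s. \<alpha> i *\<^sub>R w i) + (\<Sum>j<t. \<beta> j *\<^sub>R h j) \<and>
     int (s + card {j. j < t \<and> \<beta> j \<noteq> 0}) + aff_dim (E \<inter> {u. W \<bullet> u = M}) \<le> int DIM('a)"
proof -
  let ?F = "E \<inter> {u. W \<bullet> u = M}"
  have "convex E"
    unfolding E by (intro convex_Int convex_INT) (auto intro: convex_hyperplane convex_halfspace_le)
  then have convF: "convex ?F" by (intro convex_Int convex_hyperplane)
  obtain f where f: "f \<in> rel_interior ?F" using rel_interior_eq_empty[OF convF] ne by blast
  have fF: "f \<in> ?F" using f rel_interior_subset by blast
  have tight: "h j \<bullet> u = c j" if u: "u \<in> ?F" and j: "j < t" "h j \<bullet> f = c j" for u j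
  proof -
    \<comment> \<open>The segment from \<open>u\<close> to \<open>f\<close> can be prolonged beyond
      \<open>f\<close> inside the face; slack at \<open>u\<close> would violate the halfspace
      there.\<close>
    obtain e where e: "e > 1" "(1 - e) *\<^sub>R u + e *\<^sub>R f \<in> ?F"
      using f u convex_rel_interior_iff[OF convF ne, of f] by blast
    then have "h j \<bullet> ((1 - e) *\<^sub>R u + e *\<^sub>R f) \<le> c j" using j by (auto simp: E)
    then have "(1 - e) * (h j \<bullet> u) + e * c j \<le> c j" using j by (simp add: inner_add_right)
    then have "(e - 1) * c j \<le> (e - 1) * (h j \<bullet> u)" by (simp add: algebra_simps)
    then have "c j \<le> h j \<bullet> u" using e(1) by simp
    moreover have "h j \<bullet> u \<le> c j" using u j by (auto simp: E)
    ultimately show ?thesis by simp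
  qed
  \<comment> \<open>Vanishing off the halfspaces tight at \<open>f\<close> is built into the
    property, so that a representation with the fewest terms still has it.\<close>
  define rep where "rep p \<longleftrightarrow> (\<forall>j. 0 \<le> snd p j) \<and> (\<forall>j<t. h j \<bullet> f \<noteq> c j \<longrightarrow> snd p j = 0) \<and>
     W = (\<Sum>i<s. fst p i *\<^sub>R w i) + (\<Sum>j<t. snd p j *\<^sub>R h j)" for p :: "(nat \<Rightarrow> real) \<times> (nat \<Rightarrow> real)"
  have fE: "f \<in> E" and Wf: "\<And>u. u \<in> E \<Longrightarrow> W \<bullet> u \<le> W \<bullet> f" using fF max by auto
  from normal_cone_representation[OF E fE Wf] obtain \<alpha>0 \<beta>0 where "(\<forall>j. 0 \<le> \<beta>0 j) \<and>
      (\<forall>j<t. h j \<bullet> f \<noteq> c j \<longrightarrow> \<beta>0 j = 0) \<and> W = (\<Sum>i<s. \<alpha>0 i *\<^sub>R w i) + (\<Sum>j<t. \<beta>0 j *\<^sub>R h j)"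
    by blast
  then have "rep (\<alpha>0, \<beta>0)" unfolding rep_def fst_conv snd_conv .
  then have "\<exists>p. rep p" ..
  then obtain p where p: "rep p" and pmin: "\<And>q. rep q \<Longrightarrow> card {j. j < t \<and> snd p j \<noteq> 0} \<le> card {j. j < t \<and> snd q j \<noteq> 0}"
    using ex_has_least_nat[of rep _ "\<lambda>q. card {j. j < t \<and> snd q j \<noteq> 0}"] by blast
  define \<alpha> where "\<alpha> = fst p"
  define \<beta> where "\<beta> = snd p"
  have W: "W = (\<Sum>i<s. \<alpha> i *\<^sub>R w i) + (\<Sum>j<t. \<beta> j *\<^sub>R h j)" and \<beta>: "\<And>j. 0 \<le> \<beta> j"
    and \<beta>0: "\<And>j. j < t \<Longrightarrow> h j \<bullet> f \<noteq> c j \<Longrightarrow> \<beta> j = 0"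
    using p by (auto simp: rep_def \<alpha>_def \<beta>_def)
  let ?S = "{j. j < t \<and> \<beta> j \<noteq> 0}"
  have g0: "g j = 0" if "(\<Sum>i<s. a i *\<^sub>R w i) + (\<Sum>j\<in>?S. g j *\<^sub>R h j) = 0" "j \<in> ?S" for a g j
  proof (rule minimal_representation_independent[where \<beta> = \<beta> and t = t and s = s and w = w and h = h and \<alpha> = \<alpha> and a = a and g = g and j = j])
    fix \<alpha>' \<beta>' :: "nat \<Rightarrow> real"
    assume "\<And>j. 0 \<le> \<beta>' j" "\<And>j. j < t \<Longrightarrow> \<beta> j = 0 \<Longrightarrow> \<beta>' j = 0"
      "(\<Sum>i<s. \<alpha>' i *\<^sub>R w i) + (\<Sum>j<t. \<beta>' j *\<^sub>R h j) = (\<Sum>i<s. \<alpha> i *\<^sub>R w i) + (\<Sum>j<t. \<beta> j *\<^sub>R h j)"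
    then have "rep (\<alpha>', \<beta>')" using \<beta>0 W by (simp add: rep_def)
    from pmin[OF this] show "card ?S \<le> card {j. j < t \<and> \<beta>' j \<noteq> 0}" by (simp add: \<beta>_def)
  qed (use \<beta> that in auto)
  define I where "I = {0::nat} \<times> {..<s} \<union> {1} \<times> ?S"
  define v where "v p = (if fst p = 0 then w (snd p) else h (snd p))" for p :: "nat \<times> nat"
  have fin: "finite I" by (simp add: I_def)
  have ind: "d i = 0" if s0: "(\<Sum>i\<in>I. d i *\<^sub>R v i) = 0" and i: "i \<in> I" for d i
  proof -
    have sing: "(\<Sum>p\<in>{k} \<times> F. q p) = (\<Sum>i\<in>F. q (k, i))" for k :: nat and F :: "nat set" and q :: "_ \<Rightarrow> 'a"
      by (rule sum.reindex_bij_witness[of _ "\<lambda>i. (k, i)" snd]) auto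
    have "(\<Sum>i\<in>I. d i *\<^sub>R v i) = (\<Sum>p\<in>{0} \<times> {..<s}. d p *\<^sub>R v p) + (\<Sum>p\<in>{1} \<times> ?S. d p *\<^sub>R v p)"
      unfolding I_def by (rule sum.union_disjoint) auto
    also have "\<dots> = (\<Sum>i<s. d (0, i) *\<^sub>R w i) + (\<Sum>j\<in>?S. d (1, j) *\<^sub>R h j)"
      unfolding sing by (simp add: v_def)
    finally have *: "(\<Sum>i<s. d (0, i) *\<^sub>R w i) + (\<Sum>j\<in>?S. d (1, j) *\<^sub>R h j) = 0" using s0 by simp
    have d1: "d (1, j) = 0" if "j \<in> ?S" for j by (rule g0[OF * that])
    then have "(\<Sum>j\<in>?S. d (1, j) *\<^sub>R h j) = 0" by (intro sum.neutral) auto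
    then have "d (0, i) = 0" if "i < s" for i
      using * that independent_family_sum_zero[OF w, of "\<lambda>i. d (0, i)" i] by simp
    then show ?thesis using d1 i by (auto simp: I_def)
  qed
  have vI: "inj_on v I" "independent (v ` I)" using independent_familyI[OF fin, of v] ind by blast+
  have "card I = s + card ?S"
    unfolding I_def by (subst card_Un_disjoint) (auto simp: card_cartesian_product)
  then have "dim (span (v ` I)) = s + card ?S"
    using vI by (simp add: dim_eq_card_independent card_image)
  moreover have "dim {y \<in> UNIV. \<forall>x\<in>span (v ` I). orthogonal x y} + dim (span (v ` I)) = DIM('a)"
    using dim_subspace_orthogonal_to_vectors[of "span (v ` I)" UNIV] by simp
  moreover have "dim ((\<lambda>u. u - f) ` ?F) \<le> dim {y \<in> UNIV. \<forall>x\<in>span (v ` I). orthogonal x y}"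
  proof (rule dim_subset, safe)
    fix u x assume u: "u \<in> E" "M = W \<bullet> u" and x: "x \<in> span (v ` I)"
    have "v q \<bullet> (u - f) = 0" if "q \<in> I" for q
    proof (cases "fst q = 0")
      case True
      then have "snd q < s" "v q = w (snd q)" using that by (auto simp: I_def v_def)
      then show ?thesis using u(1) fF by (auto simp: E inner_diff_right)
    next
      case False
      then have q: "snd q < t" "\<beta> (snd q) \<noteq> 0" "v q = h (snd q)" using that by (auto simp: I_def v_def)
      then have "h (snd q) \<bullet> f = c (snd q)" using \<beta>0 by blast
      then show ?thesis using tight[of u "snd q"] q u by (simp add: inner_diff_right)
    qed
    then have "span (v ` I) \<subseteq> {x. orthogonal x (u - f)}"
      by (intro span_minimal) (auto simp: orthogonal_def subspace_def inner_add_left)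
    then show "orthogonal x (u - f)" using x by auto
  qed simp
  moreover have "aff_dim ?F = int (dim ((\<lambda>u. u - f) ` ?F))"
    by (rule aff_dim_eq_dim_subtract) (use fF hull_inc in metis)
  ultimately have "int (s + card ?S) + aff_dim ?F \<le> int DIM('a)" by linarith
  then show ?thesis using W \<beta> by blast
qed

text \<open>Starting from a generator \<open>v\<close> of least degree, tilting the degree functional towards
  a coordinate in which \<open>v\<close> is not minimal makes a second generator minimal as well.\<close>

lemma antichain_edge:
  fixes G :: "('n::finite \<Rightarrow>\<^sub>0 nat) set"
  assumes fin: "finite G" and anti: "\<And>a b. a \<in> G \<Longrightarrow> b \<in> G \<Longrightarrow> dv a b \<Longrightarrow> a = b"
    and two: "a0 \<in> G" "b0 \<in> G" "a0 \<noteq> b0"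
  shows "\<exists>(W :: real ^ 'n) M. (\<forall>l. W $ l < 0) \<and> (\<forall>u\<in>newton G. W \<bullet> u \<le> M) \<and>
     aff_dim (newton G \<inter> {u. W \<bullet> u = M}) \<ge> 1"
proof -
  define f where "f b = (\<Sum>l\<in>UNIV. real (lookup b l))" for b :: "'n \<Rightarrow>\<^sub>0 nat"
  have "\<exists>v\<in>G. \<forall>b\<in>G. f v \<le> f b"
    using ex_is_arg_min_if_finite[OF fin, of f] two(1) by (auto simp: is_arg_min_linorder)
  then obtain v where v: "v \<in> G" "\<And>b. b \<in> G \<Longrightarrow> f v \<le> f b" by blast
  obtain b where b: "b \<in> G" "b \<noteq> v" using two by metis
  then have "\<not> dv v b" using anti v by blast
  then obtain l where l: "lookup b l < lookup v l" by (auto simp: dv_iff not_le)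
  \<comment> \<open>Tilting in coordinate \<open>l\<close> favours exactly the generators in
    \<open>S\<close> over \<open>v\<close>, and \<open>b\<close> is one of them. The value \<tau> is
    the first at which one of them ties with \<open>v\<close>.\<close>
  define S where "S = {g \<in> G. lookup g l < lookup v l}"
  define \<tau> where "\<tau> = Min ((\<lambda>g. (f g - f v) / (real (lookup v l) - real (lookup g l))) ` S)"
  have S: "finite S" "b \<in> S" using fin b l by (auto simp: S_def)
  have "\<tau> \<in> (\<lambda>g. (f g - f v) / (real (lookup v l) - real (lookup g l))) ` S"
    unfolding \<tau>_def by (rule Min_in) (use S in auto)
  then obtain g0 where g0: "g0 \<in> S" "\<tau> = (f g0 - f v) / (real (lookup v l) - real (lookup g0 l))" by blast
  have \<tau>0: "\<tau> \<ge> 0" unfolding g0(2) using g0(1) v(2)[of g0] by (auto simp: S_def)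
  define W :: "real ^ 'n" where "W = (\<chi> i. - (1 + (if i = l then \<tau> else 0)))"
  define M where "M = - (f v + \<tau> * real (lookup v l))"
  have W: "W \<bullet> expvec g = - (f g + \<tau> * real (lookup g l))" for g
  proof -
    have "W \<bullet> expvec g = (\<Sum>i\<in>UNIV. - (real (lookup g i) + (if i = l then \<tau> * real (lookup g l) else 0)))"
      unfolding inner_vec_def by (rule sum.cong) (auto simp: W_def expvec_def algebra_simps)
    then show ?thesis by (simp add: sum_negf sum.distrib sum_subtractf f_def)
  qed
  have le: "W \<bullet> expvec g \<le> M" if g: "g \<in> G" for g
  proof (cases "g \<in> S")
    case True
    then have pos: "0 < real (lookup v l) - real (lookup g l)" by (simp add: S_def)
    have "\<tau> \<le> (f g - f v) / (real (lookup v l) - real (lookup g l))"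
      unfolding \<tau>_def using S True by (intro Min_le) auto
    then have "\<tau> * (real (lookup v l) - real (lookup g l)) \<le> f g - f v"
      using pos by (simp add: pos_le_divide_eq)
    then show ?thesis by (simp add: W M_def algebra_simps)
  next
    case False
    then have "\<tau> * real (lookup v l) \<le> \<tau> * real (lookup g l)" using g \<tau>0 by (intro mult_left_mono) (auto simp: S_def)
    then show ?thesis using v(2)[OF g] by (simp add: W M_def)
  qed
  have "W \<bullet> expvec g0 = M"
  proof -
    have "real (lookup v l) - real (lookup g0 l) \<noteq> 0" using g0(1) by (simp add: S_def)
    then have "\<tau> * (real (lookup v l) - real (lookup g0 l)) = f g0 - f v" by (simp add: g0(2))
    then show ?thesis by (simp add: W M_def algebra_simps)
  qed
  moreover have "W \<bullet> expvec v = M" by (simp add: W M_def)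
  moreover have "expvec v \<in> newton G" "expvec g0 \<in> newton G"
    using v(1) g0(1) by (auto simp: newton_def S_def intro: hull_inc)
  ultimately have "{expvec v, expvec g0} \<subseteq> newton G \<inter> {u. W \<bullet> u = M}" by auto
  then have "aff_dim {expvec v, expvec g0} \<le> aff_dim (newton G \<inter> {u. W \<bullet> u = M})" by (rule aff_dim_subset)
  moreover have "v \<noteq> g0" using g0(1) by (auto simp: S_def)
  then have "aff_dim {expvec v, expvec g0} = 1" by (simp add: aff_dim_2)
  moreover have "W $ i < 0" for i using \<tau>0 by (simp add: W_def)
  ultimately show ?thesis using le newton_le_iff[of G W M] by (intro exI[of _ W] exI[of _ M]) auto
qed


section \<open>The largest compact face in terms of s and k\<close>

lemma polytope_descriptionD:
  assumes "polytope_description E s w b t h c"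
  shows "inj_on w {..<s}" "independent (w ` {..<s})"
    and "(\<Inter>i<s. {u. w i \<bullet> u = b i}) = affine hull E"
    and "E = (\<Inter>i<s. {u. w i \<bullet> u = b i}) \<inter> (\<Inter>j<t. {u. h j \<bullet> u \<le> c j})"
    and "j < t \<Longrightarrow> (E \<inter> {u. h j \<bullet> u = c j}) facet_of E"
  using assms unfolding polytope_description_def minimal_hyperplanes_def facet_defining_halfspaces_def
  by blast+

text \<open>The representation of \<open>W\<close> by normals is itself a negative combination, so
  it uses at least \<open>k\<close> facet normals.\<close>

lemma aff_dim_face_le:
  fixes E :: "(real ^ 'n::finite) set" and W :: "real ^ 'n"
  assumes desc: "polytope_description E s w b t h c" and neg: "\<forall>l. W $ l < 0"
    and le: "\<forall>u\<in>E. W \<bullet> u \<le> M" and ne: "E \<inter> {u. W \<bullet> u = M} \<noteq> {}"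
    and k: "k = (LEAST m. \<exists>\<alpha> \<beta>. negative_combination s w t h \<alpha> \<beta> \<and> card {j. j < t \<and> \<beta> j \<noteq> 0} = m)"
  shows "int (s + k) + aff_dim (E \<inter> {u. W \<bullet> u = M}) \<le> int CARD('n)"
proof -
  have w: "inj_on w {..<s}" "independent (w ` {..<s})"
    and E: "E = (\<Inter>i<s. {u. w i \<bullet> u = b i}) \<inter> (\<Inter>j<t. {u. h j \<bullet> u \<le> c j})"
    by (rule polytope_descriptionD[OF desc])+
  have le': "\<And>u. u \<in> E \<Longrightarrow> W \<bullet> u \<le> M" using le by blast
  obtain \<alpha> \<beta> where ab: "\<forall>j. 0 \<le> \<beta> j" "W = (\<Sum>i<s. \<alpha> i *\<^sub>R w i) + (\<Sum>j<t. \<beta> j *\<^sub>R h j)"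
     "int (s + card {j. j < t \<and> \<beta> j \<noteq> 0}) + aff_dim (E \<inter> {u. W \<bullet> u = M}) \<le> int DIM(real ^ 'n)"
    using normal_representation_card[OF w E le' ne] by blast
  have "negative_combination s w t h \<alpha> \<beta>"
    using ab(1) neg unfolding negative_combination_def ab(2)[symmetric] by blast
  then have "k \<le> card {j. j < t \<and> \<beta> j \<noteq> 0}" unfolding k by (intro Least_le) blast
  then show ?thesis using ab(3) by simp
qed

lemma ex_face_ge:
  fixes G :: "(3 \<Rightarrow>\<^sub>0 nat) set" and w h :: "nat \<Rightarrow> real ^ 3"
  assumes fin: "finite G" and anti: "\<And>a b. a \<in> G \<Longrightarrow> b \<in> G \<Longrightarrow> dv a b \<Longrightarrow> a = b"
    and desc: "polytope_description (newton G) s w b t h c" and ex: "\<exists>\<alpha> \<beta>. negative_combination s w t h \<alpha> \<beta>"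
    and k: "k = (LEAST m. \<exists>\<alpha> \<beta>. negative_combination s w t h \<alpha> \<beta> \<and> card {j. j < t \<and> \<beta> j \<noteq> 0} = m)"
  shows "\<exists>(W :: real ^ 3) M. (\<forall>l. W $ l < 0) \<and> (\<forall>u\<in>newton G. W \<bullet> u \<le> M) \<and>
     newton G \<inter> {u. W \<bullet> u = M} \<noteq> {} \<and> 3 - int s - int k \<le> aff_dim (newton G \<inter> {u. W \<bullet> u = M})"
proof -
  let ?E = "newton G"
  have w: "inj_on w {..<s}" "independent (w ` {..<s})"
    and hyp: "(\<Inter>i<s. {u. w i \<bullet> u = b i}) = affine hull ?E"
    and E: "?E = (\<Inter>i<s. {u. w i \<bullet> u = b i}) \<inter> (\<Inter>j<t. {u. h j \<bullet> u \<le> c j})"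
    by (rule polytope_descriptionD[OF desc])+
  note facet = polytope_descriptionD(5)[OF desc]
  \<comment> \<open>The hyperplanes are independent and meet in the affine hull, so \<open>s\<close>
    is the codimension of the polytope.\<close>
  have dimE: "aff_dim ?E = 3 - int s"
    using independent_hyperplanes_Inter[OF w, of b] unfolding hyp by simp
  have "s \<le> 3" using independent_bound[of "w ` {..<s}"] w by (simp add: card_image)
  then have neE: "?E \<noteq> {}" using dimE by auto
  have compE: "compact ?E" unfolding newton_def using fin by (simp add: compact_convex_hull finite_imp_compact)
  have support: "\<exists>M. (\<forall>u\<in>?E. W \<bullet> u \<le> M) \<and> ?E \<inter> {u. W \<bullet> u = M} \<noteq> {}" for W :: "real ^ 3"
  proof -
    have "continuous_on ?E (\<lambda>u. W \<bullet> u)" by (intro continuous_intros)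
    then obtain x where "x \<in> ?E" "\<forall>y\<in>?E. W \<bullet> y \<le> W \<bullet> x"
      using continuous_attains_sup[OF compE neE] by blast
    then show ?thesis by (intro exI[of _ "W \<bullet> x"]) auto
  qed
  obtain \<alpha> \<beta> where ab: "negative_combination s w t h \<alpha> \<beta>" "card {j. j < t \<and> \<beta> j \<noteq> 0} = k"
  proof -
    have "\<exists>m \<alpha> \<beta>. negative_combination s w t h \<alpha> \<beta> \<and> card {j. j < t \<and> \<beta> j \<noteq> 0} = m" using ex by blast
    from LeastI_ex[OF this] show ?thesis using that unfolding k by blast
  qed
  define W where "W = (\<Sum>i<s. \<alpha> i *\<^sub>R w i) + (\<Sum>j<t. \<beta> j *\<^sub>R h j)"
  have neg: "\<forall>l. W $ l < 0" and \<beta>: "\<And>j. j < t \<Longrightarrow> 0 \<le> \<beta> j"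
    using ab(1) unfolding negative_combination_def W_def by auto
  let ?S = "{j. j < t \<and> \<beta> j \<noteq> 0}"
  consider (zero) "k = 0" | (one) "k = 1" | (edge) "s = 0" "k = 2" | (small) "3 \<le> s + k" "k \<noteq> 0" "k \<noteq> 1" by linarith
  then show ?thesis
  proof cases
    case zero
    then have S: "?S = {}" using ab(2) by simp
    obtain M where M: "\<forall>u\<in>?E. W \<bullet> u \<le> M" "?E \<inter> {u. W \<bullet> u = M} \<noteq> {}" using support[of W] by blast
    have "(\<Sum>j<t. \<beta> j *\<^sub>R h j) = 0" by (rule sum.neutral) (use S in auto)
    \<comment> \<open>Without facet normals \<open>W\<close> is constant on the polytope, which is
      then the exposed face.\<close>
    then have "W \<bullet> u = (\<Sum>i<s. \<alpha> i * b i)" if "u \<in> ?E" for u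
      using that unfolding W_def E by (simp add: inner_sum_left)
    then have "?E \<inter> {u. W \<bullet> u = M} = ?E" using M(2) by auto
    then show ?thesis using M neg dimE zero by (intro exI[of _ W] exI[of _ M]) simp
  next
    case one
    then obtain j where S: "?S = {j}" using ab(2) by (auto simp: card_1_singleton_iff)
    then have j: "j < t" "\<beta> j > 0" using \<beta>[of j] by (auto simp: less_le)
    have "(\<Sum>j<t. \<beta> j *\<^sub>R h j) = (\<Sum>j\<in>{j}. \<beta> j *\<^sub>R h j)"
      by (rule sum.mono_neutral_right) (use S in auto)
    then have Wu: "W \<bullet> u = (\<Sum>i<s. \<alpha> i * b i) + \<beta> j * (h j \<bullet> u)" if "u \<in> ?E" for u
      using that unfolding W_def E by (simp add: inner_sum_left inner_add_left)
    define M where "M = (\<Sum>i<s. \<alpha> i * b i) + \<beta> j * c j"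
    \<comment> \<open>On the polytope \<open>W\<close> is a positive multiple of \<open>h j\<close>
      up to a constant, so it exposes the facet of \<open>h j\<close>.\<close>
    have "?E \<inter> {u. W \<bullet> u = M} = ?E \<inter> {u. h j \<bullet> u = c j}"
      using j(2) by (auto simp: Wu M_def)
    moreover have "W \<bullet> u \<le> M" if "u \<in> ?E" for u
    proof -
      have "h j \<bullet> u \<le> c j" using that j(1) unfolding E by auto
      then show ?thesis using j(2) by (simp add: Wu[OF that] M_def)
    qed
    moreover have "aff_dim (?E \<inter> {u. h j \<bullet> u = c j}) = aff_dim ?E - 1" "?E \<inter> {u. h j \<bullet> u = c j} \<noteq> {}"
      using facet[OF j(1)] unfolding facet_of_def by auto
    ultimately show ?thesis using neg dimE one by (intro exI[of _ W] exI[of _ M]) simp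
  next
    case edge
    \<comment> \<open>As \<open>s = 0\<close>, the polytope has dimension 3, so one generator cannot
      be all.\<close>
    have "\<exists>a0 b0. a0 \<in> G \<and> b0 \<in> G \<and> a0 \<noteq> b0"
    proof (rule ccontr)
      assume "\<not> ?thesis"
      then obtain a where "G \<subseteq> {a}" by (metis insertCI subsetI)
      then have "expvec ` G \<subseteq> {expvec a}" by auto
      then have "?E \<subseteq> {expvec a}" unfolding newton_def by (intro hull_minimal) auto
      then have "aff_dim ?E \<le> 0" using aff_dim_subset[of ?E "{expvec a}"] by simp
      then show False using dimE edge by simp
    qed
    then obtain a0 b0 where "a0 \<in> G" "b0 \<in> G" "a0 \<noteq> b0" by blast
    from antichain_edge[OF fin anti this] obtain W' :: "real ^ 3" and M where
      W': "\<forall>l. W' $ l < 0" "\<forall>u\<in>?E. W' \<bullet> u \<le> M" "1 \<le> aff_dim (?E \<inter> {u. W' \<bullet> u = M})" by blast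
    have "?E \<inter> {u. W' \<bullet> u = M} \<noteq> {}"
    proof
      assume "?E \<inter> {u. W' \<bullet> u = M} = {}"
      then show False using W'(3) by simp
    qed
    then show ?thesis using W' edge by (intro exI[of _ W'] exI[of _ M]) simp
  next
    case small
    obtain M where M: "\<forall>u\<in>?E. W \<bullet> u \<le> M" "?E \<inter> {u. W \<bullet> u = M} \<noteq> {}" using support[of W] by blast
    \<comment> \<open>Here \<open>3 - s - k\<close> is at most 0, so it is enough that the face is
      nonempty.\<close>
    have "aff_dim (?E \<inter> {u. W \<bullet> u = M}) \<noteq> -1" using M(2) unfolding aff_dim_empty .
    then have "0 \<le> aff_dim (?E \<inter> {u. W \<bullet> u = M})" using aff_dim_geq[of "?E \<inter> {u. W \<bullet> u = M}"] by linarith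
    then show ?thesis using M neg small by (intro exI[of _ W] exI[of _ M]) simp
  qed
qed

theorem proposition5p3:
  fixes I :: "(3, 'k::field) mpoly set"
    and s t k :: nat
    and w h :: "nat \<Rightarrow> real ^ 3"
    and b c :: "nat \<Rightarrow> real"
  assumes "infinite (UNIV :: 'k set)"
    and "monomial_ideal I"
    and "polytope_description (newton_polytope I) s w b t h c"
    and "\<exists>\<alpha> \<beta>. negative_combination s w t h \<alpha> \<beta>"
    and "k = (LEAST m. \<exists>\<alpha> \<beta>. negative_combination s w t h \<alpha> \<beta> \<and>
                card {j. j < t \<and> \<beta> j \<noteq> 0} = m)"
  shows "analytic_spread I = ereal (4 - (real s + real k))"
proof -
  obtain H where H: "H \<subseteq> range monom_of" "I = Idl\<^bsub>poly_ring\<^esub> H"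
    using assms(2) by (auto simp: monomial_ideal_def)
  define M0 where "M0 = monom_of -` H"
  have HM: "H = monom_of ` M0" using H(1) by (auto simp: M0_def)
  define G where "G = min_exps M0"
  have IG: "I = monomial_span G"
    unfolding H(2) HM Idl_monomials G_def by (rule monomial_span_min_exps[symmetric])
  have anti: "\<And>a b. a \<in> G \<Longrightarrow> b \<in> G \<Longrightarrow> dv a b \<Longrightarrow> a = b"
    unfolding G_def by (rule min_exps_antichain)
  have fin: "finite G" using finite_antichain[of G] anti by blast
  have gens: "min_monomial_gens I = monom_of ` G"
    unfolding H(2) HM Idl_monomials G_def by (rule min_monomial_gens_eq)
  have "{b. monom_of b \<in> min_monomial_gens I} = G"
    unfolding gens using monom_of_inj by (auto dest: injD)
  then have NP: "newton_polytope I = newton G"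
    by (simp add: newton_polytope_def newton_def expvec_def[abs_def])
  note desc = assms(3)[unfolded NP]
  interpret rees G "TYPE('k)" .
  \<comment> \<open>This will be the largest dimension of a compact face, and \<open>d + 1\<close>
    the analytic spread.\<close>
  define d where "d = 3 - int s - int k"
  obtain W :: "real ^ 3" and M where W: "\<forall>l. W $ l < 0" "\<forall>u\<in>newton G. W \<bullet> u \<le> M"
     "newton G \<inter> {u. W \<bullet> u = M} \<noteq> {}" "d \<le> aff_dim (newton G \<inter> {u. W \<bullet> u = M})"
    using ex_face_ge[OF fin anti desc assms(4,5)] unfolding d_def by blast
  have upper: "aff_dim (newton G \<inter> {u. W \<bullet> u = M}) \<le> d"
    if "\<forall>l. W $ l < 0" "\<forall>u\<in>newton G. W \<bullet> u \<le> M" "newton G \<inter> {u. W \<bullet> u = M} \<noteq> {}" for W :: "real ^ 3" and M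
    using aff_dim_face_le[OF desc that assms(5)] by (simp add: d_def)
  have eq: "aff_dim (newton G \<inter> {u. W \<bullet> u = M}) = d" using upper[OF W(1-3)] W(4) by simp
  \<comment> \<open>A nonempty face of dimension \<open>d\<close> exists, so \<open>d\<close> is
    nonnegative; the upper bound then also covers hyperplanes that miss the polytope.\<close>
  have "aff_dim (newton G \<inter> {u. W \<bullet> u = M}) \<noteq> -1" using W(3) unfolding aff_dim_empty .
  then have d0: "0 \<le> d" using eq aff_dim_geq[of "newton G \<inter> {u. W \<bullet> u = M}"] by linarith
  have "krull_dim (fiber_ring A) \<le> ereal (real_of_int (d + 1))"
  proof (rule krull_dim_le[OF fin])
    fix W :: "real ^ 3" and M assume *: "\<forall>l. W $ l < 0" "\<forall>u\<in>newton G. W \<bullet> u \<le> M"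
    show "aff_dim (newton G \<inter> {u. W \<bullet> u = M}) \<le> d"
    proof (cases "newton G \<inter> {u. W \<bullet> u = M} = {}")
      case False
      then show ?thesis by (rule upper[OF *])
    qed (use d0 in simp)
  qed (use d0 in simp)
  moreover have "krull_dim (fiber_ring A) \<ge> ereal (real (nat (d + 1)))"
    by (rule krull_dim_ge_face[OF fin, of W M]) (use W eq d0 in auto)
  ultimately have "krull_dim (fiber_ring A) = ereal (real_of_int (d + 1))" using d0 by simp
  then show ?thesis unfolding IG analytic_spread_eq by (simp add: d_def)
qed

end
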